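(* A spectral measure over $\mathbb{T}^2$ for the group $\mathrm{F}=\Sigma(72\times3)\subset SU(3)$ (of order 216) is $$\mathrm{d}\varepsilon=\frac{1}{32\pi^4}J^2\,\mathrm{d}^{(4)}+\frac{1}{216\pi^4}J^2\,\mathrm{d}^{(3)}+\frac16\,\mathrm{d}^{(2)}-\frac1{36}\,\mathrm{d}^{(1)}.$$
   Context: Let $\omega=e^{2\pi i/3}$ and $\sqrt{-3}=i\sqrt3$. $\mathrm{F}=\Sigma(72\times3)$ is the subgroup of $SU(3)$ of order 216 generated by $S_1=\mathrm{diag}(1,\omega,\omega^2)$, $S_2=\mathrm{diag}(\omega,\omega,\omega)$, $T=\begin{pmatrix}0&1&0\\0&0&1\\1&0&0\end{pmatrix}$, $V=\frac{1}{\sqrt{-3}}\begin{pmatrix}1&1&1\\1&\omega&\omega^2\\1&\omega^2&\omega\end{pmatrix}$ and $W=\frac{1}{\sqrt{-3}}\begin{pmatrix}1&1&\omega^2\\1&\omega&\omega\\\omega&1&\omega\end{pmatrix}$. For a finite subgroup $\Gamma\subset SU(3)$ let $\rho$ be the 3-dimensional representation given by the inclusion. The McKay graph $\mathcal{G}_\Gamma$ has as vertices the irreducible representations of $\Gamma$ (up to isomorphism), with adjacency matrix $\Delta_{\sigma,\sigma'}$ = multiplicity of $\sigma'$ in $\rho\otimes\sigma$; $\Delta$ is normal. Let $e_1$ be the basis vector of the trivial representation. With $\mathbb{T}$ the unit circle and $R_{m,n}(\omega_1,\omega_2)=(\omega_1+\omega_2^{-1}+\omega_1^{-1}\omega_2)^{m}(\omega_1^{-1}+\omega_2+\omega_1\omega_2^{-1})^{n}$,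 a measure $\varepsilon$ on $\mathbb{T}^2$ is called a spectral measure over $\mathbb{T}^2$ of $\Gamma$ if $\int_{\mathbb{T}^2}R_{m,n}\,\mathrm{d}\varepsilon=\langle\Delta^{m}(\Delta^\ast)^{n} e_1,e_1\rangle$ for all integers $m,n\ge0$. For $N\in\mathbb{N}$, $\mathrm{d}^{(N)}$ is the uniform probability measure on $D_N=\{(e^{2\pi iq_1/3N},e^{2\pi iq_2/3N}) : q_1,q_2\in\{0,\dots,3N-1\},\ q_1+q_2\equiv0 \bmod 3\}$. $J$ is the function on $\mathbb{T}^2$ given at $(e^{2\pi i\theta_1},e^{2\pi i\theta_2})$ by $J=4\pi^2\big(\sin(2\pi(\theta_1+\theta_2))-\sin(2\pi(2\theta_1-\theta_2))-\sin(2\pi(2\theta_2-\theta_1))\big)$, and $J^2\mathrm{d}^{(N)}$ is the measure with density $J^2$ with respect to $\mathrm{d}^{(N)}$. *)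

theory Defs
  imports
    "HOL-Analysis.Bochner_Integration"
    "HOL-Algebra.Generated_Groups"
    "Jordan_Normal_Form.VS_Connect"
    "Jordan_Normal_Form.Schur_Decomposition"
begin

section \<open>The special unitary group and \<open>\<Sigma>(72\<times>3)\<close>\<close>

definition SU :: "nat \<Rightarrow> complex mat monoid" where
  "SU n = \<lparr>carrier = {A \<in> carrier_mat n n. A * mat_adjoint A = 1\<^sub>m n \<and> det A = 1},
           mult = (*), one = 1\<^sub>m n\<rparr>"

definition \<omega> :: complex where
  "\<omega> = exp (2 * of_real pi * \<i> / 3)"

definition sqrt_m3 :: complex where
  "sqrt_m3 = \<i> * of_real (sqrt 3)"

definition S1_mat :: "complex mat" where
  "S1_mat = mat_of_rows_list 3 [[1, 0, 0], [0, \<omega>, 0], [0, 0, \<omega>\<^sup>2]]"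

definition S2_mat :: "complex mat" where
  "S2_mat = mat_of_rows_list 3 [[\<omega>, 0, 0], [0, \<omega>, 0], [0, 0, \<omega>]]"

definition T_mat :: "complex mat" where
  "T_mat = mat_of_rows_list 3 [[0, 1, 0], [0, 0, 1], [1, 0, 0]]"

definition V_mat :: "complex mat" where
  "V_mat = (1 / sqrt_m3) \<cdot>\<^sub>m
     mat_of_rows_list 3 [[1, 1, 1], [1, \<omega>, \<omega>\<^sup>2], [1, \<omega>\<^sup>2, \<omega>]]"

definition W_mat :: "complex mat" where
  "W_mat = (1 / sqrt_m3) \<cdot>\<^sub>m
     mat_of_rows_list 3 [[1, 1, \<omega>\<^sup>2], [1, \<omega>, \<omega>], [\<omega>, 1, \<omega>]]"

definition Sigma_72x3 :: "complex mat set" where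
  "Sigma_72x3 = generate (SU 3) {S1_mat, S2_mat, T_mat, V_mat, W_mat}"


section \<open>Finite-dimensional complex representations\<close>

text \<open>A representation is a pair of its degree and a map into matrices of that size. Only the
  values of the map on the carrier of the group matter.\<close>

type_synonym 'g crep = "nat \<times> ('g \<Rightarrow> complex mat)"

definition GL :: "nat \<Rightarrow> complex mat monoid" where
  "GL n = units_of (ring_mat TYPE(complex) n ())"

definition is_rep :: "'g monoid \<Rightarrow> 'g crep \<Rightarrow> bool" where
  "is_rep G r \<longleftrightarrow> snd r \<in> hom G (GL (fst r))"

definition invariant_subspace :: "'g monoid \<Rightarrow> 'g crep \<Rightarrow> complex vec set \<Rightarrow> bool" where
  "invariant_subspace G r U \<longleftrightarrow>
     VectorSpace.subspace class_ring U (module_vec TYPE(complex) (fst r)) \<and>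
     (\<forall>g\<in>carrier G. \<forall>u\<in>U. snd r g *\<^sub>v u \<in> U)"

definition irreducible_rep :: "'g monoid \<Rightarrow> 'g crep \<Rightarrow> bool" where
  "irreducible_rep G r \<longleftrightarrow> is_rep G r \<and> fst r > 0 \<and>
     (\<forall>U. invariant_subspace G r U \<longrightarrow> U = {0\<^sub>v (fst r)} \<or> U = carrier_vec (fst r))"

definition rep_iso :: "'g monoid \<Rightarrow> 'g crep \<Rightarrow> 'g crep \<Rightarrow> bool" where
  "rep_iso G r s \<longleftrightarrow> fst r = fst s \<and>
     (\<exists>P\<in>carrier (GL (fst r)). \<forall>g\<in>carrier G. P * snd r g = snd s g * P)"

definition rep_dsum :: "'g crep list \<Rightarrow> 'g crep" where
  "rep_dsum rs = (sum_list (map fst rs), \<lambda>g. diag_block_mat (map (\<lambda>r. snd r g) rs))"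

definition kronecker :: "complex mat \<Rightarrow> complex mat \<Rightarrow> complex mat" where
  "kronecker A B = mat (dim_row A * dim_row B) (dim_col A * dim_col B)
     (\<lambda>(i, j). A $$ (i div dim_row B, j div dim_col B) * B $$ (i mod dim_row B, j mod dim_col B))"

definition rep_tensor :: "'g crep \<Rightarrow> 'g crep \<Rightarrow> 'g crep" where
  "rep_tensor r s = (fst r * fst s, \<lambda>g. kronecker (snd r g) (snd s g))"

definition trivial_rep :: "'g crep" where
  "trivial_rep = (1, \<lambda>_. 1\<^sub>m 1)"

text \<open>The multiplicity of an irreducible \<open>s\<close> in \<open>r\<close>: the number of summands isomorphic to \<open>s\<close>
  in a decomposition of \<open>r\<close> into irreducibles. For a finite group such a decomposition exists
  (Maschke) and the number does not depend on it (Krull--Schmidt), so the description is proper.\<close>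

definition multiplicity_rep :: "'g monoid \<Rightarrow> 'g crep \<Rightarrow> 'g crep \<Rightarrow> nat" where
  "multiplicity_rep G s r = (THE k. \<exists>rs. (\<forall>t\<in>set rs. irreducible_rep G t) \<and>
     rep_iso G r (rep_dsum rs) \<and> k = length (filter (rep_iso G s) rs))"

definition irrep_iso_rel :: "'g monoid \<Rightarrow> ('g crep \<times> 'g crep) set" where
  "irrep_iso_rel G = {(r, s). irreducible_rep G r \<and> irreducible_rep G s \<and> rep_iso G r s}"

definition Irr :: "'g monoid \<Rightarrow> 'g crep set set" where
  "Irr G = {r. irreducible_rep G r} // irrep_iso_rel G"

definition class_rep :: "'g crep set \<Rightarrow> 'g crep" where
  "class_rep C = (SOME r. r \<in> C)"


section \<open>The McKay graph and its adjacency matrix\<close>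

text \<open>Matrices and vectors over a finite index set \<open>I\<close> are functions, of which only the values on
  \<open>I\<close> matter.\<close>

definition mat_act :: "'i set \<Rightarrow> ('i \<Rightarrow> 'i \<Rightarrow> complex) \<Rightarrow> ('i \<Rightarrow> complex) \<Rightarrow> ('i \<Rightarrow> complex)" where
  "mat_act I A v = (\<lambda>i. \<Sum>j\<in>I. A i j * v j)"

definition mat_star :: "('i \<Rightarrow> 'i \<Rightarrow> complex) \<Rightarrow> ('i \<Rightarrow> 'i \<Rightarrow> complex)" where
  "mat_star A = (\<lambda>i j. cnj (A j i))"

definition inner_on :: "'i set \<Rightarrow> ('i \<Rightarrow> complex) \<Rightarrow> ('i \<Rightarrow> complex) \<Rightarrow> complex" where
  "inner_on I u v = (\<Sum>i\<in>I. u i * cnj (v i))"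

definition as_group :: "complex mat set \<Rightarrow> complex mat monoid" where
  "as_group \<Gamma> = (SU 3)\<lparr>carrier := \<Gamma>\<rparr>"

definition inclusion_rep :: "complex mat crep" where
  "inclusion_rep = (3, \<lambda>g. g)"

definition mckay_vertices :: "complex mat set \<Rightarrow> complex mat crep set set" where
  "mckay_vertices \<Gamma> = Irr (as_group \<Gamma>)"

definition mckay_adj ::
    "complex mat set \<Rightarrow> complex mat crep set \<Rightarrow> complex mat crep set \<Rightarrow> complex" where
  "mckay_adj \<Gamma> C C' = of_nat (multiplicity_rep (as_group \<Gamma>) (class_rep C')
     (rep_tensor inclusion_rep (class_rep C)))"

definition mckay_e1 :: "complex mat crep set \<Rightarrow> complex" where
  "mckay_e1 C = (if trivial_rep \<in> C then 1 else 0)"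

definition mckay_moment :: "complex mat set \<Rightarrow> nat \<Rightarrow> nat \<Rightarrow> complex" where
  "mckay_moment \<Gamma> m n =
    (let I = mckay_vertices \<Gamma>; \<Delta> = mckay_adj \<Gamma> in
      inner_on I ((mat_act I \<Delta> ^^ m) ((mat_act I (mat_star \<Delta>) ^^ n) mckay_e1)) mckay_e1)"


section \<open>Measures on the torus\<close>

definition T2 :: "(complex \<times> complex) set" where
  "T2 = sphere 0 1 \<times> sphere 0 1"

definition borel_T2 :: "(complex \<times> complex) measure" where
  "borel_T2 = restrict_space borel T2"

definition R_fun :: "nat \<Rightarrow> nat \<Rightarrow> complex \<times> complex \<Rightarrow> complex" where
  "R_fun m n = (\<lambda>(w1, w2).
     (w1 + inverse w2 + inverse w1 * w2) ^ m * (inverse w1 + w2 + w1 * inverse w2) ^ n)"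

definition spectral_measure_T2 ::
    "complex mat set \<Rightarrow> (complex \<times> complex) measure \<Rightarrow> bool" where
  "spectral_measure_T2 \<Gamma> \<epsilon> \<longleftrightarrow> sets \<epsilon> = sets borel_T2 \<and> finite_measure \<epsilon> \<and>
     (\<forall>m n. (\<integral>p. R_fun m n p \<partial>\<epsilon>) = mckay_moment \<Gamma> m n)"

definition D_set :: "nat \<Rightarrow> (complex \<times> complex) set" where
  "D_set N = {(cis (2 * pi * real q1 / (3 * real N)), cis (2 * pi * real q2 / (3 * real N))) |
     q1 q2 :: nat. q1 < 3 * N \<and> q2 < 3 * N \<and> (q1 + q2) mod 3 = 0}"

text \<open>The uniform probability measure on \<open>D_set N\<close>, as a Borel measure on \<open>T2\<close>.\<close>

definition d_measure :: "nat \<Rightarrow> (complex \<times> complex) measure" where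
  "d_measure N = distr (uniform_count_measure (D_set N)) borel_T2 (\<lambda>p. p)"

definition J_angle :: "real \<Rightarrow> real \<Rightarrow> real" where
  "J_angle \<theta>1 \<theta>2 = 4 * pi\<^sup>2 * (sin (2 * pi * (\<theta>1 + \<theta>2)) -
     sin (2 * pi * (2 * \<theta>1 - \<theta>2)) - sin (2 * pi * (2 * \<theta>2 - \<theta>1)))"

text \<open>Since \<open>J_angle\<close> is 1-periodic in both arguments, the choice of the branch of the argument
  is immaterial; see \<open>J_fun_cis\<close> below.\<close>

definition J_fun :: "complex \<times> complex \<Rightarrow> real" where
  "J_fun = (\<lambda>(w1, w2). J_angle (Arg w1 / (2 * pi)) (Arg w2 / (2 * pi)))"

definition J2_measure :: "nat \<Rightarrow> (complex \<times> complex) measure" where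
  "J2_measure N = density (d_measure N) (\<lambda>p. ennreal ((J_fun p)\<^sup>2))"

lemma J_angle_shift: "J_angle (\<theta>1 + of_int k) (\<theta>2 + of_int l) = J_angle \<theta>1 \<theta>2"
proof -
  have per: "sin (x + 2 * pi * of_int i) = sin x" for x :: real and i :: int
    using sin_int_2pin[of i] cos_int_2pin[of i] by (simp add: sin_add)
  have e1: "2 * pi * ((\<theta>1 + of_int k) + (\<theta>2 + of_int l)) =
      2 * pi * (\<theta>1 + \<theta>2) + 2 * pi * of_int (k + l)"
    by (simp add: algebra_simps)
  have e2: "2 * pi * (2 * (\<theta>1 + of_int k) - (\<theta>2 + of_int l)) =
      2 * pi * (2 * \<theta>1 - \<theta>2) + 2 * pi * of_int (2 * k - l)"
    by (simp add: algebra_simps)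
  have e3: "2 * pi * (2 * (\<theta>2 + of_int l) - (\<theta>1 + of_int k)) =
      2 * pi * (2 * \<theta>2 - \<theta>1) + 2 * pi * of_int (2 * l - k)"
    by (simp add: algebra_simps)
  show ?thesis
    unfolding J_angle_def e1 e2 e3 per ..
qed

lemma J_fun_cis: "J_fun (cis (2 * pi * \<theta>1), cis (2 * pi * \<theta>2)) = J_angle \<theta>1 \<theta>2"
proof -
  have arg: "\<exists>k::int. Arg (cis (2 * pi * t)) / (2 * pi) = t + of_int k" for t :: real
  proof -
    have "cis (Arg (cis (2 * pi * t))) = cis (2 * pi * t)"
      using cis_Arg[of "cis (2 * pi * t)"] by (simp add: sgn_eq)
    then have "sin (Arg (cis (2 * pi * t))) = sin (2 * pi * t)
        \<and> cos (Arg (cis (2 * pi * t))) = cos (2 * pi * t)"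
      by (simp add: complex_eq_iff)
    then obtain k :: int where "Arg (cis (2 * pi * t)) = 2 * pi * t + 2 * pi * of_int k"
      using sin_cos_eq_iff by (metis mult.commute mult.left_commute)
    then have "Arg (cis (2 * pi * t)) / (2 * pi) = t + of_int k"
      by (simp add: field_simps)
    then show ?thesis ..
  qed
  obtain k l :: int where "Arg (cis (2 * pi * \<theta>1)) / (2 * pi) = \<theta>1 + of_int k"
      "Arg (cis (2 * pi * \<theta>2)) / (2 * pi) = \<theta>2 + of_int l"
    using arg by metis
  then show ?thesis
    by (simp add: J_fun_def J_angle_shift)
qed

lemma D_set_subset_T2: "D_set N \<subseteq> T2"
  by (auto simp: D_set_def T2_def)

end

theory Submission
  imports Defs "Jordan_Normal_Form.Spectral_Radius"
begin

text \<open>Since multiplicities are character pairings, \<open>\<chi>\<^sup>n\<close> has the coordinates of \<open>(\<Delta>\<^sup>*)\<^sup>n e\<^sub>1\<close> in the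
  orthonormal basis of irreducible characters, where \<open>\<chi>\<close> is the character of the inclusion; hence
  the moments of the McKay graph are the averages of \<open>\<chi>\<^sup>n cnj \<chi>\<^sup>m\<close> over the group.

  The Heisenberg group \<open>\<langle>S1, S2, T\<rangle>\<close> of order 27 is normal with quotient \<open>Q\<^sub>8\<close>. On the coset of
  1 the trace is \<open>3\<omega>\<^sup>a\<close> at the three central elements and 0 elsewhere, on the coset of \<open>V\<^sup>2\<close> it is
  \<open>-\<omega>\<^sup>a\<close>, and on the other six cosets it is \<open>\<omega>\<^sup>a\<close>. The same values arise at the points of \<open>D_set N\<close>:
  \<open>J\<^sup>2\<close> keeps the points with distinct eigenvalues, which up to the center of \<open>SU(3)\<close> are permutations
  of \<open>(1, \<i>, -\<i>)\<close> for \<open>N = 4\<close> and of \<open>(1, \<omega>, \<omega>\<^sup>2)\<close> for \<open>N = 3\<close>; the points for \<open>N = 1, 2\<close>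
  give the center and the permutations of \<open>(1, -1, -1)\<close>.\<close>

section \<open>Traces, sums of matrices and adapted bases\<close>

text \<open>Both sides are combinations of \<open>center_moment m n t\<close> for t = 3, -1, 1, 0,
  and this fixes the constants. The group average has coefficients 1/216, 9/216, 54/216 and 8/216.
  For N = 4, six classes of points modulo the center have J^2 = 64 pi^4, and 6 * 64 pi^4 / (32 pi^4
  * 48) = 54/216; for N = 3, two classes have J^2 = 108 pi^4, and 2 * 108 pi^4 / (216 pi^4 * 27) =
  8/216. The factor 1/6 on the 12 points of \<open>D_set 2\<close> gives 3/72 = 9/216 at t = -1, but
  3/216 instead of 1/216 at t = 3; the negative term corrects that excess. As \<open>D_set 1\<close>
  lies in \<open>D_set 2\<close>, positivity survives. The exponents need care: the graph yields
  \<chi>^n cnj \<chi>^m, while \<open>R_fun m n\<close> yields \<chi>^m cnj \<chi>^n. The two agree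
  after summation over the center because all four t are real. \<open>multiplicity_rep\<close> is a
  definite description, so character theory applies only after Maschke's theorem (a decomposition
  exists) and Schur's lemma (the count is independent of it). Sums over the irreducibles also
  require that there are finitely many of them.\<close>

definition mat_trace :: "'a::comm_monoid_add mat \<Rightarrow> 'a" where
  "mat_trace A = (\<Sum>i<dim_row A. A $$ (i, i))"

lemma index_mult_mat_sum:
  assumes "A \<in> carrier_mat n m" "B \<in> carrier_mat m k" "i < n" "j < k"
  shows "(A * B) $$ (i, j) = (\<Sum>l<m. A $$ (i, l) * B $$ (l, j))"
  using assms by (auto simp: scalar_prod_def atLeast0LessThan)

lemma mat_trace_mult_commute:
  fixes A B :: "'a::comm_semiring_0 mat"
  assumes "A \<in> carrier_mat n m" "B \<in> carrier_mat m n"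
  shows "mat_trace (A * B) = mat_trace (B * A)"
proof -
  have "mat_trace (A * B) = (\<Sum>i<n. \<Sum>j<m. A $$ (i, j) * B $$ (j, i))"
    using assms by (auto simp: mat_trace_def index_mult_mat_sum[OF assms] simp del: index_mult_mat(1) intro!: sum.cong)
  also have "\<dots> = (\<Sum>j<m. \<Sum>i<n. B $$ (j, i) * A $$ (i, j))"
    by (subst sum.swap) (simp add: mult.commute)
  also have "\<dots> = mat_trace (B * A)"
    using assms by (auto simp: mat_trace_def index_mult_mat_sum[OF assms(2,1)] simp del: index_mult_mat(1) intro!: sum.cong)
  finally show ?thesis .
qed

lemma mat_trace_four_block:
  assumes "A \<in> carrier_mat n n" "D \<in> carrier_mat m m"
  shows "mat_trace (four_block_mat A B C D) = mat_trace A + mat_trace D"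
proof -
  have "(\<Sum>i<n+m. four_block_mat A B C D $$ (i, i))
      = (\<Sum>i<n. four_block_mat A B C D $$ (i, i)) + (\<Sum>i<m. four_block_mat A B C D $$ (n + i, n + i))"
    by (induction m) (simp_all add: add.assoc)
  then show ?thesis using assms by (simp add: mat_trace_def)
qed

text \<open>The size is an argument because matrices of all sizes share one type, and an empty sum
  must still be the zero matrix of a definite size.\<close>

definition mat_sum :: "nat \<Rightarrow> nat \<Rightarrow> ('i \<Rightarrow> 'a::comm_monoid_add mat) \<Rightarrow> 'i set \<Rightarrow> 'a mat" where
  "mat_sum n m f S = mat n m (\<lambda>ij. \<Sum>s\<in>S. f s $$ ij)"

lemma mat_sum_carrier [simp]: "mat_sum n m f S \<in> carrier_mat n m"
  by (simp add: mat_sum_def)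

lemma mat_sum_cong:
  assumes "\<And>s. s \<in> S \<Longrightarrow> f s = g s"
  shows "mat_sum n m f S = mat_sum n m g S"
  using assms by (simp add: mat_sum_def)

lemma mat_sum_reindex:
  assumes "bij_betw h S T"
  shows "mat_sum n m (\<lambda>s. f (h s)) S = mat_sum n m f T"
  unfolding mat_sum_def by (subst sum.reindex_bij_betw[OF assms]) (rule refl)

lemma mult_mat_sum:
  fixes A :: "'a::comm_semiring_0 mat"
  assumes "A \<in> carrier_mat k n" "\<And>s. s \<in> S \<Longrightarrow> f s \<in> carrier_mat n m"
  shows "A * mat_sum n m f S = mat_sum k m (\<lambda>s. A * f s) S"
proof (rule eq_matI)
  fix i j assume "i < dim_row (mat_sum k m (\<lambda>s. A * f s) S)" "j < dim_col (mat_sum k m (\<lambda>s. A * f s) S)"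
  then have ij: "i < k" "j < m" by (auto simp: mat_sum_def)
  have "(A * mat_sum n m f S) $$ (i, j) = (\<Sum>l<n. \<Sum>s\<in>S. A $$ (i, l) * f s $$ (l, j))"
    using ij by (subst index_mult_mat_sum[OF assms(1) mat_sum_carrier])
      (auto simp: mat_sum_def sum_distrib_left)
  also have "\<dots> = (\<Sum>s\<in>S. (A * f s) $$ (i, j))"
    by (subst sum.swap) (rule sum.cong[OF refl], rule index_mult_mat_sum[OF assms(1) assms(2) ij, symmetric])
  finally show "(A * mat_sum n m f S) $$ (i, j) = mat_sum k m (\<lambda>s. A * f s) S $$ (i, j)"
    using ij by (simp add: mat_sum_def)
qed (use assms(1) in \<open>auto simp: mat_sum_def\<close>)

lemma mat_sum_mult:
  fixes A :: "'a::comm_semiring_0 mat"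
  assumes "A \<in> carrier_mat m k" "\<And>s. s \<in> S \<Longrightarrow> f s \<in> carrier_mat n m"
  shows "mat_sum n m f S * A = mat_sum n k (\<lambda>s. f s * A) S"
proof (rule eq_matI)
  fix i j assume "i < dim_row (mat_sum n k (\<lambda>s. f s * A) S)" "j < dim_col (mat_sum n k (\<lambda>s. f s * A) S)"
  then have ij: "i < n" "j < k" by (auto simp: mat_sum_def)
  have "(mat_sum n m f S * A) $$ (i, j) = (\<Sum>l<m. \<Sum>s\<in>S. f s $$ (i, l) * A $$ (l, j))"
    using ij by (subst index_mult_mat_sum[OF mat_sum_carrier assms(1)])
      (auto simp: mat_sum_def sum_distrib_right)
  also have "\<dots> = (\<Sum>s\<in>S. (f s * A) $$ (i, j))"
    by (subst sum.swap) (rule sum.cong[OF refl], rule index_mult_mat_sum[OF assms(2) assms(1) ij, symmetric])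
  finally show "(mat_sum n m f S * A) $$ (i, j) = mat_sum n k (\<lambda>s. f s * A) S $$ (i, j)"
    using ij by (simp add: mat_sum_def)
qed (use assms(1) in \<open>auto simp: mat_sum_def\<close>)

section \<open>Invertible matrices, representations and invariant subspaces in matrix terms\<close>

lemma carrier_GL:
  "P \<in> carrier (GL n) \<longleftrightarrow> P \<in> carrier_mat n n \<and> (\<exists>Q\<in>carrier_mat n n. P * Q = 1\<^sub>m n \<and> Q * P = 1\<^sub>m n)"
  by (auto simp: GL_def units_of_def Units_def ring_mat_simps)

lemma GL_simps [simp]: "mult (GL n) = (*)" "one (GL n) = 1\<^sub>m n"
  by (simp_all add: GL_def units_of_def ring_mat_simps)

lemma group_GL: "group (GL n)"
proof -
  interpret ring "ring_mat TYPE(complex) n ()" by (rule ring_mat)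
  show ?thesis unfolding GL_def by (rule units_group)
qed

lemma carrier_GL_det: "P \<in> carrier (GL n) \<longleftrightarrow> P \<in> carrier_mat n n \<and> det P \<noteq> 0"
  unfolding GL_def units_of_def
  using unit_imp_det_non_zero[of P n "()"] det_non_zero_imp_unit[of P n "()"]
  by (auto simp: Units_def ring_mat_simps)

lemma subspace_vec_iff:
  "VectorSpace.subspace class_ring U (module_vec TYPE(complex) n) \<longleftrightarrow>
    U \<subseteq> carrier_vec n \<and> 0\<^sub>v n \<in> U \<and> (\<forall>u\<in>U. \<forall>v\<in>U. u + v \<in> U) \<and> (\<forall>c. \<forall>u\<in>U. c \<cdot>\<^sub>v u \<in> U)"
  (is "?L \<longleftrightarrow> ?R")
proof
  interpret vec_space "TYPE(complex)" n .
  show ?R if ?L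
  proof -
    from that have "LinearCombinations.submodule class_ring U V"
      by (simp add: VectorSpace.subspace_def)
    then show ?thesis
      by (auto simp: LinearCombinations.submodule_def module_vec_simps class_ring_simps)
  qed
  show ?L if ?R
    unfolding VectorSpace.subspace_def
    using that vec_vs[of n] vec_module[of n]
    by (auto simp: LinearCombinations.submodule_def module_vec_simps class_ring_simps class_field_def)
qed

lemma is_rep_iff:
  assumes "Group.group G"
  shows "is_rep G r \<longleftrightarrow> (\<forall>g\<in>carrier G. snd r g \<in> carrier_mat (fst r) (fst r)) \<and>
    (\<forall>g\<in>carrier G. \<forall>h\<in>carrier G. snd r (g \<otimes>\<^bsub>G\<^esub> h) = snd r g * snd r h) \<and>
    snd r \<one>\<^bsub>G\<^esub> = 1\<^sub>m (fst r)" (is "?L \<longleftrightarrow> ?R")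
proof
  interpret G: Group.group G by fact
  interpret GL: Group.group "GL (fst r)" by (rule group_GL)
  show ?R if ?L
  proof -
    from that have h: "snd r \<in> hom G (GL (fst r))" by (simp add: is_rep_def)
    then have "snd r \<one>\<^bsub>G\<^esub> = \<one>\<^bsub>GL (fst r)\<^esub>"
      using hom_one[OF h G.group_axioms GL.group_axioms] by simp
    with h show ?thesis
      by (auto simp: hom_def carrier_GL)
  qed
  show ?L if R: ?R
    unfolding is_rep_def hom_def
  proof (intro CollectI conjI ballI funcsetI)
    fix g assume g: "g \<in> carrier G"
    have "snd r g * snd r (inv\<^bsub>G\<^esub> g) = 1\<^sub>m (fst r)" "snd r (inv\<^bsub>G\<^esub> g) * snd r g = 1\<^sub>m (fst r)"
      using R g by (metis G.inv_closed G.r_inv, metis G.inv_closed G.l_inv g)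
    then show "snd r g \<in> carrier (GL (fst r))"
      using R g unfolding carrier_GL by blast
  qed (use R in auto)
qed

lemma mat_unit_vec_col:
  assumes "A \<in> carrier_mat n m" "j < m"
  shows "A *\<^sub>v unit_vec m j = (col A j :: 'a::semiring_1 vec)"
  using assms by (intro eq_vecI) auto

text \<open>Steinitz exchange, with k in the role of dim U: take k maximal such that the first k
  columns of some invertible P lie in U. A vector of U with a nonzero coordinate beyond these
  columns could be exchanged into position k, against maximality.\<close>

lemma subspace_adapted_basis:
  fixes U :: "complex vec set"
  assumes U: "U \<subseteq> carrier_vec n" "0\<^sub>v n \<in> U" "\<And>u v. u \<in> U \<Longrightarrow> v \<in> U \<Longrightarrow> u + v \<in> U"
    "\<And>c u. u \<in> U \<Longrightarrow> c \<cdot>\<^sub>v u \<in> U"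
  obtains P k where "P \<in> carrier (GL n)" "k \<le> n"
    "U = {P *\<^sub>v v | v. v \<in> carrier_vec n \<and> (\<forall>j. k \<le> j \<and> j < n \<longrightarrow> v $ j = 0)}"
proof -
  define Q where "Q k \<longleftrightarrow> k \<le> n \<and> (\<exists>P\<in>carrier (GL n). \<forall>j<k. col P j \<in> U)" for k
  have "Q 0"
    unfolding Q_def using group.is_monoid[OF group_GL, of n] monoid.one_closed by fastforce
  then obtain k where k: "Q k" and max: "\<And>j. Q j \<Longrightarrow> j \<le> k"
    using Nat.ex_has_greatest_nat[of Q 0 n] Q_def by auto
  from k obtain P where P: "P \<in> carrier (GL n)" and PU: "\<And>j. j < k \<Longrightarrow> col P j \<in> U" and kn: "k \<le> n"
    unfolding Q_def by auto
  have Pc: "P \<in> carrier_mat n n" and dP: "det P \<noteq> 0" using P by (auto simp: carrier_GL_det)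
  obtain P' where P': "P' \<in> carrier_mat n n" "P * P' = 1\<^sub>m n" "P' * P = 1\<^sub>m n"
    using P by (auto simp: carrier_GL)
  have sup: "P *\<^sub>v v \<in> U" if "l \<le> k" "v \<in> carrier_vec n" "\<forall>j. l \<le> j \<and> j < n \<longrightarrow> v $ j = 0" for l v
    using that
  proof (induction l arbitrary: v)
    case 0
    then have "P *\<^sub>v v = 0\<^sub>v n" using Pc by (intro eq_vecI) (auto simp: scalar_prod_def)
    then show ?case using U(2) by simp
  next
    case (Suc l)
    let ?w = "vec n (\<lambda>j. if j = l then 0 else v $ j)"
    have "v = ?w + v $ l \<cdot>\<^sub>v unit_vec n l"
      using Suc.prems kn by (auto simp: unit_vec_def)
    then have "P *\<^sub>v v = P *\<^sub>v ?w + P *\<^sub>v (v $ l \<cdot>\<^sub>v unit_vec n l)"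
      using Pc by (metis mult_add_distrib_mat_vec smult_carrier_vec unit_vec_carrier vec_carrier)
    also have "P *\<^sub>v (v $ l \<cdot>\<^sub>v unit_vec n l) = v $ l \<cdot>\<^sub>v col P l"
      using Pc Suc.prems kn by (simp add: mult_mat_vec mat_unit_vec_col)
    finally show ?case
      using Suc.IH[of ?w] Suc.prems U(3,4) PU[of l] by (auto simp: not_less_eq_eq le_Suc_eq Suc_le_eq)
  qed
  have "u \<in> {P *\<^sub>v v | v. v \<in> carrier_vec n \<and> (\<forall>j. k \<le> j \<and> j < n \<longrightarrow> v $ j = 0)}" if u: "u \<in> U" for u
  proof -
    have uc: "u \<in> carrier_vec n" using u U(1) by auto
    define y where "y = P' *\<^sub>v u"
    have yc: "y \<in> carrier_vec n" and uy: "u = P *\<^sub>v y"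
      unfolding y_def using P' Pc uc
      by (auto simp: assoc_mult_mat_vec[symmetric])
    have "y $ j = 0" if j: "k \<le> j" "j < n" for j
    proof (rule ccontr)
      assume yj: "y $ j \<noteq> 0"
      \<comment> \<open>P * E keeps the first k columns of P, puts u in position k and, if j differs
        from k, moves column k of P to position j. The exchange is invertible because y_j is
        nonzero.\<close>
      define E where "E = mat n n (\<lambda>(a, b). if b = k then y $ a else if b = j then (if a = k then 1 else 0)
        else if a = b then 1 else 0)"
      have Ec: "E \<in> carrier_mat n n" by (simp add: E_def)
      have colk: "col (P * E) k = u"
      proof -
        have "col E k = y" using yc j kn unfolding E_def by (intro eq_vecI) auto
        then show ?thesis using col_mult2[OF Pc Ec, of k] j uy by simp
      qed
      have coli: "col (P * E) i = col P i" if "i < k" for i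
      proof -
        have "col E i = unit_vec n i" using that j unfolding E_def unit_vec_def by (intro eq_vecI) auto
        then show ?thesis using col_mult2[OF Pc Ec, of i] that kn Pc by (simp add: mat_unit_vec_col)
      qed
      have "det E \<noteq> 0"
      proof
        assume "det E = 0"
        then obtain v where v: "v \<in> carrier_vec n" "v \<noteq> 0\<^sub>v n" "E *\<^sub>v v = 0\<^sub>v n"
          using det_0_iff_vec_prod_zero_field[OF Ec] by auto
        have ent: "(\<Sum>b<n. E $$ (a, b) * v $ b) = 0" if "a < n" for a
        proof -
          have "(E *\<^sub>v v) $ a = 0" using v(3) that by simp
          then show ?thesis using that v(1) Ec by (simp add: scalar_prod_def atLeast0LessThan)
        qed
        have split: "(\<Sum>b<n. E $$ (a, b) * v $ b) = y $ a * v $ k +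
            (\<Sum>b\<in>{..<n} - {k}. E $$ (a, b) * v $ b)" if "a < n" for a
          using that j by (subst sum.remove[of _ k]) (auto simp: E_def)
        \<comment> \<open>The only possibly nonzero entry in row j of E is y_j, in column k.\<close>
        have vk: "v $ k = 0"
        proof -
          have "(\<Sum>b\<in>{..<n} - {k}. E $$ (j, b) * v $ b) = 0"
            using j by (intro sum.neutral) (auto simp: E_def)
          with ent[of j] split[of j] yj j show ?thesis by auto
        qed
        have "v $ a = 0" if a: "a < n" for a
        proof (cases "a = k")
          case True with vk show ?thesis by simp
        next
          case ak: False
          \<comment> \<open>The row of E which, outside column k, has its single 1 in column a; for
            a = j this is row k.\<close>
          define c where "c = (if a = j then k else a)"
          have c: "c < n" using a j by (auto simp: c_def)
          have "(\<Sum>b\<in>{..<n} - {k}. E $$ (c, b) * v $ b) = (\<Sum>b\<in>{..<n} - {k}. if b = a then v $ b else 0)"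
            using c a ak j by (intro sum.cong) (auto simp: E_def c_def)
          also have "\<dots> = v $ a" using a ak by (simp add: sum.delta)
          finally show ?thesis using ent[OF c] split[OF c] vk by simp
        qed
        then have "v = 0\<^sub>v n" using v(1) by auto
        with v(2) show False by simp
      qed
      then have "P * E \<in> carrier (GL n)"
        using Pc Ec dP by (simp add: carrier_GL_det det_mult[OF Pc Ec])
      then have "Q (Suc k)"
        unfolding Q_def using j coli colk u PU by (auto simp: less_Suc_eq intro!: bexI[of _ "P * E"])
      with max[of "Suc k"] show False by simp
    qed
    with uy yc show ?thesis by blast
  qed
  moreover have "{P *\<^sub>v v | v. v \<in> carrier_vec n \<and> (\<forall>j. k \<le> j \<and> j < n \<longrightarrow> v $ j = 0)} \<subseteq> U"
    using sup[of k] by auto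
  ultimately show ?thesis using that[OF P kn] by blast
qed

section \<open>Schur's lemma and the orthogonality of characters\<close>

text \<open>The kernel and the image of P are invariant, so irreducibility makes the kernel zero and
  the image everything. The inverse is assembled column by column from preimages of the unit
  vectors.\<close>

lemma intertwiner_invertible:
  assumes r: "irreducible_rep G r" and s: "irreducible_rep G s" and G: "Group.group G"
    and P: "P \<in> carrier_mat (fst s) (fst r)" and int: "\<And>g. g \<in> carrier G \<Longrightarrow> P * snd r g = snd s g * P"
    and nz: "P \<noteq> 0\<^sub>m (fst s) (fst r)"
  shows "fst r = fst s \<and> P \<in> carrier (GL (fst r))"
proof -
  let ?n = "fst r" and ?m = "fst s"
  have rr: "snd r g \<in> carrier_mat ?n ?n" and ss: "snd s g \<in> carrier_mat ?m ?m" if "g \<in> carrier G" for g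
    using r s that G by (auto simp: irreducible_rep_def is_rep_iff)
  define K where "K = {v \<in> carrier_vec ?n. P *\<^sub>v v = 0\<^sub>v ?m}"
  define I where "I = (\<lambda>v. P *\<^sub>v v) ` carrier_vec ?n"
  have P0: "P *\<^sub>v 0\<^sub>v ?n = 0\<^sub>v ?m" using P by (intro eq_vecI) auto
  have "invariant_subspace G r K"
    unfolding invariant_subspace_def subspace_vec_iff
  proof (intro conjI ballI allI)
    show "snd r g *\<^sub>v u \<in> K" if g: "g \<in> carrier G" and u: "u \<in> K" for g u
    proof -
      have "P *\<^sub>v (snd r g *\<^sub>v u) = snd s g *\<^sub>v (P *\<^sub>v u)"
        using u P rr[OF g] ss[OF g] int[OF g] unfolding K_def
        by (metis (no_types, lifting) assoc_mult_mat_vec mem_Collect_eq)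
      also have "\<dots> = 0\<^sub>v ?m" using u ss[OF g] unfolding K_def by (intro eq_vecI) auto
      finally show ?thesis using u rr[OF g] unfolding K_def by auto
    qed
  qed (use P P0 in \<open>auto simp: K_def mult_add_distrib_mat_vec mult_mat_vec\<close>)
  then have "K = {0\<^sub>v ?n} \<or> K = carrier_vec ?n" using r by (auto simp: irreducible_rep_def)
  moreover have "K \<noteq> carrier_vec ?n"
  proof
    assume K: "K = carrier_vec ?n"
    have "P = 0\<^sub>m ?m ?n"
    proof (rule eq_matI)
      fix i j assume ij: "i < dim_row (0\<^sub>m ?m ?n)" "j < dim_col (0\<^sub>m ?m ?n)"
      then have "unit_vec ?n j \<in> K" using K by auto
      then have "P *\<^sub>v unit_vec ?n j = 0\<^sub>v ?m" by (simp add: K_def)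
      then have "col P j = 0\<^sub>v ?m" using P ij by (simp add: mat_unit_vec_col)
      then have "col P j $ i = 0" using ij by simp
      then show "P $$ (i, j) = 0\<^sub>m ?m ?n $$ (i, j)" using P ij by simp
    qed (use P in auto)
    with nz show False by simp
  qed
  ultimately have K: "K = {0\<^sub>v ?n}" by simp
  have inj: "v = 0\<^sub>v ?n" if "v \<in> carrier_vec ?n" "P *\<^sub>v v = 0\<^sub>v ?m" for v
    using that K unfolding K_def by blast
  have "invariant_subspace G s I"
    unfolding invariant_subspace_def subspace_vec_iff
  proof (intro conjI ballI allI)
    show "I \<subseteq> carrier_vec ?m" using P by (auto simp: I_def)
    show "0\<^sub>v ?m \<in> I" using P0 unfolding I_def by (metis image_eqI zero_carrier_vec)
    show "u + v \<in> I" if uv: "u \<in> I" "v \<in> I" for u v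
    proof -
      from uv obtain x y where "x \<in> carrier_vec ?n" "y \<in> carrier_vec ?n" "u = P *\<^sub>v x" "v = P *\<^sub>v y"
        by (auto simp: I_def)
      then show ?thesis
        using P by (auto simp: I_def mult_add_distrib_mat_vec[symmetric])
    qed
    show "c \<cdot>\<^sub>v u \<in> I" if u: "u \<in> I" for c u
    proof -
      from u obtain x where "x \<in> carrier_vec ?n" "u = P *\<^sub>v x" by (auto simp: I_def)
      then show ?thesis using P by (auto simp: I_def mult_mat_vec[symmetric])
    qed
    show "snd s g *\<^sub>v u \<in> I" if g: "g \<in> carrier G" and u: "u \<in> I" for g u
    proof -
      from u obtain x where x: "x \<in> carrier_vec ?n" "u = P *\<^sub>v x" by (auto simp: I_def)
      have "snd s g *\<^sub>v u = P *\<^sub>v (snd r g *\<^sub>v x)"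
        using x P rr[OF g] ss[OF g] int[OF g] by (metis assoc_mult_mat_vec)
      then show ?thesis using x rr[OF g] by (auto simp: I_def)
    qed
  qed
  then have "I = {0\<^sub>v ?m} \<or> I = carrier_vec ?m" using s by (auto simp: irreducible_rep_def)
  moreover have "I \<noteq> {0\<^sub>v ?m}"
  proof
    assume I: "I = {0\<^sub>v ?m}"
    have "0 < ?n" using r by (simp add: irreducible_rep_def)
    have "P *\<^sub>v unit_vec ?n 0 \<in> I" by (simp add: I_def)
    then have "unit_vec ?n 0 = (0\<^sub>v ?n :: complex vec)" using I inj by simp
    then have "unit_vec ?n 0 $ 0 = (0\<^sub>v ?n :: complex vec) $ 0" by simp
    then show False using \<open>0 < ?n\<close> by simp
  qed
  ultimately have I: "I = carrier_vec ?m" by simp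
  have "\<forall>i. \<exists>v. i < ?m \<longrightarrow> v \<in> carrier_vec ?n \<and> P *\<^sub>v v = unit_vec ?m i"
  proof
    fix i
    have "unit_vec ?m i \<in> I" unfolding I by simp
    then show "\<exists>v. i < ?m \<longrightarrow> v \<in> carrier_vec ?n \<and> P *\<^sub>v v = unit_vec ?m i" by (auto simp: I_def)
  qed
  then obtain v where v: "\<And>i. i < ?m \<Longrightarrow> v i \<in> carrier_vec ?n" "\<And>i. i < ?m \<Longrightarrow> P *\<^sub>v v i = unit_vec ?m i"
    by metis
  define Q where "Q = mat_of_cols ?n (map v [0..<?m])"
  have Q: "Q \<in> carrier_mat ?n ?m" by (intro carrier_matI) (simp_all add: Q_def)
  have colQ: "col Q i = v i" if "i < ?m" for i
    unfolding Q_def using v(1)[OF that] that by (subst col_mat_of_cols) auto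
  have PQ: "P * Q = 1\<^sub>m ?m"
  proof (rule mat_col_eqI)
    fix i assume "i < dim_col (1\<^sub>m ?m :: complex mat)"
    then show "col (P * Q) i = col (1\<^sub>m ?m) i"
      by (simp only: index_one_mat(3) col_mult2[OF P Q] colQ v col_one)
  qed (use P Q in auto)
  have QPv: "Q *\<^sub>v (P *\<^sub>v w) = w" if w: "w \<in> carrier_vec ?n" for w
  proof -
    let ?x = "Q *\<^sub>v (P *\<^sub>v w)"
    have x: "?x \<in> carrier_vec ?n" using P Q w by auto
    have "P *\<^sub>v ?x = P *\<^sub>v w"
      using P Q w PQ by (metis assoc_mult_mat_vec mult_mat_vec_carrier one_mult_mat_vec)
    then have "P *\<^sub>v (?x - w) = 0\<^sub>v ?m"
      using mult_minus_distrib_mat_vec[OF P x w] P w by auto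
    with inj[of "?x - w"] x w have "?x - w = 0\<^sub>v ?n" by auto
    then have "(?x - w) $ i = 0" if "i < ?n" for i using that by simp
    then show ?thesis using x w Q by (intro eq_vecI) auto
  qed
  have QP: "Q * P = 1\<^sub>m ?n"
  proof (rule mat_col_eqI)
    fix j assume j: "j < dim_col (1\<^sub>m ?n :: complex mat)"
    then have "col (Q * P) j = (Q * P) *\<^sub>v unit_vec ?n j"
      using P Q by (subst mat_unit_vec_col[of _ ?n ?n]) auto
    also have "\<dots> = Q *\<^sub>v (P *\<^sub>v unit_vec ?n j)"
      using P Q by (subst assoc_mult_mat_vec) auto
    also have "\<dots> = unit_vec ?n j" by (rule QPv) simp
    finally show "col (Q * P) j = col (1\<^sub>m ?n) j" using j by simp
  qed (use P Q in auto)
  \<comment> \<open>Dimension theory is replaced by traces: the identities P Q and Q P have equal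
    trace, which in characteristic 0 forces equal sizes.\<close>
  have "of_nat ?m = (of_nat ?n :: complex)"
    using mat_trace_mult_commute[OF P Q] unfolding PQ QP by (simp add: mat_trace_def)
  then have "?n = ?m" by simp
  then show ?thesis using P Q PQ QP by (auto simp: carrier_GL)
qed

text \<open>Over the complex numbers P has an eigenvalue c. Then P - c is an intertwiner with a
  nonzero kernel, hence not invertible, hence zero by the first half of Schur's lemma.\<close>

lemma intertwiner_scalar:
  assumes r: "irreducible_rep G r" and G: "Group.group G"
    and P: "P \<in> carrier_mat (fst r) (fst r)" and int: "\<And>g. g \<in> carrier G \<Longrightarrow> P * snd r g = snd r g * P"
  obtains c where "P = c \<cdot>\<^sub>m 1\<^sub>m (fst r)"
proof -
  let ?n = "fst r"
  have n: "0 < ?n" using r by (simp add: irreducible_rep_def)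
  have rr: "snd r g \<in> carrier_mat ?n ?n" if "g \<in> carrier G" for g
    using r that G by (auto simp: irreducible_rep_def is_rep_iff)
  obtain c where c: "eigenvalue P c"
    using spectrum_non_empty[OF P] n by (auto simp: spectrum_def)
  define M where "M = P - c \<cdot>\<^sub>m 1\<^sub>m ?n"
  have M: "M \<in> carrier_mat ?n ?n" using P by (auto simp: M_def)
  obtain v where v: "v \<in> carrier_vec ?n" "v \<noteq> 0\<^sub>v ?n" "P *\<^sub>v v = c \<cdot>\<^sub>v v"
    using c P by (auto simp: eigenvalue_def eigenvector_def)
  have "M *\<^sub>v v = P *\<^sub>v v - (c \<cdot>\<^sub>m 1\<^sub>m ?n) *\<^sub>v v"
    unfolding M_def using P v by (intro minus_mult_distrib_mat_vec) auto
  also have "(c \<cdot>\<^sub>m 1\<^sub>m ?n) *\<^sub>v v = c \<cdot>\<^sub>v v"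
    using v(1) by (intro eq_vecI) (auto simp: scalar_prod_left_unit)
  finally have Mv: "M *\<^sub>v v = 0\<^sub>v ?n" using v by simp
  have "M = 0\<^sub>m ?n ?n"
  proof (rule ccontr)
    assume nz: "M \<noteq> 0\<^sub>m ?n ?n"
    have "M * snd r g = snd r g * M" if g: "g \<in> carrier G" for g
    proof -
      have "M * snd r g = P * snd r g - (c \<cdot>\<^sub>m 1\<^sub>m ?n) * snd r g"
        unfolding M_def using P rr[OF g] by (intro minus_mult_distrib_mat) auto
      also have "\<dots> = snd r g * P - snd r g * (c \<cdot>\<^sub>m 1\<^sub>m ?n)"
        using int[OF g] rr[OF g] mult_smult_assoc_mat[OF one_carrier_mat rr[OF g], of c]
          mult_smult_distrib[OF rr[OF g] one_carrier_mat, of c] by simp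
      also have "\<dots> = snd r g * M"
        unfolding M_def using P rr[OF g] by (intro mult_minus_distrib_mat[symmetric]) auto
      finally show ?thesis .
    qed
    then have "M \<in> carrier (GL ?n)" using intertwiner_invertible[OF r r G M _ nz] by blast
    then have "det M \<noteq> 0" by (simp add: carrier_GL_det)
    then show False using det_0_iff_vec_prod_zero_field[OF M] v Mv by auto
  qed
  have "P = c \<cdot>\<^sub>m 1\<^sub>m ?n"
  proof (rule eq_matI)
    fix i j assume ij: "i < dim_row (c \<cdot>\<^sub>m 1\<^sub>m ?n)" "j < dim_col (c \<cdot>\<^sub>m 1\<^sub>m ?n)"
    have "M $$ (i, j) = 0" using \<open>M = 0\<^sub>m ?n ?n\<close> ij by simp
    then show "P $$ (i, j) = (c \<cdot>\<^sub>m 1\<^sub>m ?n) $$ (i, j)" using P ij by (auto simp: M_def)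
  qed (use P in auto)
  then show ?thesis by (rule that)
qed


text \<open>A matrix unit in the middle isolates one column of A and one row of B. Averages over
  matrix units thereby produce the products of matrix coefficients in Schur orthogonality.\<close>

lemma mat_of_entry_product:
  fixes A B :: "complex mat"
  assumes "A \<in> carrier_mat n m" "B \<in> carrier_mat k l" "i < m" "j < k" "a < n" "b < l"
  shows "(A * mat m k (\<lambda>(x, y). if x = i \<and> y = j then 1 else 0) * B) $$ (a, b) = A $$ (a, i) * B $$ (j, b)"
proof -
  let ?E = "mat m k (\<lambda>(x, y). if x = i \<and> y = j then 1 else 0) :: complex mat"
  have E: "?E \<in> carrier_mat m k" by simp
  have "(A * ?E) $$ (a, y) = (if y = j then A $$ (a, i) else 0)" if "y < k" for y
  proof -
    have "(A * ?E) $$ (a, y) = (\<Sum>x<m. if x = i then (if y = j then A $$ (a, i) else 0) else 0)"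
      unfolding index_mult_mat_sum[OF assms(1) E assms(5) that]
      by (rule sum.cong) (use that in auto)
    then show ?thesis using assms(3) by simp
  qed
  then have "(\<Sum>y<k. (A * ?E) $$ (a, y) * B $$ (y, b)) = (\<Sum>y<k. if y = j then A $$ (a, i) * B $$ (j, b) else 0)"
    by (intro sum.cong) auto
  then show ?thesis
    using assms by (subst index_mult_mat_sum[OF mult_carrier_mat[OF assms(1) E] assms(2)]) auto
qed

section \<open>Characters of a finite group and their orthogonality\<close>

locale finite_group = Group.group G for G :: "'a monoid" (structure) +
  assumes finite_carrier [simp]: "finite (carrier G)"
begin

abbreviation card\<^sub>G :: complex where "card\<^sub>G \<equiv> of_nat (card (carrier G))"

lemma card_carrier_neq_0 [simp]: "card\<^sub>G \<noteq> 0"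
  using one_closed by (auto simp: card_eq_0_iff)

definition char_of :: "'a crep \<Rightarrow> 'a \<Rightarrow> complex" where
  "char_of r g = mat_trace (snd r g)"

text \<open>Evaluating the second argument at the inverse instead of conjugating it makes the
  pairing bilinear and matches Schur's lemma directly. Conjugates enter only for the inclusion
  representation, where unitarity gives them.\<close>

definition char_pair :: "('a \<Rightarrow> complex) \<Rightarrow> ('a \<Rightarrow> complex) \<Rightarrow> complex" where
  "char_pair \<phi> \<psi> = (\<Sum>g\<in>carrier G. \<phi> g * \<psi> (inv g)) / card\<^sub>G"

lemma rep_carrier: "is_rep G r \<Longrightarrow> g \<in> carrier G \<Longrightarrow> snd r g \<in> carrier_mat (fst r) (fst r)"
  and rep_mult: "is_rep G r \<Longrightarrow> g \<in> carrier G \<Longrightarrow> h \<in> carrier G \<Longrightarrow> snd r (g \<otimes> h) = snd r g * snd r h"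
  and rep_one: "is_rep G r \<Longrightarrow> snd r \<one> = 1\<^sub>m (fst r)"
  by (auto simp: is_rep_iff[OF group_axioms])

lemma irreducible_is_rep: "irreducible_rep G r \<Longrightarrow> is_rep G r"
  by (simp add: irreducible_rep_def)

lemma bij_betw_translate: "h \<in> carrier G \<Longrightarrow> bij_betw (\<lambda>g. h \<otimes> g) (carrier G) (carrier G)"
  by (rule bij_betw_byWitness[where f' = "\<lambda>g. inv h \<otimes> g"]) (auto simp: m_assoc[symmetric])

definition averaged :: "'a crep \<Rightarrow> 'a crep \<Rightarrow> complex mat \<Rightarrow> complex mat" where
  "averaged s r M = mat_sum (fst s) (fst r) (\<lambda>g. snd s g * M * snd r (inv g)) (carrier G)"

text \<open>The substitution of h g for g in the sum trades s(h) on the left for r(h) on the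
  right.\<close>

lemma averaged_intertwines:
  assumes r: "is_rep G r" and s: "is_rep G s" and M: "M \<in> carrier_mat (fst s) (fst r)" and h: "h \<in> carrier G"
  shows "averaged s r M * snd r h = snd s h * averaged s r M"
proof -
  note c = rep_carrier[OF r] rep_carrier[OF s]
  have cc: "snd s g * M * snd r (inv g) \<in> carrier_mat (fst s) (fst r)" if "g \<in> carrier G" for g
    using c that M by (meson inv_closed mult_carrier_mat)
  have "snd s h * averaged s r M = mat_sum (fst s) (fst r) (\<lambda>g. snd s h * (snd s g * M * snd r (inv g))) (carrier G)"
    unfolding averaged_def using c h cc by (intro mult_mat_sum) auto
  also have "\<dots> = mat_sum (fst s) (fst r) (\<lambda>g. snd s (h \<otimes> g) * M * snd r (inv (h \<otimes> g)) * snd r h) (carrier G)"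
  proof (rule mat_sum_cong)
    fix g assume g: "g \<in> carrier G"
    have hg: "h \<otimes> g \<in> carrier G" "inv (h \<otimes> g) \<in> carrier G" "inv g \<in> carrier G" using g h by auto
    have "snd r (inv (h \<otimes> g)) * snd r h = snd r (inv g)"
      using g h by (simp add: rep_mult[OF r, symmetric] inv_mult_group m_assoc)
    moreover have "snd s (h \<otimes> g) * M * snd r (inv (h \<otimes> g)) * snd r h
        = snd s (h \<otimes> g) * M * (snd r (inv (h \<otimes> g)) * snd r h)"
      by (rule assoc_mult_mat[OF mult_carrier_mat[OF c(2)[OF hg(1)] M] c(1)[OF hg(2)] c(1)[OF h]])
    moreover have "snd s (h \<otimes> g) * M = snd s h * (snd s g * M)"
      unfolding rep_mult[OF s h g] by (rule assoc_mult_mat[OF c(2)[OF h] c(2)[OF g] M])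
    moreover have "snd s h * (snd s g * M) * snd r (inv g) = snd s h * (snd s g * M * snd r (inv g))"
      by (rule assoc_mult_mat[OF c(2)[OF h] mult_carrier_mat[OF c(2)[OF g] M] c(1)[OF hg(3)]])
    ultimately show "snd s h * (snd s g * M * snd r (inv g))
        = snd s (h \<otimes> g) * M * snd r (inv (h \<otimes> g)) * snd r h" by simp
  qed
  also have "\<dots> = mat_sum (fst s) (fst r) (\<lambda>g. snd s g * M * snd r (inv g) * snd r h) (carrier G)"
    by (rule mat_sum_reindex[OF bij_betw_translate[OF h]])
  also have "\<dots> = averaged s r M * snd r h"
    unfolding averaged_def using c h cc by (intro mat_sum_mult[symmetric]) auto
  finally show ?thesis ..
qed

text \<open>A product of two traces is the sum over i, j of s(g)_ii r(g^-1)_jj, and this summand is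
  the (i, j) entry of s(g) E_ij r(g^-1) for the matrix unit E_ij. So Schur's lemma for the averages
  controls the pairing.\<close>

lemma char_pair_averaged:
  assumes r: "is_rep G r" and s: "is_rep G s"
  shows "(\<Sum>g\<in>carrier G. char_of s g * char_of r (inv g)) =
    (\<Sum>i<fst s. \<Sum>j<fst r. averaged s r (mat (fst s) (fst r) (\<lambda>(x, y). if x = i \<and> y = j then 1 else 0)) $$ (i, j))"
proof -
  note c = rep_carrier[OF r] rep_carrier[OF s]
  have "(\<Sum>g\<in>carrier G. char_of s g * char_of r (inv g)) =
      (\<Sum>g\<in>carrier G. \<Sum>i<fst s. \<Sum>j<fst r. snd s g $$ (i, i) * snd r (inv g) $$ (j, j))"
  proof (rule sum.cong[OF refl])
    fix g assume g: "g \<in> carrier G"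
    show "char_of s g * char_of r (inv g) = (\<Sum>i<fst s. \<Sum>j<fst r. snd s g $$ (i, i) * snd r (inv g) $$ (j, j))"
      using c(2)[OF g] c(1)[OF inv_closed[OF g]] by (simp add: char_of_def mat_trace_def sum_product)
  qed
  also have "\<dots> = (\<Sum>i<fst s. \<Sum>j<fst r. \<Sum>g\<in>carrier G. snd s g $$ (i, i) * snd r (inv g) $$ (j, j))"
    by (subst sum.swap, rule sum.cong[OF refl], rule sum.swap)
  also have "\<dots> = (\<Sum>i<fst s. \<Sum>j<fst r. averaged s r (mat (fst s) (fst r) (\<lambda>(x, y). if x = i \<and> y = j then 1 else 0)) $$ (i, j))"
    by (intro sum.cong refl) (simp add: averaged_def mat_sum_def mat_of_entry_product[OF c(2) c(1)[OF inv_closed]])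
  finally show ?thesis .
qed

lemma char_pair_irreducible_not_iso:
  assumes r: "irreducible_rep G r" and s: "irreducible_rep G s" and n: "\<not> rep_iso G r s"
  shows "char_pair (char_of s) (char_of r) = 0"
proof -
  note rr = irreducible_is_rep[OF r] and ss = irreducible_is_rep[OF s]
  have "averaged s r M = 0\<^sub>m (fst s) (fst r)" if M: "M \<in> carrier_mat (fst s) (fst r)" for M
  proof (rule ccontr)
    assume nz: "averaged s r M \<noteq> 0\<^sub>m (fst s) (fst r)"
    have "averaged s r M \<in> carrier_mat (fst s) (fst r)" by (simp add: averaged_def)
    from intertwiner_invertible[OF r s group_axioms this averaged_intertwines[OF rr ss M] nz]
    have "fst r = fst s \<and> averaged s r M \<in> carrier (GL (fst r))" .
    with averaged_intertwines[OF rr ss M] n show False unfolding rep_iso_def by blast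
  qed
  then show ?thesis
    unfolding char_pair_def char_pair_averaged[OF rr ss] by simp
qed

text \<open>Each averaged matrix unit is a scalar by Schur's lemma, and its trace determines the
  scalar: cyclically rearranged, the trace is the sum of the (j, i) entries of r(g^-1) r(g) = 1.
  Only the n diagonal units contribute, each with |G| / n.\<close>

lemma char_pair_irreducible_self:
  assumes r: "irreducible_rep G r"
  shows "char_pair (char_of r) (char_of r) = 1"
proof -
  note rr = irreducible_is_rep[OF r]
  let ?n = "fst r"
  have n: "0 < ?n" using r by (simp add: irreducible_rep_def)
  define E :: "nat \<Rightarrow> nat \<Rightarrow> complex mat" where "E i j = mat ?n ?n (\<lambda>(x, y). if x = i \<and> y = j then 1 else 0)" for i j
  have E: "E i j \<in> carrier_mat ?n ?n" for i j by (simp add: E_def)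
  have av: "averaged r r (E i j) = (if i = j then card\<^sub>G / of_nat ?n else 0) \<cdot>\<^sub>m 1\<^sub>m ?n"
    if ij: "i < ?n" "j < ?n" for i j
  proof -
    obtain c where c: "averaged r r (E i j) = c \<cdot>\<^sub>m 1\<^sub>m ?n"
      using intertwiner_scalar[OF r group_axioms _ averaged_intertwines[OF rr rr E]] by (auto simp: averaged_def)
    have "of_nat ?n * c = mat_trace (averaged r r (E i j))"
      unfolding c by (simp add: mat_trace_def)
    also have "\<dots> = (\<Sum>a<?n. \<Sum>g\<in>carrier G. snd r g $$ (a, i) * snd r (inv g) $$ (j, a))"
      unfolding mat_trace_def E_def using ij
      by (simp add: averaged_def mat_sum_def mat_of_entry_product[OF rep_carrier[OF rr] rep_carrier[OF rr, OF inv_closed]])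
    also have "\<dots> = (\<Sum>g\<in>carrier G. (snd r (inv g) * snd r g) $$ (j, i))"
      by (subst sum.swap, intro sum.cong refl,
          subst index_mult_mat_sum[OF rep_carrier[OF rr, OF inv_closed] rep_carrier[OF rr] ij(2,1)])
        (auto simp: mult.commute)
    also have "\<dots> = (\<Sum>g\<in>carrier G. if i = j then 1 else 0)"
      using ij by (intro sum.cong refl) (auto simp: rep_mult[OF rr, symmetric] rep_one[OF rr])
    finally have "c = (if i = j then card\<^sub>G / of_nat ?n else 0)"
      using n by (auto simp: field_simps split: if_splits)
    then show ?thesis using c by simp
  qed
  have "(\<Sum>g\<in>carrier G. char_of r g * char_of r (inv g)) = (\<Sum>i<?n. \<Sum>j<?n. if i = j then card\<^sub>G / of_nat ?n else 0)"
    unfolding char_pair_averaged[OF rr rr] E_def[symmetric]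
    by (intro sum.cong refl) (auto simp: av)
  also have "\<dots> = card\<^sub>G" using n by simp
  finally show ?thesis using carrier_not_empty by (simp add: char_pair_def)
qed

lemma char_of_iso:
  assumes "is_rep G r" "is_rep G s" "rep_iso G r s" "g \<in> carrier G"
  shows "char_of r g = char_of s g"
proof -
  obtain P where n: "fst r = fst s" and P: "P \<in> carrier (GL (fst r))" and int: "P * snd r g = snd s g * P"
    using assms(3,4) by (auto simp: rep_iso_def)
  obtain Q where Q: "Q \<in> carrier_mat (fst r) (fst r)" "P * Q = 1\<^sub>m (fst r)" "Q * P = 1\<^sub>m (fst r)"
    and Pc: "P \<in> carrier_mat (fst r) (fst r)"
    using P by (auto simp: carrier_GL)
  note c = rep_carrier[OF assms(1,4)] rep_carrier[OF assms(2,4), folded n]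
  have "mat_trace (snd r g) = mat_trace ((Q * P) * snd r g)" using Q c by simp
  also have "(Q * P) * snd r g = Q * (snd s g * P)" unfolding int[symmetric] by (rule assoc_mult_mat[OF Q(1) Pc c(1)])
  also have "mat_trace \<dots> = mat_trace ((snd s g * P) * Q)"
    by (rule mat_trace_mult_commute[OF Q(1) mult_carrier_mat[OF c(2) Pc]])
  also have "(snd s g * P) * Q = snd s g"
    unfolding assoc_mult_mat[OF c(2) Pc Q(1)] Q(2) by (rule right_mult_one_mat[OF c(2)])
  finally show ?thesis by (simp add: char_of_def)
qed

lemma rep_iso_refl: "is_rep G r \<Longrightarrow> rep_iso G r r"
  unfolding rep_iso_def
  by (intro conjI refl bexI[of _ "1\<^sub>m (fst r)"]) (auto dest: rep_carrier simp: carrier_GL)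

lemma rep_iso_sym:
  assumes "is_rep G r" "is_rep G s" "rep_iso G r s"
  shows "rep_iso G s r"
proof -
  obtain P where n: "fst r = fst s" and P: "P \<in> carrier (GL (fst r))"
    and int: "\<And>g. g \<in> carrier G \<Longrightarrow> P * snd r g = snd s g * P"
    using assms(3) by (auto simp: rep_iso_def)
  obtain Q where Q: "Q \<in> carrier_mat (fst r) (fst r)" "P * Q = 1\<^sub>m (fst r)" "Q * P = 1\<^sub>m (fst r)"
    and Pc: "P \<in> carrier_mat (fst r) (fst r)"
    using P by (auto simp: carrier_GL)
  have "Q * snd s g = snd r g * Q" if g: "g \<in> carrier G" for g
  proof -
    note c = rep_carrier[OF assms(1) g] rep_carrier[OF assms(2) g, folded n]
    have "Q * snd s g = Q * (snd s g * (P * Q))" using Q c by simp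
    also have "snd s g * (P * Q) = (snd s g * P) * Q"
      by (rule assoc_mult_mat[OF c(2) Pc Q(1), symmetric])
    also have "\<dots> = P * (snd r g * Q)"
      unfolding int[OF g, symmetric] by (rule assoc_mult_mat[OF Pc c(1) Q(1)])
    also have "Q * \<dots> = (Q * P) * (snd r g * Q)"
      by (rule assoc_mult_mat[OF Q(1) Pc mult_carrier_mat[OF c(1) Q(1)], symmetric])
    also have "\<dots> = snd r g * Q" unfolding Q(3) by (rule left_mult_one_mat[OF mult_carrier_mat[OF c(1) Q(1)]])
    finally show ?thesis .
  qed
  moreover have "Q \<in> carrier (GL (fst s))" using Q Pc n by (auto simp: carrier_GL)
  ultimately show ?thesis using n by (auto simp: rep_iso_def)
qed

lemma rep_iso_trans:
  assumes "is_rep G r" "is_rep G s" "is_rep G t" "rep_iso G r s" "rep_iso G s t"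
  shows "rep_iso G r t"
proof -
  obtain P where n: "fst r = fst s" and P: "P \<in> carrier (GL (fst r))"
    and int: "\<And>g. g \<in> carrier G \<Longrightarrow> P * snd r g = snd s g * P"
    using assms(4) by (auto simp: rep_iso_def)
  obtain Q where n': "fst s = fst t" and Q: "Q \<in> carrier (GL (fst s))"
    and int': "\<And>g. g \<in> carrier G \<Longrightarrow> Q * snd s g = snd t g * Q"
    using assms(5) by (auto simp: rep_iso_def)
  have c: "P \<in> carrier_mat (fst r) (fst r)" "Q \<in> carrier_mat (fst r) (fst r)"
    using P Q n by (auto simp: carrier_GL)
  have "(Q * P) * snd r g = snd t g * (Q * P)" if g: "g \<in> carrier G" for g
  proof -
    note d = rep_carrier[OF assms(1) g] rep_carrier[OF assms(2) g, folded n] rep_carrier[OF assms(3) g, folded n' n]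
    have "(Q * P) * snd r g = Q * (P * snd r g)" 
      by (rule assoc_mult_mat[OF c(2,1) d(1)])
    also have "\<dots> = (Q * snd s g) * P"
      unfolding int[OF g] by (rule assoc_mult_mat[OF c(2) d(2) c(1), symmetric])
    also have "\<dots> = snd t g * (Q * P)"
      unfolding int'[OF g] by (rule assoc_mult_mat[OF d(3) c(2,1)])
    finally show ?thesis .
  qed
  moreover have "Q * P \<in> carrier (GL (fst r))"
    using group.subgroup_self[OF group_GL, of "fst r"] P Q n
    by (metis GL_simps(1) subgroup.m_closed)
  ultimately show ?thesis using n n' by (auto simp: rep_iso_def)
qed

end

section \<open>Sums and tensor products of representations\<close>

lemma sum_lessThan_add:
  fixes f :: "nat \<Rightarrow> 'a::comm_monoid_add"
  shows "(\<Sum>i<n+m. f i) = (\<Sum>i<n. f i) + (\<Sum>i<m. f (n + i))"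
  by (induction m) (simp_all add: add.assoc)

text \<open>Division with remainder as a bijection. It serves both the row indices of Kronecker
  products and, later, the splitting of torsion exponents by the center.\<close>

lemma sum_div_mod:
  fixes f :: "nat \<Rightarrow> nat \<Rightarrow> 'a::comm_monoid_add"
  shows "(\<Sum>i<n*m. f (i div m) (i mod m)) = (\<Sum>a<n. \<Sum>b<m. f a b)"
proof (induction n)
  case (Suc n)
  have "(\<Sum>i<Suc n*m. f (i div m) (i mod m)) = (\<Sum>i<n*m+m. f (i div m) (i mod m))"
    by (simp add: add.commute)
  also have "\<dots> = (\<Sum>a<n. \<Sum>b<m. f a b) + (\<Sum>b<m. f ((n*m+b) div m) ((n*m+b) mod m))"
    by (simp add: sum_lessThan_add Suc)
  also have "(\<Sum>b<m. f ((n*m+b) div m) ((n*m+b) mod m)) = (\<Sum>b<m. f n b)"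
    by (intro sum.cong refl) (auto simp: div_add1_eq)
  finally show ?case by simp
qed simp

lemma kronecker_mult:
  assumes A: "A \<in> carrier_mat n n" "C \<in> carrier_mat n n" and B: "B \<in> carrier_mat m m" "D \<in> carrier_mat m m"
  shows "kronecker (A * C) (B * D) = kronecker A B * kronecker C D"
proof (rule eq_matI)
  fix i j assume ij': "i < dim_row (kronecker A B * kronecker C D)" "j < dim_col (kronecker A B * kronecker C D)"
  then have ij: "i < n * m" "j < n * m" using assms by (auto simp: kronecker_def)
  then have "0 < m" by (cases m) auto
  then have d: "i div m < n" "j div m < n" "i mod m < m" "j mod m < m"
    using ij by (auto simp: less_mult_imp_div_less)
  have K: "kronecker A B \<in> carrier_mat (n*m) (n*m)" "kronecker C D \<in> carrier_mat (n*m) (n*m)"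
    using assms by (auto simp: kronecker_def)
  have "kronecker (A * C) (B * D) $$ (i, j) = (A * C) $$ (i div m, j div m) * (B * D) $$ (i mod m, j mod m)"
    using assms ij by (simp add: kronecker_def)
  also have "\<dots> = (\<Sum>a<n. \<Sum>b<m. (A $$ (i div m, a) * C $$ (a, j div m)) * (B $$ (i mod m, b) * D $$ (b, j mod m)))"
    by (simp only: index_mult_mat_sum[OF A d(1,2)] index_mult_mat_sum[OF B d(3,4)] sum_product)
  also have "\<dots> = (\<Sum>l<n*m. (A $$ (i div m, l div m) * C $$ (l div m, j div m)) * (B $$ (i mod m, l mod m) * D $$ (l mod m, j mod m)))"
    by (rule sum_div_mod[symmetric])
  also have "\<dots> = (\<Sum>l<n*m. kronecker A B $$ (i, l) * kronecker C D $$ (l, j))"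
    using assms ij by (intro sum.cong refl) (simp add: kronecker_def)
  also have "\<dots> = (kronecker A B * kronecker C D) $$ (i, j)"
    by (rule index_mult_mat_sum[OF K ij, symmetric])
  finally show "kronecker (A * C) (B * D) $$ (i, j) = (kronecker A B * kronecker C D) $$ (i, j)" .
qed (use assms in \<open>auto simp: kronecker_def\<close>)

lemma kronecker_one: "kronecker (1\<^sub>m n) (1\<^sub>m m) = 1\<^sub>m (n * m)"
proof (rule eq_matI)
  fix i j assume "i < dim_row (1\<^sub>m (n*m) :: complex mat)" "j < dim_col (1\<^sub>m (n*m) :: complex mat)"
  then have ij: "i < n * m" "j < n * m" by auto
  then have "0 < m" by (cases m) auto
  then have d: "i div m < n" "j div m < n" "i mod m < m" "j mod m < m"
    using ij by (auto simp: less_mult_imp_div_less)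
  have "i = j \<longleftrightarrow> i div m = j div m \<and> i mod m = j mod m"
    by (metis div_mult_mod_eq)
  then show "kronecker (1\<^sub>m n) (1\<^sub>m m) $$ (i, j) = 1\<^sub>m (n * m) $$ (i, j)"
    using ij d by (auto simp: kronecker_def)
qed (auto simp: kronecker_def)

lemma mat_trace_kronecker:
  assumes "A \<in> carrier_mat n n" "B \<in> carrier_mat m m"
  shows "mat_trace (kronecker A B) = mat_trace A * mat_trace B"
proof -
  have "mat_trace (kronecker A B) = (\<Sum>i<n*m. A $$ (i div m, i div m) * B $$ (i mod m, i mod m))"
    using assms by (simp add: mat_trace_def kronecker_def)
  also have "\<dots> = mat_trace A * mat_trace B"
    unfolding sum_div_mod[of "\<lambda>a b. A $$ (a, a) * B $$ (b, b)"]
    using assms by (simp add: mat_trace_def sum_product)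
  finally show ?thesis .
qed

lemma mat_four_block:
  assumes "A \<in> carrier_mat n n" "B \<in> carrier_mat n m" "C \<in> carrier_mat m n" "D \<in> carrier_mat m m"
  shows "mat n n (\<lambda>(i, j). four_block_mat A B C D $$ (i, j)) = A"
    "mat n m (\<lambda>(i, j). four_block_mat A B C D $$ (i, n + j)) = B"
    "mat m m (\<lambda>(i, j). four_block_mat A B C D $$ (n + i, n + j)) = D"
  using assms by (auto intro!: eq_matI)

text \<open>Two summands at a time, so that the product rule for 2 by 2 block matrices applies;
  \<open>rep_dsum\<close> is reduced to this form along the list.\<close>

definition rep_plus :: "'g crep \<Rightarrow> 'g crep \<Rightarrow> 'g crep" where
  "rep_plus r s = (fst r + fst s, \<lambda>g. four_block_mat (snd r g) (0\<^sub>m (fst r) (fst s)) (0\<^sub>m (fst s) (fst r)) (snd s g))"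

context finite_group
begin

lemma is_rep_cong:
  assumes "fst r = fst s" "\<And>g. g \<in> carrier G \<Longrightarrow> snd r g = snd s g"
  shows "is_rep G r \<longleftrightarrow> is_rep G s"
  using assms by (auto simp: is_rep_iff[OF group_axioms])

lemma rep_iso_cong:
  assumes "fst s = fst t" "\<And>g. g \<in> carrier G \<Longrightarrow> snd s g = snd t g"
  shows "rep_iso G r s \<longleftrightarrow> rep_iso G r t"
  using assms by (auto simp: rep_iso_def)

lemma is_rep_tensor:
  assumes r: "is_rep G r" and s: "is_rep G s"
  shows "is_rep G (rep_tensor r s)"
  unfolding is_rep_iff[OF group_axioms]
proof (intro conjI ballI)
  fix g assume g: "g \<in> carrier G"
  show "snd (rep_tensor r s) g \<in> carrier_mat (fst (rep_tensor r s)) (fst (rep_tensor r s))"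
    using rep_carrier[OF r g] rep_carrier[OF s g] by (auto simp: rep_tensor_def kronecker_def)
  fix h assume h: "h \<in> carrier G"
  show "snd (rep_tensor r s) (g \<otimes> h) = snd (rep_tensor r s) g * snd (rep_tensor r s) h"
    using kronecker_mult[OF rep_carrier[OF r g] rep_carrier[OF r h] rep_carrier[OF s g] rep_carrier[OF s h]]
    by (simp add: rep_tensor_def rep_mult[OF r g h] rep_mult[OF s g h])
qed (simp add: rep_tensor_def rep_one[OF r] rep_one[OF s] kronecker_one)

lemma char_of_tensor:
  assumes "is_rep G r" "is_rep G s" "g \<in> carrier G"
  shows "char_of (rep_tensor r s) g = char_of r g * char_of s g"
  using mat_trace_kronecker[OF rep_carrier[OF assms(1,3)] rep_carrier[OF assms(2,3)]]
  by (simp add: char_of_def rep_tensor_def)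

lemma is_rep_plus:
  assumes r: "is_rep G r" and s: "is_rep G s"
  shows "is_rep G (rep_plus r s)"
  unfolding is_rep_iff[OF group_axioms]
proof (intro conjI ballI)
  fix g assume g: "g \<in> carrier G"
  show "snd (rep_plus r s) g \<in> carrier_mat (fst (rep_plus r s)) (fst (rep_plus r s))"
    using rep_carrier[OF r g] rep_carrier[OF s g] by (auto simp: rep_plus_def)
  fix h assume h: "h \<in> carrier G"
  note c = rep_carrier[OF r g] rep_carrier[OF s g] rep_carrier[OF r h] rep_carrier[OF s h]
  show "snd (rep_plus r s) (g \<otimes> h) = snd (rep_plus r s) g * snd (rep_plus r s) h"
    using c by (simp add: rep_plus_def mult_four_block_mat[OF c(1) zero_carrier_mat zero_carrier_mat c(2)
        c(3) zero_carrier_mat zero_carrier_mat c(4)] rep_mult[OF r g h] rep_mult[OF s g h])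
qed (simp add: rep_plus_def rep_one[OF r] rep_one[OF s])

lemma char_of_plus:
  assumes "is_rep G r" "is_rep G s" "g \<in> carrier G"
  shows "char_of (rep_plus r s) g = char_of r g + char_of s g"
  using mat_trace_four_block[OF rep_carrier[OF assms(1,3)] rep_carrier[OF assms(2,3)]]
  by (simp add: char_of_def rep_plus_def)

text \<open>\<open>diag_block_mat\<close> reads block sizes off the matrices and
  \<open>rep_plus\<close> off the declared degrees; these are known to agree only on the carrier.
  Therefore equality is pointwise here and in \<open>rep_dsum_append\<close>, and is transported by
  \<open>is_rep_cong\<close> and \<open>rep_iso_cong\<close>.\<close>

lemma rep_dsum_Cons:
  assumes "is_rep G r" "is_rep G (rep_dsum rs)"
  shows "fst (rep_dsum (r # rs)) = fst (rep_plus r (rep_dsum rs))"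
    "g \<in> carrier G \<Longrightarrow> snd (rep_dsum (r # rs)) g = snd (rep_plus r (rep_dsum rs)) g"
proof -
  assume g: "g \<in> carrier G"
  note c = rep_carrier[OF assms(1) g] rep_carrier[OF assms(2) g]
  show "snd (rep_dsum (r # rs)) g = snd (rep_plus r (rep_dsum rs)) g"
    using carrier_matD[OF c(1)] carrier_matD[OF c(2)] by (simp add: rep_plus_def rep_dsum_def Let_def)
qed (simp add: rep_plus_def rep_dsum_def)

lemma is_rep_dsum: "(\<And>r. r \<in> set rs \<Longrightarrow> is_rep G r) \<Longrightarrow> is_rep G (rep_dsum rs)"
proof (induction rs)
  case Nil
  then show ?case by (auto simp: is_rep_iff[OF group_axioms] rep_dsum_def)
next
  case (Cons r rs)
  then have r: "is_rep G r" and rs: "is_rep G (rep_dsum rs)" by auto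
  show ?case
    using is_rep_cong[OF rep_dsum_Cons[OF r rs]] is_rep_plus[OF r rs] by blast
qed

lemma char_of_dsum:
  assumes "g \<in> carrier G"
  shows "(\<And>r. r \<in> set rs \<Longrightarrow> is_rep G r) \<Longrightarrow> char_of (rep_dsum rs) g = (\<Sum>r\<leftarrow>rs. char_of r g)"
proof (induction rs)
  case Nil
  then show ?case by (simp add: char_of_def mat_trace_def rep_dsum_def)
next
  case (Cons r rs)
  then have r: "is_rep G r" and rs: "is_rep G (rep_dsum rs)" by (auto intro: is_rep_dsum)
  have "char_of (rep_dsum (r # rs)) g = char_of (rep_plus r (rep_dsum rs)) g"
    unfolding char_of_def rep_dsum_Cons(2)[OF r rs assms] ..
  with Cons char_of_plus[OF r rs assms] show ?case by simp
qed

lemma rep_dsum_append: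
  assumes "is_rep G (rep_dsum rs)" "is_rep G (rep_dsum ss)"
  shows "fst (rep_dsum (rs @ ss)) = fst (rep_plus (rep_dsum rs) (rep_dsum ss))"
    "g \<in> carrier G \<Longrightarrow> snd (rep_dsum (rs @ ss)) g = snd (rep_plus (rep_dsum rs) (rep_dsum ss)) g"
proof -
  assume g: "g \<in> carrier G"
  note c = rep_carrier[OF assms(1) g] rep_carrier[OF assms(2) g]
  show "snd (rep_dsum (rs @ ss)) g = snd (rep_plus (rep_dsum rs) (rep_dsum ss)) g"
    using carrier_matD[OF c(1)] carrier_matD[OF c(2)]
    by (simp add: rep_plus_def rep_dsum_def Let_def diag_block_mat_append)
qed (simp add: rep_plus_def rep_dsum_def)

lemma rep_iso_plus:
  assumes r: "is_rep G r" "is_rep G r'" and s: "is_rep G s" "is_rep G s'"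
    and iso: "rep_iso G r r'" "rep_iso G s s'"
  shows "rep_iso G (rep_plus r s) (rep_plus r' s')"
proof -
  obtain P where P: "fst r = fst r'" "P \<in> carrier (GL (fst r))" "\<And>g. g \<in> carrier G \<Longrightarrow> P * snd r g = snd r' g * P"
    using iso(1) by (auto simp: rep_iso_def)
  obtain Q where Q: "fst s = fst s'" "Q \<in> carrier (GL (fst s))" "\<And>g. g \<in> carrier G \<Longrightarrow> Q * snd s g = snd s' g * Q"
    using iso(2) by (auto simp: rep_iso_def)
  obtain P' Q' where P': "P' \<in> carrier_mat (fst r) (fst r)" "P * P' = 1\<^sub>m (fst r)" "P' * P = 1\<^sub>m (fst r)"
    and Q': "Q' \<in> carrier_mat (fst s) (fst s)" "Q * Q' = 1\<^sub>m (fst s)" "Q' * Q = 1\<^sub>m (fst s)"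
    and c: "P \<in> carrier_mat (fst r) (fst r)" "Q \<in> carrier_mat (fst s) (fst s)"
    using P(2) Q(2) by (auto simp: carrier_GL)
  let ?n = "fst r" and ?m = "fst s"
  define b where "b A B = four_block_mat A (0\<^sub>m ?n ?m) (0\<^sub>m ?m ?n) B" for A B :: "complex mat"
  have b_mult: "b A B * b A' B' = b (A * A') (B * B')"
    if "A \<in> carrier_mat ?n ?n" "A' \<in> carrier_mat ?n ?n" "B \<in> carrier_mat ?m ?m" "B' \<in> carrier_mat ?m ?m" for A A' B B'
    unfolding b_def using that
    by (simp add: mult_four_block_mat[OF that(1) zero_carrier_mat zero_carrier_mat that(3)
        that(2) zero_carrier_mat zero_carrier_mat that(4)])
  have b_carrier: "b A B \<in> carrier_mat (?n + ?m) (?n + ?m)"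
    if "A \<in> carrier_mat ?n ?n" "B \<in> carrier_mat ?m ?m" for A B
    using that by (auto simp: b_def)
  have "b P Q \<in> carrier (GL (?n + ?m))"
    unfolding carrier_GL using b_carrier[OF c] b_carrier[OF P'(1) Q'(1)]
      b_mult[OF c(1) P'(1) c(2) Q'(1)] b_mult[OF P'(1) c(1) Q'(1) c(2)] P' Q'
    by (auto intro!: bexI[of _ "b P' Q'"] simp: b_def)
  moreover have "b P Q * snd (rep_plus r s) g = snd (rep_plus r' s') g * b P Q" if g: "g \<in> carrier G" for g
  proof -
    have "b P Q * b (snd r g) (snd s g) = b (snd r' g) (snd s' g) * b P Q"
      using b_mult[OF c(1) rep_carrier[OF r(1) g] c(2) rep_carrier[OF s(1) g]]
        b_mult[OF rep_carrier[OF r(2) g, folded P(1)] c(1) rep_carrier[OF s(2) g, folded Q(1)] c(2)]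
        P(3)[OF g] Q(3)[OF g] by simp
    then show ?thesis by (simp add: rep_plus_def b_def P(1) Q(1))
  qed
  ultimately show ?thesis using P(1) Q(1) by (auto simp: rep_iso_def rep_plus_def)
qed


section \<open>Complete reducibility\<close>

lemma is_rep_conjugate:
  assumes r: "is_rep G r" and P: "P \<in> carrier_mat (fst r) (fst r)" "P' \<in> carrier_mat (fst r) (fst r)"
    and PP': "P * P' = 1\<^sub>m (fst r)" "P' * P = 1\<^sub>m (fst r)"
  shows "is_rep G (fst r, \<lambda>g. P' * snd r g * P)"
  unfolding is_rep_iff[OF group_axioms]
proof (intro conjI ballI)
  fix g assume g: "g \<in> carrier G"
  note cg = rep_carrier[OF r g]
  show "snd (fst r, \<lambda>g. P' * snd r g * P) g \<in> carrier_mat (fst (fst r, \<lambda>g. P' * snd r g * P)) (fst (fst r, \<lambda>g. P' * snd r g * P))"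
    using P cg by auto
  fix h assume h: "h \<in> carrier G"
  note ch = rep_carrier[OF r h]
  have "(P' * snd r g * P) * (P' * snd r h * P) = (P' * snd r g) * (P * (P' * snd r h * P))"
    using P cg ch by (intro assoc_mult_mat[of _ "fst r" "fst r" _ "fst r" _ "fst r"]) auto
  also have "P * (P' * snd r h * P) = P * (P' * (snd r h * P))"
    using P cg ch by (subst assoc_mult_mat[of _ "fst r" "fst r" _ "fst r" _ "fst r"]) auto
  also have "\<dots> = (P * P') * (snd r h * P)"
    using P cg ch by (intro assoc_mult_mat[of _ "fst r" "fst r" _ "fst r" _ "fst r", symmetric]) auto
  also have "\<dots> = snd r h * P" unfolding PP' using P ch by (intro left_mult_one_mat) auto
  also have "(P' * snd r g) * (snd r h * P) = (P' * snd r g * snd r h) * P"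
    using P cg ch by (intro assoc_mult_mat[of _ "fst r" "fst r" _ "fst r" _ "fst r", symmetric]) auto
  also have "P' * snd r g * snd r h = P' * (snd r g * snd r h)"
    using P cg ch by (intro assoc_mult_mat[of _ "fst r" "fst r" _ "fst r" _ "fst r"]) auto
  finally show "snd (fst r, \<lambda>g. P' * snd r g * P) (g \<otimes> h)
      = snd (fst r, \<lambda>g. P' * snd r g * P) g * snd (fst r, \<lambda>g. P' * snd r g * P) h"
    by (simp add: rep_mult[OF r g h])
qed (use P PP' in \<open>simp add: rep_one[OF r]\<close>)

text \<open>Maschke's theorem in coordinates. In a basis adapted to U the representation has
  diagonal blocks A, D and upper right block B. Conjugation by the unipotent matrix with upper right
  block X removes B exactly when A X + B = X D, and averaging over the group supplies such an
  X.\<close>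

lemma reducible_rep_iso_plus:
  assumes r: "is_rep G r" and U: "invariant_subspace G r U" "U \<noteq> {0\<^sub>v (fst r)}" "U \<noteq> carrier_vec (fst r)"
  obtains a b where "is_rep G a" "is_rep G b" "fst a < fst r" "fst b < fst r" "rep_iso G r (rep_plus a b)"
proof -
  define n where "n = fst r"
  note c = rep_carrier[OF r, folded n_def]
  obtain P k where P: "P \<in> carrier (GL n)" and kn: "k \<le> n"
    and UP: "U = {P *\<^sub>v v | v. v \<in> carrier_vec n \<and> (\<forall>j. k \<le> j \<and> j < n \<longrightarrow> v $ j = 0)}"
  proof (rule subspace_adapted_basis[of U n])
    show "U \<subseteq> carrier_vec n" "0\<^sub>v n \<in> U" "\<And>u v. u \<in> U \<Longrightarrow> v \<in> U \<Longrightarrow> u + v \<in> U"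
      "\<And>c u. u \<in> U \<Longrightarrow> c \<cdot>\<^sub>v u \<in> U"
      using U(1) unfolding invariant_subspace_def subspace_vec_iff n_def by auto
  qed
  obtain P' where P': "P' \<in> carrier_mat n n" "P * P' = 1\<^sub>m n" "P' * P = 1\<^sub>m n" and Pc: "P \<in> carrier_mat n n"
    using P by (auto simp: carrier_GL)
  have k0: "k \<noteq> 0"
  proof
    assume k: "k = 0"
    have "u = 0\<^sub>v n" if u: "u \<in> U" for u
    proof -
      obtain v where v: "u = P *\<^sub>v v" "v \<in> carrier_vec n" "\<forall>j. k \<le> j \<and> j < n \<longrightarrow> v $ j = 0"
        using u unfolding UP by blast
      have "v = 0\<^sub>v n" using v(2,3) k by (intro eq_vecI) auto
      then show ?thesis unfolding v(1) using Pc by (intro eq_vecI) auto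
    qed
    moreover have "0\<^sub>v n \<in> U"
      using U(1) unfolding invariant_subspace_def subspace_vec_iff n_def by blast
    ultimately have "U = {0\<^sub>v n}" by blast
    with U(2) show False unfolding n_def by blast
  qed
  have kn': "k \<noteq> n"
  proof
    assume "k = n"
    then have "U = {P *\<^sub>v v | v. v \<in> carrier_vec n}" unfolding UP by auto
    also have "\<dots> = carrier_vec n"
    proof (intro equalityI subsetI)
      fix x :: "complex vec" assume x: "x \<in> carrier_vec n"
      then have "x = P *\<^sub>v (P' *\<^sub>v x)" "P' *\<^sub>v x \<in> carrier_vec n"
        using Pc P' by (auto simp: assoc_mult_mat_vec[symmetric])
      then show "x \<in> {P *\<^sub>v v | v. v \<in> carrier_vec n}" by blast
    qed (use Pc in auto)
    finally show False using U(3) unfolding n_def by blast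
  qed
  define l where "l = n - k"
  have nkl: "n = k + l" and l: "l \<noteq> 0" using kn kn' by (auto simp: l_def)
  define R where "R g = P' * snd r g * P" for g
  have Rrep: "is_rep G (n, R)"
    using is_rep_conjugate[OF r, of P P'] Pc P' by (simp add: n_def R_def[abs_def])
  note Rc = rep_carrier[OF Rrep, simplified]
  define A where "A g = mat k k (\<lambda>(i, j). R g $$ (i, j))" for g
  define B where "B g = mat k l (\<lambda>(i, j). R g $$ (i, k + j))" for g
  define D where "D g = mat l l (\<lambda>(i, j). R g $$ (k + i, k + j))" for g
  have ABD: "A g \<in> carrier_mat k k" "B g \<in> carrier_mat k l" "D g \<in> carrier_mat l l" for g
    by (auto simp: A_def B_def D_def)
  have dims [simp]: "dim_row (A g) = k" "dim_col (A g) = k" "dim_row (B g) = k" "dim_col (B g) = l"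
    "dim_row (D g) = l" "dim_col (D g) = l" for g
    by (simp_all add: A_def B_def D_def)
  \<comment> \<open>For j < k, column j of R(g) lists the coordinates of the image of a vector of U,
    which stays in U.\<close>
  have R0: "R g $$ (i, j) = 0" if g: "g \<in> carrier G" and ij: "k \<le> i" "i < n" "j < k" for g i j
  proof -
    have "P *\<^sub>v unit_vec n j \<in> U" unfolding UP using ij by (auto intro!: exI[of _ "unit_vec n j"])
    then have "snd r g *\<^sub>v (P *\<^sub>v unit_vec n j) \<in> U"
      using U(1) g by (auto simp: invariant_subspace_def)
    then obtain v where v: "v \<in> carrier_vec n" "snd r g *\<^sub>v (P *\<^sub>v unit_vec n j) = P *\<^sub>v v"
      "\<forall>j. k \<le> j \<and> j < n \<longrightarrow> v $ j = 0" unfolding UP by auto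
    have "col (R g) j = R g *\<^sub>v unit_vec n j"
      using Rc[OF g] ij by (subst mat_unit_vec_col) auto
    also have "\<dots> = (P' * snd r g) *\<^sub>v (P *\<^sub>v unit_vec n j)"
      unfolding R_def using Pc P' c[OF g] by (intro assoc_mult_mat_vec[of _ n n _ n]) auto
    also have "\<dots> = P' *\<^sub>v (P *\<^sub>v v)"
      unfolding v(2)[symmetric] using Pc P' c[OF g] by (intro assoc_mult_mat_vec[of _ n n _ n]) auto
    also have "\<dots> = v"
      using Pc P' v(1) by (simp add: assoc_mult_mat_vec[symmetric])
    finally have "col (R g) j $ i = v $ i" by simp
    then show ?thesis using v(3) ij Rc[OF g] by simp
  qed
  have R_block: "R g = four_block_mat (A g) (B g) (0\<^sub>m l k) (D g)" if g: "g \<in> carrier G" for g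
  proof (rule eq_matI)
    fix i j assume "i < dim_row (four_block_mat (A g) (B g) (0\<^sub>m l k) (D g))" "j < dim_col (four_block_mat (A g) (B g) (0\<^sub>m l k) (D g))"
    then have ij: "i < k + l" "j < k + l" using ABD by auto
    then show "R g $$ (i, j) = four_block_mat (A g) (B g) (0\<^sub>m l k) (D g) $$ (i, j)"
      using R0[OF g, of i j] nkl by (auto simp: A_def B_def D_def)
  qed (use Rc[OF g] nkl ABD in auto)
  have mult: "A (g \<otimes> h) = A g * A h" "B (g \<otimes> h) = A g * B h + B g * D h" "D (g \<otimes> h) = D g * D h"
    if g: "g \<in> carrier G" and h: "h \<in> carrier G" for g h
  proof -
    have "R (g \<otimes> h) = R g * R h" using rep_mult[OF Rrep g h] by simp
    also have "\<dots> = four_block_mat (A g * A h) (A g * B h + B g * D h) (0\<^sub>m l k) (D g * D h)"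
      unfolding R_block[OF g] R_block[OF h]
        mult_four_block_mat[OF ABD(1,2) zero_carrier_mat ABD(3) ABD(1,2) zero_carrier_mat ABD(3)]
      using ABD by (simp add: right_mult_zero_mat[of _ k l] left_mult_zero_mat[of _ k k] left_mult_zero_mat[of _ k l]
          right_mult_zero_mat[of _ l l] right_add_zero_mat[OF mult_carrier_mat[OF ABD(1,1)]]
          left_add_zero_mat[OF mult_carrier_mat[OF ABD(3,3)]])
    finally have e: "R (g \<otimes> h) = four_block_mat (A g * A h) (A g * B h + B g * D h) (0\<^sub>m l k) (D g * D h)" .
    have c': "A g * A h \<in> carrier_mat k k" "A g * B h + B g * D h \<in> carrier_mat k l" "D g * D h \<in> carrier_mat l l"
      using ABD by auto
    show "A (g \<otimes> h) = A g * A h" "B (g \<otimes> h) = A g * B h + B g * D h" "D (g \<otimes> h) = D g * D h"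
      unfolding A_def[of "g \<otimes> h"] B_def[of "g \<otimes> h"] D_def[of "g \<otimes> h"] e
      by (rule mat_four_block[OF c'(1,2) zero_carrier_mat c'(3)])+
  qed
  have R1: "R \<one> = 1\<^sub>m n" using rep_one[OF Rrep] by simp
  have A1: "A \<one> = 1\<^sub>m k" and D1: "D \<one> = 1\<^sub>m l"
    unfolding A_def D_def R1 nkl by (auto intro!: eq_matI)
  have a: "is_rep G (k, A)" and b: "is_rep G (l, D)"
    using ABD mult A1 D1 by (auto simp: is_rep_iff[OF group_axioms])
  \<comment> \<open>B satisfies the cocycle rule B(gh) = A(g) B(h) + B(g) D(h). Multiplying it on
    the right by D(h^-1) and summing over h gives S D(g) = A(g) S + |G| B(g), so S / |G| is the
    required X.\<close>
  define S where "S = mat_sum k l (\<lambda>h. B h * D (inv h)) (carrier G)"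
  define X where "X = (1 / card\<^sub>G) \<cdot>\<^sub>m S"
  have Sc: "S \<in> carrier_mat k l" and Xc: "X \<in> carrier_mat k l" by (auto simp: S_def X_def)
  have S_eq: "A g * S + card\<^sub>G \<cdot>\<^sub>m B g = S * D g" if g: "g \<in> carrier G" for g
  proof -
    have BD: "B h * D (inv h) \<in> carrier_mat k l" for h using ABD by auto
    have step: "A g * (B h * D (inv h)) + B g = B (g \<otimes> h) * D (inv (g \<otimes> h)) * D g" if h: "h \<in> carrier G" for h
    proof -
      have "D (inv (g \<otimes> h)) * D g = D (inv h)"
        using g h by (simp add: mult(3)[symmetric] inv_mult_group m_assoc)
      then have "B (g \<otimes> h) * D (inv (g \<otimes> h)) * D g = B (g \<otimes> h) * D (inv h)"
        using ABD by (subst assoc_mult_mat[of _ k l _ l _ l]) auto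
      also have "\<dots> = A g * B h * D (inv h) + B g * D h * D (inv h)"
        unfolding mult(2)[OF g h] using ABD by (intro add_mult_distrib_mat[of _ k l _ _ l]) auto
      also have "A g * B h * D (inv h) = A g * (B h * D (inv h))"
        using ABD by (intro assoc_mult_mat[of _ k k _ l _ l]) auto
      also have "B g * D h * D (inv h) = B g * (D h * D (inv h))"
        using ABD by (intro assoc_mult_mat[of _ k l _ l _ l]) auto
      also have "\<dots> = B g" using h ABD D1 by (simp add: mult(3)[symmetric])
      finally show ?thesis ..
    qed
    have "S * D g = mat_sum k l (\<lambda>h. B h * D (inv h) * D g) (carrier G)"
      unfolding S_def by (rule mat_sum_mult) (use ABD BD in auto)
    also have "\<dots> = mat_sum k l (\<lambda>h. B (g \<otimes> h) * D (inv (g \<otimes> h)) * D g) (carrier G)"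
      by (rule mat_sum_reindex[OF bij_betw_translate[OF g], symmetric])
    also have "\<dots> = mat_sum k l (\<lambda>h. A g * (B h * D (inv h)) + B g) (carrier G)"
      by (rule mat_sum_cong) (simp add: step)
    also have "\<dots> = mat_sum k l (\<lambda>h. A g * (B h * D (inv h))) (carrier G) + card\<^sub>G \<cdot>\<^sub>m B g"
    proof (rule eq_matI)
      fix i j assume "i < dim_row (mat_sum k l (\<lambda>h. A g * (B h * D (inv h))) (carrier G) + card\<^sub>G \<cdot>\<^sub>m B g)"
        "j < dim_col (mat_sum k l (\<lambda>h. A g * (B h * D (inv h))) (carrier G) + card\<^sub>G \<cdot>\<^sub>m B g)"
      then have ij: "i < k" "j < l" using ABD by auto
      have "(A g * (B h * D (inv h)) + B g) $$ (i, j) = (A g * (B h * D (inv h))) $$ (i, j) + B g $$ (i, j)" for h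
        using ij ABD by (intro index_add_mat(1)) auto
      then show "mat_sum k l (\<lambda>h. A g * (B h * D (inv h)) + B g) (carrier G) $$ (i, j)
          = (mat_sum k l (\<lambda>h. A g * (B h * D (inv h))) (carrier G) + card\<^sub>G \<cdot>\<^sub>m B g) $$ (i, j)"
        using ij ABD(2)[of g] by (simp add: mat_sum_def sum.distrib)
    qed (use ABD in \<open>auto simp: mat_sum_def\<close>)
    also have "mat_sum k l (\<lambda>h. A g * (B h * D (inv h))) (carrier G) = A g * S"
      unfolding S_def by (rule mult_mat_sum[symmetric]) (use ABD BD in auto)
    finally show ?thesis ..
  qed
  have X_eq: "A g * X + B g = X * D g" if g: "g \<in> carrier G" for g
  proof -
    have "X * D g = (1 / card\<^sub>G) \<cdot>\<^sub>m (A g * S + card\<^sub>G \<cdot>\<^sub>m B g)"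
      unfolding X_def S_eq[OF g] using Sc ABD by (intro mult_smult_assoc_mat) auto
    also have "\<dots> = A g * X + (1 / card\<^sub>G) \<cdot>\<^sub>m (card\<^sub>G \<cdot>\<^sub>m B g)"
      unfolding X_def mult_smult_distrib[OF ABD(1) Sc]
      by (rule add_smult_distrib_left_mat) (use Sc ABD in auto)
    also have "(1 / card\<^sub>G) \<cdot>\<^sub>m (card\<^sub>G \<cdot>\<^sub>m B g) = B g"
      using carrier_not_empty by (intro eq_matI) auto
    finally show ?thesis ..
  qed
  define Q where "Q = four_block_mat (1\<^sub>m k) X (0\<^sub>m l k) (1\<^sub>m l)"
  have Qc: "Q \<in> carrier_mat n n" using Xc by (auto simp: Q_def nkl)
  have "det Q = 1"
    unfolding Q_def using Xc by (subst det_four_block_mat_lower_left_zero) auto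
  then have QGL: "Q \<in> carrier (GL n)" using Qc by (simp add: carrier_GL_det)
  have PQ: "P * Q \<in> carrier (GL n)"
    using P QGL group.subgroup_self[OF group_GL, of n] by (metis GL_simps(1) subgroup.m_closed)
  have RQ: "R g * Q = Q * snd (rep_plus (k, A) (l, D)) g" if g: "g \<in> carrier G" for g
  proof -
    have "R g * Q = four_block_mat (A g) (A g * X + B g) (0\<^sub>m l k) (D g)"
      unfolding R_block[OF g] Q_def
        mult_four_block_mat[OF ABD(1,2) zero_carrier_mat ABD(3) one_carrier_mat Xc zero_carrier_mat one_carrier_mat]
      using ABD Xc by (simp add: right_mult_zero_mat[of _ k l] left_mult_zero_mat[of _ k l] left_mult_zero_mat[of _ k k]
          right_mult_zero_mat[of _ l l] right_mult_one_mat[of _ k] right_mult_one_mat[of _ k l] right_mult_one_mat[of _ l]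
          right_add_zero_mat[OF ABD(1)] left_add_zero_mat[OF ABD(3)])
    also have "\<dots> = Q * four_block_mat (A g) (0\<^sub>m k l) (0\<^sub>m l k) (D g)"
      unfolding X_eq[OF g] Q_def
        mult_four_block_mat[OF one_carrier_mat Xc zero_carrier_mat one_carrier_mat ABD(1) zero_carrier_mat zero_carrier_mat ABD(3)]
      using ABD Xc by (simp add: right_mult_zero_mat[of _ k l] left_mult_zero_mat[of _ k l] left_mult_zero_mat[of _ k k]
          right_add_zero_mat[OF ABD(1)] left_add_zero_mat[OF ABD(3)] left_add_zero_mat[OF mult_carrier_mat[OF Xc ABD(3)]])
    finally show ?thesis by (simp add: rep_plus_def)
  qed
  have "rep_iso G (rep_plus (k, A) (l, D)) r"
    unfolding rep_iso_def
  proof (intro conjI bexI[of _ "P * Q"] ballI)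
    show "fst (rep_plus (k, A) (l, D)) = fst r" using nkl by (simp add: rep_plus_def n_def)
    then show "P * Q \<in> carrier (GL (fst (rep_plus (k, A) (l, D))))" using PQ by (simp add: n_def)
    fix g assume g: "g \<in> carrier G"
    have plc: "snd (rep_plus (k, A) (l, D)) g \<in> carrier_mat n n"
      using ABD by (auto simp: rep_plus_def nkl)
    have PR: "P * R g = snd r g * P"
    proof -
      have "P * R g = P * (P' * (snd r g * P))"
        unfolding R_def using Pc P' c[OF g] by (subst assoc_mult_mat[of _ n n _ n _ n]) auto
      also have "\<dots> = (P * P') * (snd r g * P)"
        using Pc P' c[OF g] by (intro assoc_mult_mat[of _ n n _ n _ n, symmetric]) auto
      also have "\<dots> = snd r g * P" unfolding P' using Pc c[OF g] by (intro left_mult_one_mat) auto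
      finally show ?thesis .
    qed
    have "P * Q * snd (rep_plus (k, A) (l, D)) g = P * (Q * snd (rep_plus (k, A) (l, D)) g)"
      by (rule assoc_mult_mat[OF Pc Qc plc])
    also have "\<dots> = (P * R g) * Q"
      unfolding RQ[OF g, symmetric] by (rule assoc_mult_mat[OF Pc Rc[OF g] Qc, symmetric])
    also have "\<dots> = snd r g * (P * Q)"
      unfolding PR by (rule assoc_mult_mat[OF c[OF g] Pc Qc])
    finally show "P * Q * snd (rep_plus (k, A) (l, D)) g = snd r g * (P * Q)" .
  qed
  then have "rep_iso G r (rep_plus (k, A) (l, D))"
    by (rule rep_iso_sym[OF is_rep_plus[OF a b] r])
  then show ?thesis using that[OF a b] k0 l nkl by (simp add: n_def)
qed

theorem complete_reducibility:
  "is_rep G r \<Longrightarrow> \<exists>rs. (\<forall>t\<in>set rs. irreducible_rep G t) \<and> rep_iso G r (rep_dsum rs)"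
proof (induction "fst r" arbitrary: r rule: less_induct)
  case less
  consider "fst r = 0" | "irreducible_rep G r"
    | U where "invariant_subspace G r U" "U \<noteq> {0\<^sub>v (fst r)}" "U \<noteq> carrier_vec (fst r)"
    using less.prems unfolding irreducible_rep_def by blast
  then show ?case
  proof cases
    \<comment> \<open>Degree 0 is excluded from irreducibility, so it is decomposed as the empty
      sum.\<close>
    case 1
    have "rep_iso G r (rep_dsum [])"
      unfolding rep_iso_def
    proof (intro conjI bexI[of _ "1\<^sub>m 0"] ballI)
      fix g assume "g \<in> carrier G"
      then have "snd r g \<in> carrier_mat 0 0" using 1 rep_carrier[OF less.prems] by simp
      then show "1\<^sub>m 0 * snd r g = snd (rep_dsum []) g * 1\<^sub>m 0"
        by (intro eq_matI) (auto simp: rep_dsum_def)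
    qed (auto simp: 1 rep_dsum_def carrier_GL)
    then show ?thesis by (intro exI[of _ "[]"]) auto
  next
    case 2
    have "rep_iso G r r \<longleftrightarrow> rep_iso G r (rep_dsum [r])"
      by (rule rep_iso_cong) (auto simp: rep_dsum_def)
    then show ?thesis using 2 rep_iso_refl[OF less.prems] by (intro exI[of _ "[r]"]) auto
  next
    case 3
    obtain a b where ab: "is_rep G a" "is_rep G b" "fst a < fst r" "fst b < fst r" "rep_iso G r (rep_plus a b)"
      by (rule reducible_rep_iso_plus[OF less.prems 3])
    obtain rs where rs: "\<forall>t\<in>set rs. irreducible_rep G t" "rep_iso G a (rep_dsum rs)"
      using less.hyps[OF ab(3,1)] by blast
    obtain ss where ss: "\<forall>t\<in>set ss. irreducible_rep G t" "rep_iso G b (rep_dsum ss)"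
      using less.hyps[OF ab(4,2)] by blast
    have d: "is_rep G (rep_dsum rs)" "is_rep G (rep_dsum ss)"
      using rs(1) ss(1) irreducible_is_rep by (blast intro: is_rep_dsum)+
    have "rep_iso G (rep_plus a b) (rep_plus (rep_dsum rs) (rep_dsum ss))"
      by (rule rep_iso_plus[OF ab(1) d(1) ab(2) d(2) rs(2) ss(2)])
    then have "rep_iso G r (rep_plus (rep_dsum rs) (rep_dsum ss))"
      using rep_iso_trans[OF less.prems is_rep_plus[OF ab(1,2)] is_rep_plus[OF d]] ab(5) by blast
    then have "rep_iso G r (rep_dsum (rs @ ss))"
      using rep_iso_cong[OF rep_dsum_append[OF d]] by blast
    then show ?thesis using rs(1) ss(1) by (intro exI[of _ "rs @ ss"]) auto
  qed
qed


section \<open>Multiplicities\<close>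

lemma char_pair_cong:
  assumes "\<And>g. g \<in> carrier G \<Longrightarrow> \<phi> g = \<phi>' g" "\<And>g. g \<in> carrier G \<Longrightarrow> \<psi> g = \<psi>' g"
  shows "char_pair \<phi> \<psi> = char_pair \<phi>' \<psi>'"
  using assms by (simp add: char_pair_def)

lemma char_pair_sum_left:
  "char_pair (\<lambda>g. \<Sum>i\<in>I. c i * \<phi> i g) \<psi> = (\<Sum>i\<in>I. c i * char_pair (\<phi> i) \<psi>)"
proof -
  have "(\<Sum>g\<in>carrier G. (\<Sum>i\<in>I. c i * \<phi> i g) * \<psi> (inv g)) = (\<Sum>i\<in>I. c i * (\<Sum>g\<in>carrier G. \<phi> i g * \<psi> (inv g)))"
    by (simp add: sum_distrib_left sum_distrib_right mult.assoc sum.swap[of _ I "carrier G"])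
  then show ?thesis by (simp add: char_pair_def sum_divide_distrib[where A = I])
qed

lemma char_pair_sum_right:
  "char_pair \<phi> (\<lambda>g. \<Sum>i\<in>I. c i * \<psi> i g) = (\<Sum>i\<in>I. c i * char_pair \<phi> (\<psi> i))"
proof -
  have "(\<Sum>g\<in>carrier G. \<phi> g * (\<Sum>i\<in>I. c i * \<psi> i (inv g))) = (\<Sum>i\<in>I. c i * (\<Sum>g\<in>carrier G. \<phi> g * \<psi> i (inv g)))"
    by (simp add: sum_distrib_left mult.left_commute sum.swap[of _ I "carrier G"])
  then show ?thesis by (simp add: char_pair_def sum_divide_distrib[where A = I])
qed

lemma char_pair_irreducible:
  assumes "irreducible_rep G r" "irreducible_rep G s"
  shows "char_pair (char_of r) (char_of s) = (if rep_iso G s r then 1 else 0)"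
proof (cases "rep_iso G s r")
  case True
  then have "char_pair (char_of r) (char_of s) = char_pair (char_of r) (char_of r)"
    using assms by (intro char_pair_cong) (auto intro: char_of_iso irreducible_is_rep)
  with True char_pair_irreducible_self[OF assms(1)] show ?thesis by simp
qed (simp add: char_pair_irreducible_not_iso[OF assms(2,1)])

lemma char_of_decomposition:
  assumes r: "is_rep G r" and rs: "\<forall>t\<in>set rs. irreducible_rep G t" "rep_iso G r (rep_dsum rs)"
    and g: "g \<in> carrier G"
  shows "char_of r g = (\<Sum>i<length rs. char_of (rs ! i) g)"
proof -
  have rep: "\<And>t. t \<in> set rs \<Longrightarrow> is_rep G t" using rs(1) by (auto intro: irreducible_is_rep)
  have "char_of r g = char_of (rep_dsum rs) g"
    by (rule char_of_iso[OF r is_rep_dsum[OF rep] rs(2) g])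
  also have "\<dots> = (\<Sum>t\<leftarrow>rs. char_of t g)" by (rule char_of_dsum[OF g rep])
  finally show ?thesis by (simp add: sum_list_sum_nth atLeast0LessThan)
qed

text \<open>By orthonormality, counting in any decomposition yields the same pairing, so the count
  is unique; complete reducibility provides a decomposition. Together they evaluate the definite
  description.\<close>

lemma multiplicity_eq_char_pair:
  assumes r: "is_rep G r" and s: "irreducible_rep G s"
  shows "of_nat (multiplicity_rep G s r) = char_pair (char_of r) (char_of s)"
proof -
  have cnt: "of_nat (length (filter (rep_iso G s) rs)) = char_pair (char_of r) (char_of s)"
    if rs: "\<forall>t\<in>set rs. irreducible_rep G t" "rep_iso G r (rep_dsum rs)" for rs
  proof -
    have "char_pair (char_of r) (char_of s) = char_pair (\<lambda>g. \<Sum>i<length rs. 1 * char_of (rs ! i) g) (char_of s)"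
      by (intro char_pair_cong) (simp_all add: char_of_decomposition[OF r rs])
    also have "\<dots> = (\<Sum>i<length rs. char_pair (char_of (rs ! i)) (char_of s))"
      unfolding char_pair_sum_left by simp
    also have "\<dots> = (\<Sum>i<length rs. if rep_iso G s (rs ! i) then 1 else 0)"
      using rs(1) s by (intro sum.cong refl) (auto simp: char_pair_irreducible)
    also have "\<dots> = of_nat (card {i. i < length rs \<and> rep_iso G s (rs ! i)})"
      by (simp add: sum.If_cases Int_def)
    finally show ?thesis by (simp add: length_filter_conv_card)
  qed
  obtain rs where rs: "\<forall>t\<in>set rs. irreducible_rep G t" "rep_iso G r (rep_dsum rs)"
    using complete_reducibility[OF r] by blast
  have "multiplicity_rep G s r = length (filter (rep_iso G s) rs)"
    unfolding multiplicity_rep_def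
  proof (rule the_equality)
    fix k assume "\<exists>rs. (\<forall>t\<in>set rs. irreducible_rep G t) \<and> rep_iso G r (rep_dsum rs) \<and> k = length (filter (rep_iso G s) rs)"
    then have "(of_nat k :: complex) = of_nat (length (filter (rep_iso G s) rs))"
      using cnt rs by metis
    then show "k = length (filter (rep_iso G s) rs)" by simp
  qed (use rs in blast)
  then show ?thesis using cnt[OF rs] by simp
qed

section \<open>Isomorphism classes of irreducibles and expansion in their characters\<close>

lemma equiv_irrep_iso_rel: "equiv {r. irreducible_rep G r} (irrep_iso_rel G)"
proof (rule equivI)
  show "irrep_iso_rel G \<subseteq> {r. irreducible_rep G r} \<times> {r. irreducible_rep G r}"
    by (auto simp: irrep_iso_rel_def)
  show "refl_on {r. irreducible_rep G r} (irrep_iso_rel G)"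
    by (auto simp: refl_on_def irrep_iso_rel_def intro: rep_iso_refl irreducible_is_rep)
  show "sym (irrep_iso_rel G)"
    by (auto simp: sym_def irrep_iso_rel_def intro: rep_iso_sym irreducible_is_rep)
  show "trans (irrep_iso_rel G)"
    unfolding trans_def irrep_iso_rel_def
    using rep_iso_trans irreducible_is_rep by blast
qed

lemma class_rep_mem:
  assumes "C \<in> Irr G"
  shows "class_rep C \<in> C"
proof -
  have "C \<noteq> {}" using assms in_quotient_imp_non_empty[OF equiv_irrep_iso_rel] by (auto simp: Irr_def)
  then show ?thesis unfolding class_rep_def by (auto intro: someI)
qed

lemma class_rep_irreducible: "C \<in> Irr G \<Longrightarrow> irreducible_rep G (class_rep C)"
  using class_rep_mem in_quotient_imp_subset[OF equiv_irrep_iso_rel] by (auto simp: Irr_def)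

lemma class_rep_is_rep: "C \<in> Irr G \<Longrightarrow> is_rep G (class_rep C)"
  by (rule irreducible_is_rep[OF class_rep_irreducible])

lemma mem_Irr_iff:
  assumes C: "C \<in> Irr G" and r: "irreducible_rep G r"
  shows "r \<in> C \<longleftrightarrow> rep_iso G (class_rep C) r"
proof
  show "rep_iso G (class_rep C) r" if "r \<in> C"
    using in_quotient_imp_in_rel[OF equiv_irrep_iso_rel, of C "class_rep C" r] that C class_rep_mem[OF C]
    by (auto simp: Irr_def irrep_iso_rel_def)
  show "r \<in> C" if "rep_iso G (class_rep C) r"
    using in_quotient_imp_closed[OF equiv_irrep_iso_rel, of C "class_rep C" r] that C class_rep_mem[OF C]
      class_rep_irreducible[OF C] r
    by (auto simp: Irr_def irrep_iso_rel_def)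
qed

lemma Irr_ex1:
  assumes r: "irreducible_rep G r"
  shows "\<exists>!C. C \<in> Irr G \<and> r \<in> C"
proof (rule ex1I)
  show "irrep_iso_rel G `` {r} \<in> Irr G \<and> r \<in> irrep_iso_rel G `` {r}"
    using r equiv_class_self[OF equiv_irrep_iso_rel, of r] by (auto simp: Irr_def quotientI)
  show "C = irrep_iso_rel G `` {r}" if "C \<in> Irr G \<and> r \<in> C" for C
    using that quotient_eq_iff[OF equiv_irrep_iso_rel, of C "irrep_iso_rel G `` {r}" r r]
      r equiv_class_self[OF equiv_irrep_iso_rel, of r] equiv_irrep_iso_rel
    by (auto simp: Irr_def quotientI equiv_def refl_on_def)
qed

lemma char_pair_class_rep:
  assumes r: "irreducible_rep G r" and C: "C \<in> Irr G"
  shows "char_pair (char_of r) (char_of (class_rep C)) = (if r \<in> C then 1 else 0)"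
  using char_pair_irreducible[OF r class_rep_irreducible[OF C]] mem_Irr_iff[OF C r] by simp

lemma char_pair_Irr:
  assumes C: "C \<in> Irr G" and D: "D \<in> Irr G"
  shows "char_pair (char_of (class_rep C)) (char_of (class_rep D)) = (if C = D then 1 else 0)"
proof -
  have "class_rep C \<in> D \<longleftrightarrow> C = D"
    using Irr_ex1[OF class_rep_irreducible[OF C]] C D class_rep_mem[OF C] by blast
  then show ?thesis using char_pair_class_rep[OF class_rep_irreducible[OF C] D] by simp
qed

text \<open>If there were more than \<open>|G|\<close> classes, the orthonormality of their characters would
  factor an invertible matrix through \<open>|G|\<close> dimensions.\<close>

lemma finite_Irr: "finite (Irr G)"
proof (rule ccontr)
  assume "infinite (Irr G)"
  define q where "q = card (carrier G)"
  define N where "N = Suc q"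
  obtain F where F: "F \<subseteq> Irr G" "card F = N" "finite F"
    using infinite_arbitrarily_large[OF \<open>infinite (Irr G)\<close>, of N] by auto
  obtain c where c: "bij_betw c {..<N} F"
    using ex_bij_betw_nat_finite[OF F(3)] F(2) by (auto simp: atLeast0LessThan)
  obtain e where e: "bij_betw e {..<q} (carrier G)"
    using ex_bij_betw_nat_finite[OF finite_carrier] by (auto simp: atLeast0LessThan q_def)
  define A where "A = mat N N (\<lambda>(i, j). if j < q then char_of (class_rep (c i)) (e j) else 0)"
  define B where "B = mat N N (\<lambda>(j, i). if j < q then char_of (class_rep (c i)) (inv e j) / card\<^sub>G else 0)"
  have AB: "A \<in> carrier_mat N N" "B \<in> carrier_mat N N" by (auto simp: A_def B_def)
  have cI: "c i \<in> Irr G" if "i < N" for i using c F(1) that by (auto simp: bij_betw_def)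
  have "A * B = 1\<^sub>m N"
  proof (rule eq_matI)
    fix i j assume "i < dim_row (1\<^sub>m N :: complex mat)" "j < dim_col (1\<^sub>m N :: complex mat)"
    then have ij: "i < N" "j < N" by auto
    have "(A * B) $$ (i, j) = (\<Sum>l<N. A $$ (i, l) * B $$ (l, j))"
      by (rule index_mult_mat_sum[OF AB ij])
    also have "\<dots> = (\<Sum>l<q. A $$ (i, l) * B $$ (l, j)) + A $$ (i, q) * B $$ (q, j)"
      by (simp add: N_def)
    also have "A $$ (i, q) = 0" using ij by (simp add: A_def N_def)
    also have "(\<Sum>l<q. A $$ (i, l) * B $$ (l, j)) + 0 * B $$ (q, j)
        = (\<Sum>l<q. char_of (class_rep (c i)) (e l) * char_of (class_rep (c j)) (inv e l) / card\<^sub>G)"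
      using ij by (simp add: A_def B_def N_def)
    also have "\<dots> = char_pair (char_of (class_rep (c i))) (char_of (class_rep (c j)))"
      unfolding char_pair_def sum_divide_distrib[symmetric]
      by (subst sum.reindex_bij_betw[OF e, symmetric]) (rule refl)
    also have "\<dots> = (if c i = c j then 1 else 0)" by (rule char_pair_Irr[OF cI[OF ij(1)] cI[OF ij(2)]])
    also have "c i = c j \<longleftrightarrow> i = j" using c ij by (auto simp: bij_betw_def inj_on_def)
    finally show "(A * B) $$ (i, j) = 1\<^sub>m N $$ (i, j)" using ij by simp
  qed (use AB in auto)
  then have "B * A = 1\<^sub>m N" by (rule mat_mult_left_right_inverse[OF AB])
  then have "(B * A) $$ (q, q) = 1" by (simp add: N_def)
  moreover have "(B * A) $$ (q, q) = 0"
    by (subst index_mult_mat_sum[OF AB(2,1)]) (auto simp: A_def B_def N_def)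
  ultimately show False by simp
qed

text \<open>For an irreducible representation only its own class contributes; a decomposition
  extends this additively. Finiteness of \<open>Irr G\<close> matters, as a sum over an infinite set
  would be 0 by convention. Expanding characters of representations is enough for the moments;
  general class functions do not occur.\<close>

lemma char_of_eq_sum_Irr:
  assumes r: "is_rep G r" and g: "g \<in> carrier G"
  shows "(\<Sum>C\<in>Irr G. char_pair (char_of r) (char_of (class_rep C)) * char_of (class_rep C) g) = char_of r g"
proof -
  have irr: "(\<Sum>C\<in>Irr G. char_pair (char_of t) (char_of (class_rep C)) * char_of (class_rep C) g) = char_of t g"
    if t: "irreducible_rep G t" for t
  proof -
    from Irr_ex1[OF t] obtain C where C: "C \<in> Irr G" "t \<in> C"
      and un: "\<forall>D. D \<in> Irr G \<and> t \<in> D \<longrightarrow> D = C"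
      unfolding Ex1_def by (elim exE conjE)
    have "(\<Sum>D\<in>Irr G. char_pair (char_of t) (char_of (class_rep D)) * char_of (class_rep D) g)
        = (\<Sum>D\<in>Irr G. if D = C then char_of (class_rep C) g else 0)"
    proof (rule sum.cong[OF refl])
      fix D assume D: "D \<in> Irr G"
      have "t \<in> D \<longleftrightarrow> D = C" using C un D by metis
      then show "char_pair (char_of t) (char_of (class_rep D)) * char_of (class_rep D) g
          = (if D = C then char_of (class_rep C) g else 0)"
        unfolding char_pair_class_rep[OF t D] by simp
    qed
    also have "\<dots> = char_of (class_rep C) g" using C(1) finite_Irr by simp
    also have "\<dots> = char_of t g"
      using mem_Irr_iff[OF C(1) t] C(2) by (intro char_of_iso[OF class_rep_is_rep[OF C(1)] irreducible_is_rep[OF t] _ g]) simp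
    finally show ?thesis .
  qed
  obtain rs where rs: "\<forall>t\<in>set rs. irreducible_rep G t" "rep_iso G r (rep_dsum rs)"
    using complete_reducibility[OF r] by blast
  have p: "char_pair (char_of r) \<psi> = (\<Sum>i<length rs. char_pair (char_of (rs ! i)) \<psi>)" for \<psi>
  proof -
    have "char_pair (char_of r) \<psi> = char_pair (\<lambda>g. \<Sum>i<length rs. 1 * char_of (rs ! i) g) \<psi>"
      by (intro char_pair_cong) (simp_all add: char_of_decomposition[OF r rs])
    then show ?thesis unfolding char_pair_sum_left by simp
  qed
  have "(\<Sum>C\<in>Irr G. char_pair (char_of r) (char_of (class_rep C)) * char_of (class_rep C) g)
      = (\<Sum>i<length rs. \<Sum>C\<in>Irr G. char_pair (char_of (rs ! i)) (char_of (class_rep C)) * char_of (class_rep C) g)"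
    unfolding p sum_distrib_right by (rule sum.swap)
  also have "\<dots> = (\<Sum>i<length rs. char_of (rs ! i) g)"
    using rs(1) by (intro sum.cong refl irr) auto
  also have "\<dots> = char_of r g" by (rule char_of_decomposition[OF r rs g, symmetric])
  finally show ?thesis .
qed

lemma is_rep_trivial: "is_rep G trivial_rep"
  by (auto simp: is_rep_iff[OF group_axioms] trivial_rep_def)

lemma irreducible_trivial: "irreducible_rep G trivial_rep"
  unfolding irreducible_rep_def
proof (intro conjI allI impI is_rep_trivial)
  fix U assume "invariant_subspace G trivial_rep U"
  then have U: "U \<subseteq> carrier_vec 1" "0\<^sub>v 1 \<in> U" "\<And>c u. u \<in> U \<Longrightarrow> c \<cdot>\<^sub>v u \<in> U"
    unfolding invariant_subspace_def subspace_vec_iff by (auto simp: trivial_rep_def)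
  have "v \<in> U" if u: "u \<in> U" "u \<noteq> 0\<^sub>v 1" and v: "v \<in> carrier_vec 1" for u v
  proof -
    have uc: "u \<in> carrier_vec 1" using u U(1) by blast
    have "u $ 0 \<noteq> 0"
    proof
      assume "u $ 0 = 0"
      then have "u = 0\<^sub>v 1" using uc by (intro eq_vecI) auto
      with u(2) show False ..
    qed
    then have "v = (v $ 0 / u $ 0) \<cdot>\<^sub>v u" using uc v by (intro eq_vecI) auto
    with U(3)[OF u(1)] show ?thesis by metis
  qed
  then have "U = {0\<^sub>v 1} \<or> U = carrier_vec 1" using U(1,2) by blast
  then show "U = {0\<^sub>v (fst trivial_rep)} \<or> U = carrier_vec (fst trivial_rep)" by (simp add: trivial_rep_def)
qed (simp add: trivial_rep_def)

end

section \<open>Moments of the McKay graph\<close>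

text \<open>Moves the powers of \<Delta> to the other argument as powers of its adjoint, so that a
  moment becomes the inner product of two vectors of the same family.\<close>

lemma inner_on_adjoint:
  "inner_on I ((mat_act I A ^^ m) u) v = inner_on I u ((mat_act I (mat_star A) ^^ m) v)"
proof (induction m arbitrary: v)
  case (Suc m)
  have step: "inner_on I (mat_act I A x) y = inner_on I x (mat_act I (mat_star A) y)" for x y
    unfolding inner_on_def mat_act_def mat_star_def cnj_sum sum_distrib_left sum_distrib_right
    by (subst sum.swap) (simp add: mult_ac)
  show ?case
    by (simp add: step Suc.IH) (simp add: funpow_swap1)
qed simp

lemma mckay_moment_eq_average:
  assumes \<Gamma>: "subgroup \<Gamma> (SU 3)" "finite \<Gamma>" and SU: "Group.group (SU 3)"
  shows "mckay_moment \<Gamma> m n = (\<Sum>g\<in>\<Gamma>. mat_trace g ^ n * cnj (mat_trace g) ^ m) / of_nat (card \<Gamma>)"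
proof -
  define G where "G = as_group \<Gamma>"
  have cG: "carrier G = \<Gamma>" and mG: "mult G = (*)" and oG: "one G = 1\<^sub>m 3"
    by (simp_all add: G_def as_group_def SU_def)
  have "Group.group G"
    using subgroup.subgroup_is_group[OF \<Gamma>(1) SU] by (simp add: G_def as_group_def)
  then interpret finite_group G
    using \<Gamma>(2) by (intro finite_group.intro finite_group_axioms.intro) (simp_all add: cG)
  have SUc: "g \<in> carrier_mat 3 3" "g * mat_adjoint g = 1\<^sub>m 3" if "g \<in> \<Gamma>" for g
    using subgroup.subset[OF \<Gamma>(1)] that by (auto simp: SU_def)
  define I where "I = Irr G"
  define \<xi> where "\<xi> = (\<lambda>C. char_of (class_rep C))"
  have rho: "is_rep G inclusion_rep"
    unfolding is_rep_iff[OF group_axioms] using SUc by (auto simp: inclusion_rep_def cG mG oG)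
  have chi_rho: "char_of inclusion_rep g = mat_trace g" for g
    by (simp add: char_of_def inclusion_rep_def)
  \<comment> \<open>Unitarity makes the group inverse the adjoint matrix; this is where the complex
    conjugate in the moments originates.\<close>
  have chi_inv: "mat_trace (inv\<^bsub>G\<^esub> g) = cnj (mat_trace g)" if g: "g \<in> \<Gamma>" for g
  proof -
    have ig: "inv\<^bsub>G\<^esub> g \<in> \<Gamma>" "inv\<^bsub>G\<^esub> g * g = 1\<^sub>m 3"
      using g inv_closed[of g] l_inv[of g] by (auto simp: cG mG oG)
    have adj: "mat_adjoint g \<in> carrier_mat 3 3"
      using SUc(1)[OF g] by (auto simp: mat_adjoint_def)
    have "inv\<^bsub>G\<^esub> g = inv\<^bsub>G\<^esub> g * (g * mat_adjoint g)"
      using SUc[OF ig(1)] SUc(2)[OF g] by simp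
    also have "\<dots> = (inv\<^bsub>G\<^esub> g * g) * mat_adjoint g"
      by (rule assoc_mult_mat[OF SUc(1)[OF ig(1)] SUc(1)[OF g] adj, symmetric])
    also have "\<dots> = mat_adjoint g" using ig adj by simp
    finally have "inv\<^bsub>G\<^esub> g = mat_adjoint g" .
    moreover have "mat_adjoint g $$ (i, i) = cnj (g $$ (i, i))" if "i < 3" for i
      using SUc(1)[OF g] that by (simp add: mat_adjoint_def mat_of_rows_def)
    ultimately show ?thesis using SUc(1)[OF g] adj by (simp add: mat_trace_def)
  qed
  define \<Delta> where "\<Delta> = mckay_adj \<Gamma>"
  have adj: "\<Delta> C D = char_pair (\<lambda>g. mat_trace g * \<xi> C g) (\<xi> D)" if "C \<in> I" "D \<in> I" for C D
  proof -
    note C = that[unfolded I_def]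
    have "\<Delta> C D = char_pair (char_of (rep_tensor inclusion_rep (class_rep C))) (char_of (class_rep D))"
      unfolding \<Delta>_def mckay_adj_def G_def[symmetric]
      by (rule multiplicity_eq_char_pair[OF is_rep_tensor[OF rho class_rep_is_rep[OF C(1)]] class_rep_irreducible[OF C(2)]])
    also have "\<dots> = char_pair (\<lambda>g. mat_trace g * \<xi> C g) (\<xi> D)"
      by (intro char_pair_cong) (simp_all add: char_of_tensor[OF rho class_rep_is_rep[OF C(1)]] \<xi>_def chi_rho)
    finally show ?thesis .
  qed
  \<comment> \<open>The entries are multiplicities, so the adjoint of \<Delta> is its transpose, and
    the iterates of \<open>mckay_e1\<close> stay real.\<close>
  have real: "cnj (\<Delta> C D) = \<Delta> C D" for C D by (simp add: \<Delta>_def mckay_adj_def)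
  define v where "v k = (mat_act I (mat_star \<Delta>) ^^ k) mckay_e1" for k
  have v_real: "cnj (v k C) = v k C" for k C
  proof (induction k arbitrary: C)
    case (Suc k)
    then show ?case by (simp add: v_def mat_act_def mat_star_def real)
  qed (simp add: v_def mckay_e1_def)
  \<comment> \<open>Row D of \<Delta> holds the coordinates of the character of the inclusion times
    \<xi>_D, hence one application of the transpose multiplies the represented function by the
    trace.\<close>
  have v_char: "(\<Sum>C\<in>I. v k C * \<xi> C g) = mat_trace g ^ k" if g: "g \<in> \<Gamma>" for k g
  proof (induction k)
    case 0
    have "v 0 C = char_pair (char_of trivial_rep) (\<xi> C)" if "C \<in> I" for C
      using char_pair_class_rep[OF irreducible_trivial] that by (simp add: v_def mckay_e1_def I_def \<xi>_def)
    then have "(\<Sum>C\<in>I. v 0 C * \<xi> C g) = char_of trivial_rep g"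
      using char_of_eq_sum_Irr[OF is_rep_trivial, of g] g by (simp add: I_def \<xi>_def cG)
    then show ?case by (simp add: char_of_def trivial_rep_def mat_trace_def)
  next
    case (Suc k)
    have "(\<Sum>C\<in>I. v (Suc k) C * \<xi> C g) = (\<Sum>C\<in>I. \<Sum>D\<in>I. \<Delta> D C * v k D * \<xi> C g)"
      by (simp add: v_def mat_act_def mat_star_def real sum_distrib_right)
    also have "\<dots> = (\<Sum>D\<in>I. v k D * (\<Sum>C\<in>I. \<Delta> D C * \<xi> C g))"
      by (subst sum.swap) (simp add: sum_distrib_left mult_ac)
    also have "\<dots> = (\<Sum>D\<in>I. v k D * (mat_trace g * \<xi> D g))"
    proof (intro sum.cong refl)
      fix D assume D: "D \<in> I"
      have r: "is_rep G (rep_tensor inclusion_rep (class_rep D))"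
        by (rule is_rep_tensor[OF rho class_rep_is_rep]) (use D in \<open>simp add: I_def\<close>)
      have ch: "char_of (rep_tensor inclusion_rep (class_rep D)) h = mat_trace h * \<xi> D h" if "h \<in> carrier G" for h
        using char_of_tensor[OF rho class_rep_is_rep that] D by (simp add: I_def \<xi>_def chi_rho)
      have "(\<Sum>C\<in>I. \<Delta> D C * \<xi> C g)
          = (\<Sum>C\<in>I. char_pair (char_of (rep_tensor inclusion_rep (class_rep D))) (\<xi> C) * \<xi> C g)"
      proof (intro sum.cong refl)
        fix C assume C: "C \<in> I"
        have "char_pair (char_of (rep_tensor inclusion_rep (class_rep D))) (\<xi> C)
            = char_pair (\<lambda>g. mat_trace g * \<xi> D g) (\<xi> C)"
          by (rule char_pair_cong) (simp_all add: ch)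
        then show "\<Delta> D C * \<xi> C g
            = char_pair (char_of (rep_tensor inclusion_rep (class_rep D))) (\<xi> C) * \<xi> C g"
          using adj[OF D C] by simp
      qed
      also have "\<dots> = mat_trace g * \<xi> D g"
        using char_of_eq_sum_Irr[OF r, of g] ch[of g] g by (simp add: I_def \<xi>_def cG)
      finally show "v k D * (\<Sum>C\<in>I. \<Delta> D C * \<xi> C g) = v k D * (mat_trace g * \<xi> D g)" by simp
    qed
    also have "\<dots> = mat_trace g * (\<Sum>D\<in>I. v k D * \<xi> D g)"
      by (simp add: sum_distrib_left mult_ac)
    finally show ?case by (simp add: Suc.IH)
  qed
  have "mckay_moment \<Gamma> m n = inner_on I (v n) (v m)"
    unfolding mckay_moment_def Let_def mckay_vertices_def \<Delta>_def[symmetric] G_def[symmetric] I_def[symmetric]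
    by (simp add: inner_on_adjoint v_def)
  also have "\<dots> = (\<Sum>C\<in>I. v n C * v m C)" by (simp add: inner_on_def v_real)
  \<comment> \<open>Parseval: orthonormality is inserted as a double sum, which bilinearity
    collapses to the pairing of the two represented functions.\<close>
  also have "\<dots> = (\<Sum>C\<in>I. v n C * (\<Sum>D\<in>I. v m D * char_pair (\<xi> C) (\<xi> D)))"
  proof (intro sum.cong refl)
    fix C assume C: "C \<in> I"
    have "(\<Sum>D\<in>I. v m D * char_pair (\<xi> C) (\<xi> D)) = (\<Sum>D\<in>I. if D = C then v m C else 0)"
      using C by (intro sum.cong refl) (auto simp: I_def \<xi>_def char_pair_Irr)
    also have "\<dots> = v m C" using C finite_Irr by (simp add: I_def)
    finally show "v n C * v m C = v n C * (\<Sum>D\<in>I. v m D * char_pair (\<xi> C) (\<xi> D))" by simp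
  qed
  also have "\<dots> = char_pair (\<lambda>g. \<Sum>C\<in>I. v n C * \<xi> C g) (\<lambda>g. \<Sum>D\<in>I. v m D * \<xi> D g)"
    by (simp only: char_pair_sum_left char_pair_sum_right)
  also have "\<dots> = char_pair (\<lambda>g. mat_trace g ^ n) (\<lambda>g. mat_trace g ^ m)"
    by (intro char_pair_cong) (simp_all add: v_char cG)
  also have "\<dots> = (\<Sum>g\<in>\<Gamma>. mat_trace g ^ n * cnj (mat_trace g) ^ m) / of_nat (card \<Gamma>)"
    by (simp add: char_pair_def cG chi_inv)
  finally show ?thesis .
qed

section \<open>The special unitary group\<close>

lemma mat_adjoint_simps:
  fixes A :: "'a::conjugatable_field mat"
  assumes "A \<in> carrier_mat n m"
  shows "mat_adjoint A \<in> carrier_mat m n" "\<And>i j. i < m \<Longrightarrow> j < n \<Longrightarrow> mat_adjoint A $$ (i, j) = conjugate (A $$ (j, i))"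
  using assms by (auto simp: mat_adjoint_def mat_of_rows_def)

lemma mat_adjoint_mult:
  fixes A B :: "complex mat"
  assumes "A \<in> carrier_mat n n" "B \<in> carrier_mat n n"
  shows "mat_adjoint (A * B) = mat_adjoint B * mat_adjoint A"
proof (rule eq_matI)
  note c = mat_adjoint_simps[OF assms(1)] mat_adjoint_simps[OF assms(2)] mat_adjoint_simps[OF mult_carrier_mat[OF assms]]
  fix i j assume "i < dim_row (mat_adjoint B * mat_adjoint A)" "j < dim_col (mat_adjoint B * mat_adjoint A)"
  then have ij: "i < n" "j < n" using c by auto
  have "mat_adjoint (A * B) $$ (i, j) = cnj (\<Sum>l<n. A $$ (j, l) * B $$ (l, i))"
    using c(6)[OF ij] index_mult_mat_sum[OF assms ij(2,1)] by (simp add: conjugate_complex_def)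
  also have "\<dots> = (\<Sum>l<n. mat_adjoint B $$ (i, l) * mat_adjoint A $$ (l, j))"
    using c(2,4) ij by (simp add: mult.commute conjugate_complex_def)
  also have "\<dots> = (mat_adjoint B * mat_adjoint A) $$ (i, j)"
    by (rule index_mult_mat_sum[OF c(3,1) ij, symmetric])
  finally show "mat_adjoint (A * B) $$ (i, j) = (mat_adjoint B * mat_adjoint A) $$ (i, j)" .
qed (use mat_adjoint_simps[OF assms(1)] mat_adjoint_simps[OF assms(2)] mat_adjoint_simps[OF mult_carrier_mat[OF assms]] in auto)

lemma group_SU: "Group.group (SU n)"
proof (rule groupI)
  have c: "A \<in> carrier_mat n n" "mat_adjoint A \<in> carrier_mat n n" "A * mat_adjoint A = 1\<^sub>m n" "det A = 1"
    if "A \<in> carrier (SU n)" for A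
    using that mat_adjoint_simps(1)[of A n n] by (auto simp: SU_def)
  show "A \<otimes>\<^bsub>SU n\<^esub> B \<in> carrier (SU n)" if "A \<in> carrier (SU n)" "B \<in> carrier (SU n)" for A B
  proof -
    note a = c[OF that(1)] and b = c[OF that(2)]
    have "(A * B) * (mat_adjoint B * mat_adjoint A) = A * (B * (mat_adjoint B * mat_adjoint A))"
      by (rule assoc_mult_mat[OF a(1) b(1) mult_carrier_mat[OF b(2) a(2)]])
    also have "B * (mat_adjoint B * mat_adjoint A) = (B * mat_adjoint B) * mat_adjoint A"
      by (rule assoc_mult_mat[OF b(1,2) a(2), symmetric])
    finally have "(A * B) * mat_adjoint (A * B) = 1\<^sub>m n"
      using a b by (simp add: mat_adjoint_mult[OF a(1) b(1)])
    then show ?thesis using a b by (simp add: SU_def det_mult[OF a(1) b(1)])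
  qed
  show "\<one>\<^bsub>SU n\<^esub> \<in> carrier (SU n)"
  proof -
    have "mat_adjoint (1\<^sub>m n) = (1\<^sub>m n :: complex mat)"
      using carrier_matD[OF mat_adjoint_simps(1)[OF one_carrier_mat], of n]
      by (intro eq_matI) (auto simp: mat_adjoint_simps(2)[OF one_carrier_mat] conjugate_complex_def)
    then show ?thesis by (simp add: SU_def)
  qed
  show "A \<otimes>\<^bsub>SU n\<^esub> B \<otimes>\<^bsub>SU n\<^esub> C = A \<otimes>\<^bsub>SU n\<^esub> (B \<otimes>\<^bsub>SU n\<^esub> C)"
    if "A \<in> carrier (SU n)" "B \<in> carrier (SU n)" "C \<in> carrier (SU n)" for A B C
    using assoc_mult_mat[OF c(1)[OF that(1)] c(1)[OF that(2)] c(1)[OF that(3)]] by (simp add: SU_def)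
  show "\<one>\<^bsub>SU n\<^esub> \<otimes>\<^bsub>SU n\<^esub> A = A" if "A \<in> carrier (SU n)" for A
    using c[OF that] by (simp add: SU_def)
  show "\<exists>B\<in>carrier (SU n). B \<otimes>\<^bsub>SU n\<^esub> A = \<one>\<^bsub>SU n\<^esub>" if A: "A \<in> carrier (SU n)" for A
  proof (intro bexI)
    note a = c[OF A]
    have inv: "mat_adjoint A * A = 1\<^sub>m n" by (rule mat_mult_left_right_inverse[OF a(1,2,3)])
    then show "mat_adjoint A \<otimes>\<^bsub>SU n\<^esub> A = \<one>\<^bsub>SU n\<^esub>" by (simp add: SU_def)
    have "mat_adjoint (mat_adjoint A) = A"
      using a by (intro eq_matI) (auto simp: mat_adjoint_simps[OF a(2)] mat_adjoint_simps[OF a(1)]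
        carrier_matD[OF mat_adjoint_simps(1)[OF a(2)]])
    moreover have "det (mat_adjoint A) = 1"
      using arg_cong[OF a(3), of det] a(4) by (simp add: det_mult[OF a(1,2)])
    ultimately show "mat_adjoint A \<in> carrier (SU n)" using a inv by (simp add: SU_def)
  qed
qed

lemma det_3:
  fixes A :: "'a::comm_ring_1 mat"
  assumes A: "A \<in> carrier_mat 3 3"
  shows "det A = A $$ (0,0) * (A $$ (1,1) * A $$ (2,2) - A $$ (1,2) * A $$ (2,1))
    - A $$ (0,1) * (A $$ (1,0) * A $$ (2,2) - A $$ (1,2) * A $$ (2,0))
    + A $$ (0,2) * (A $$ (1,0) * A $$ (2,1) - A $$ (1,1) * A $$ (2,0))"
proof -
  have det2: "det (mat 2 2 f) = f (0, 0) * f (1, 1) - f (0, 1) * f (1, 0)" for f :: "nat \<times> nat \<Rightarrow> 'a"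
  proof -
    have B: "mat 2 2 f \<in> carrier_mat 2 2" by simp
    have "det (mat 2 2 f) = mat 2 2 f $$ (0, 0) * cofactor (mat 2 2 f) 0 0 + mat 2 2 f $$ (0, 1) * cofactor (mat 2 2 f) 0 1"
      by (subst laplace_expansion_row[OF B, of 0]) (simp_all add: numeral_2_eq_2)
    moreover have "mat_delete (mat 2 2 f) 0 j \<in> carrier_mat 1 1" for j
      by (simp add: mat_delete_def)
    ultimately show ?thesis
      by (simp add: cofactor_def det_single) (simp add: mat_delete_def)
  qed
  have dims: "dim_row A = 3" "dim_col A = 3" using A by auto
  have "det A = A $$ (0, 0) * cofactor A 0 0 + A $$ (0, 1) * cofactor A 0 1 + A $$ (0, 2) * cofactor A 0 2"
    by (subst laplace_expansion_row[OF A, of 0]) (simp_all add: numeral_3_eq_3 numeral_2_eq_2)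
  then show ?thesis
    by (simp add: cofactor_def mat_delete_def dims det2 numeral_2_eq_2[symmetric] right_diff_distrib del: Suc_1)
qed

section \<open>The group \<open>\<Sigma>(72\<times>3)\<close>\<close>

lemma Re_omega: "Re \<omega> = -1/2" and Im_omega: "Im \<omega> = sqrt 3 / 2"
proof -
  have w: "\<omega> = cis (2 * pi / 3)"
    by (simp add: \<omega>_def cis_conv_exp mult_ac)
  show "Re \<omega> = -1/2" "Im \<omega> = sqrt 3 / 2"
    unfolding w using cos_120 sin_120 by simp_all
qed

text \<open>As a rewrite rule, together with the reassociated form that follows, this reduces
  polynomials in \<omega> to the shape a + b \<omega>; the table checks below then become
  normalizations.\<close>

lemma omega_mult_self: "\<omega> * \<omega> = -1 - \<omega>"
  by (simp add: complex_eq_iff Re_omega Im_omega)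

lemma omega_mult_left: "\<omega> * (\<omega> * z) = - z - \<omega> * z"
  unfolding mult.assoc[symmetric] omega_mult_self by (simp add: algebra_simps)

lemma omega_cube [simp]: "\<omega> ^ 3 = 1"
  by (simp add: power3_eq_cube omega_mult_self algebra_simps)

lemma omega_power_mod: "\<omega> ^ (n mod 3) = \<omega> ^ n"
proof -
  have "\<omega> ^ n = \<omega> ^ (3 * (n div 3) + n mod 3)" by simp
  also have "\<dots> = \<omega> ^ (n mod 3)" unfolding power_add power_mult by simp
  finally show ?thesis ..
qed

lemma omega_powers: "\<omega>\<^sup>2 = -1 - \<omega>" "\<omega> ^ 4 = \<omega>" "\<omega> ^ 5 = -1 - \<omega>" "\<omega> ^ 6 = 1" 
  using omega_power_mod[of 4] omega_power_mod[of 5] omega_power_mod[of 6]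
  by (simp_all add: power2_eq_square omega_mult_self)

lemma cnj_omega: "cnj \<omega> = -1 - \<omega>"
  by (simp add: complex_eq_iff Re_omega Im_omega)

lemma omega_neq_0 [simp]: "\<omega> \<noteq> 0"
  by (simp add: \<omega>_def)

lemma omega_power_eq_iff: "i < 3 \<Longrightarrow> j < 3 \<Longrightarrow> \<omega> ^ i = \<omega> ^ j \<longleftrightarrow> i = j"
  by (auto simp: numeral_3_eq_3 less_Suc_eq omega_mult_self complex_eq_iff Re_omega Im_omega)

text \<open>The root of -3 equals 1 + 2 \<omega>, so its inverse is -(1 + 2 \<omega>) / 3 and all
  matrix entries lie in the field generated by \<omega>.\<close>

lemma inverse_sqrt_m3: "inverse sqrt_m3 = - 1 / 3 - 2 / 3 * \<omega>"
  by (rule inverse_unique) (simp add: sqrt_m3_def complex_eq_iff Re_omega Im_omega)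

text \<open>Representatives of the eight cosets of the Heisenberg group \<open>\<langle>S1, S2, T\<rangle>\<close>:
  \<open>1, V, V\<^sup>2, V\<^sup>3, W, W\<^sup>3, VW, (VW)\<^sup>3\<close>, scaled by \<open>\<surd>-3\<close>.\<close>

definition coset_table :: "complex list list list" where
  "coset_table =
    [[[1 + 2 * \<omega>, 0, 0], [0, 1 + 2 * \<omega>, 0], [0, 0, 1 + 2 * \<omega>]],
     [[1, 1, 1], [1, \<omega>, \<omega>\<^sup>2], [1, \<omega>\<^sup>2, \<omega>]],
     [[- 1 - 2 * \<omega>, 0, 0], [0, 0, - 1 - 2 * \<omega>], [0, - 1 - 2 * \<omega>, 0]],
     [[-1, -1, -1], [-1, - (\<omega>\<^sup>2), -\<omega>], [-1, -\<omega>, - (\<omega>\<^sup>2)]],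
     [[1, 1, \<omega>\<^sup>2], [1, \<omega>, \<omega>], [\<omega>, 1, \<omega>]],
     [[-1, -1, - (\<omega>\<^sup>2)], [-1, - (\<omega>\<^sup>2), -1], [-\<omega>, - (\<omega>\<^sup>2), - (\<omega>\<^sup>2)]],
     [[-\<omega>, -\<omega>, - (\<omega>\<^sup>2)], [-\<omega>, -1, -1], [-1, -\<omega>, -1]],
     [[1, 1, \<omega>], [1, \<omega>, 1], [\<omega>\<^sup>2, \<omega>, \<omega>]]]"

definition coset_entry :: "nat \<Rightarrow> nat \<Rightarrow> nat \<Rightarrow> complex" where
  "coset_entry i x y = coset_table ! i ! x ! y * inverse sqrt_m3"

text \<open>The product \<open>S2\<^sup>a S1\<^sup>b T\<^sup>c Q\<close> for the \<open>i\<close>-th representative \<open>Q\<close>.\<close>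

definition sigma_elt :: "nat \<Rightarrow> nat \<Rightarrow> nat \<Rightarrow> nat \<Rightarrow> complex mat" where
  "sigma_elt a b c i = mat 3 3 (\<lambda>(x, y). \<omega> ^ (a + b * x) * coset_entry i ((x + c) mod 3) y)"

lemma less_3_iff: "(x::nat) < 3 \<longleftrightarrow> x = 0 \<or> x = 1 \<or> x = 2" by auto

lemma less_8_iff: "(x::nat) < 8 \<longleftrightarrow> x = 0 \<or> x = 1 \<or> x = 2 \<or> x = 3 \<or> x = 4 \<or> x = 5 \<or> x = 6 \<or> x = 7" by auto

lemma sum_lessThan_3: "(\<Sum>i<3. f i) = f 0 + f 1 + (f 2 :: 'a)" for f :: "nat \<Rightarrow> 'a::comm_monoid_add"
  by (simp add: numeral_3_eq_3 numeral_2_eq_2)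

lemma mult_carrier_mat_3 [simp]:
  "A \<in> carrier_mat 3 3 \<Longrightarrow> B \<in> carrier_mat 3 3 \<Longrightarrow> A * B \<in> carrier_mat 3 3"
  by (rule mult_carrier_mat)

lemma sigma_elt_carrier [simp]: "sigma_elt a b c i \<in> carrier_mat 3 3"
  by (simp add: sigma_elt_def)

lemma index_sigma_elt:
  "x < 3 \<Longrightarrow> y < 3 \<Longrightarrow> sigma_elt a b c i $$ (x, y) = \<omega> ^ (a + b * x) * coset_entry i ((x + c) mod 3) y"
  by (simp add: sigma_elt_def)

lemma generators_carrier [simp]: "S1_mat \<in> carrier_mat 3 3" "S2_mat \<in> carrier_mat 3 3" "T_mat \<in> carrier_mat 3 3"
  "V_mat \<in> carrier_mat 3 3" "W_mat \<in> carrier_mat 3 3"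
  by (auto simp: S1_mat_def S2_mat_def T_mat_def V_mat_def W_mat_def mat_of_rows_list_def)

lemma eq_mat_3I:
  assumes "A \<in> carrier_mat 3 3" "B \<in> carrier_mat 3 3"
    "\<And>i j. i < 3 \<Longrightarrow> j < 3 \<Longrightarrow> A $$ (i, j) = B $$ (i, j)"
  shows "A = B"
  using assms by (intro eq_matI) auto

lemma index_mult_mat_3:
  "A \<in> carrier_mat 3 3 \<Longrightarrow> B \<in> carrier_mat 3 3 \<Longrightarrow> i < 3 \<Longrightarrow> j < 3 \<Longrightarrow>
    (A * B) $$ (i, j) = A $$ (i, 0) * B $$ (0, j) + A $$ (i, 1) * B $$ (1, j) + A $$ (i, 2) * B $$ (2, j)"
  by (simp add: index_mult_mat_sum[of A 3 3 B 3] sum_lessThan_3 del: index_mult_mat)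

lemma index_S1: "i < 3 \<Longrightarrow> j < 3 \<Longrightarrow> S1_mat $$ (i, j) = (if i = j then \<omega> ^ i else 0)"
  unfolding S1_mat_def less_3_iff by (elim disjE) (simp_all add: mat_of_rows_list_def)

lemma index_S2: "i < 3 \<Longrightarrow> j < 3 \<Longrightarrow> S2_mat $$ (i, j) = (if i = j then \<omega> else 0)"
  unfolding S2_mat_def less_3_iff by (elim disjE) (simp_all add: mat_of_rows_list_def)

lemma index_T: "i < 3 \<Longrightarrow> j < 3 \<Longrightarrow> T_mat $$ (i, j) = (if j = (i + 1) mod 3 then 1 else 0)"
  unfolding T_mat_def less_3_iff by (elim disjE) (simp_all add: mat_of_rows_list_def)

lemma index_V: "i < 3 \<Longrightarrow> j < 3 \<Longrightarrow> V_mat $$ (i, j) = inverse sqrt_m3 * [[1, 1, 1], [1, \<omega>, \<omega>\<^sup>2], [1, \<omega>\<^sup>2, \<omega>]] ! i ! j"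
  unfolding V_mat_def by (simp add: mat_of_rows_list_def inverse_eq_divide)

lemma index_W: "i < 3 \<Longrightarrow> j < 3 \<Longrightarrow> W_mat $$ (i, j) = inverse sqrt_m3 * [[1, 1, \<omega>\<^sup>2], [1, \<omega>, \<omega>], [\<omega>, 1, \<omega>]] ! i ! j"
  unfolding W_mat_def by (simp add: mat_of_rows_list_def inverse_eq_divide)

context
  fixes M :: "complex mat" and i j :: nat
  assumes M: "M \<in> carrier_mat 3 3" and ij: "i < 3" "j < 3"
begin

lemma S1_mult: "(S1_mat * M) $$ (i, j) = \<omega> ^ i * M $$ (i, j)"
  unfolding index_mult_mat_3[OF generators_carrier(1) M ij]
  using ij(1) by (auto simp: less_3_iff index_S1)

lemma S2_mult: "(S2_mat * M) $$ (i, j) = \<omega> * M $$ (i, j)"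
  unfolding index_mult_mat_3[OF generators_carrier(2) M ij]
  using ij(1) by (auto simp: less_3_iff index_S2)

lemma T_mult: "(T_mat * M) $$ (i, j) = M $$ ((i + 1) mod 3, j)"
proof -
  have "(0::nat) < 3" "(1::nat) < 3" "(2::nat) < 3" by auto
  note e = this[THEN index_T[OF ij(1)]]
  show ?thesis
    unfolding index_mult_mat_3[OF generators_carrier(3) M ij] e
    using ij(1) unfolding less_3_iff by (elim disjE) (simp_all add: numeral_2_eq_2)
qed

lemma V_mult: "(V_mat * M) $$ (i, j) = inverse sqrt_m3 *
    ([[1, 1, 1], [1, \<omega>, \<omega>\<^sup>2], [1, \<omega>\<^sup>2, \<omega>]] ! i ! 0 * M $$ (0, j)
    + [[1, 1, 1], [1, \<omega>, \<omega>\<^sup>2], [1, \<omega>\<^sup>2, \<omega>]] ! i ! 1 * M $$ (1, j)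
    + [[1, 1, 1], [1, \<omega>, \<omega>\<^sup>2], [1, \<omega>\<^sup>2, \<omega>]] ! i ! 2 * M $$ (2, j))"
proof -
  have "(0::nat) < 3" "(1::nat) < 3" "(2::nat) < 3" by auto
  note e = this[THEN index_V[OF ij(1)]]
  show ?thesis
    unfolding index_mult_mat_3[OF generators_carrier(4) M ij] e distrib_left mult.assoc ..
qed

lemma W_mult: "(W_mat * M) $$ (i, j) = inverse sqrt_m3 *
    ([[1, 1, \<omega>\<^sup>2], [1, \<omega>, \<omega>], [\<omega>, 1, \<omega>]] ! i ! 0 * M $$ (0, j)
    + [[1, 1, \<omega>\<^sup>2], [1, \<omega>, \<omega>], [\<omega>, 1, \<omega>]] ! i ! 1 * M $$ (1, j)
    + [[1, 1, \<omega>\<^sup>2], [1, \<omega>, \<omega>], [\<omega>, 1, \<omega>]] ! i ! 2 * M $$ (2, j))"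
proof -
  have "(0::nat) < 3" "(1::nat) < 3" "(2::nat) < 3" by auto
  note e = this[THEN index_W[OF ij(1)]]
  show ?thesis
    unfolding index_mult_mat_3[OF generators_carrier(5) M ij] e distrib_left mult.assoc ..
qed

end

section \<open>Left multiplication by the generators\<close>

lemma S1_sigma_elt: "S1_mat * sigma_elt a b c i = sigma_elt a (b + 1) c i"
  by (rule eq_mat_3I) (simp_all add: S1_mult index_sigma_elt power_add power_mult power_mult_distrib del: index_mult_mat)

lemma S2_sigma_elt: "S2_mat * sigma_elt a b c i = sigma_elt (a + 1) b c i"
  by (rule eq_mat_3I) (simp_all add: S2_mult index_sigma_elt del: index_mult_mat)

lemma omega_power_mult_mod: "\<omega> ^ (b * (k mod 3)) = \<omega> ^ (b * k)"
  unfolding mult.commute[of b] power_mult omega_power_mod ..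

text \<open>T shifts the rows, so the factor \<omega>^(b x) of S1^b becomes \<omega>^(b (x + 1));
  that is T S1 = S2 S1 T, and the extra \<omega>^b is absorbed by S2^a.\<close>

lemma T_sigma_elt: "T_mat * sigma_elt a b c i = sigma_elt (a + b) b (c + 1) i"
proof (rule eq_mat_3I)
  fix x y :: nat assume xy: "x < 3" "y < 3"
  then have "(T_mat * sigma_elt a b c i) $$ (x, y)
      = \<omega> ^ a * \<omega> ^ (b * ((x + 1) mod 3)) * coset_entry i (((x + 1) mod 3 + c) mod 3) y"
    by (simp add: T_mult index_sigma_elt power_add del: index_mult_mat)
  also have "\<dots> = \<omega> ^ a * \<omega> ^ (b * (x + 1)) * coset_entry i ((x + 1 + c) mod 3) y"
    unfolding omega_power_mult_mod mod_add_left_eq ..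
  also have "\<dots> = sigma_elt (a + b) b (c + 1) i $$ (x, y)"
    using xy by (simp add: index_sigma_elt power_add mult_ac)
  finally show "(T_mat * sigma_elt a b c i) $$ (x, y) = sigma_elt (a + b) b (c + 1) i $$ (x, y)" .
qed auto

text \<open>The exponents are arbitrary naturals, which lets generators act by plain increments;
  reduction modulo 3 restores finiteness afterwards.\<close>

lemma sigma_elt_mod: "sigma_elt (a mod 3) (b mod 3) (c mod 3) i = sigma_elt a b c i"
proof (rule eq_mat_3I)
  fix x y :: nat assume xy: "x < 3" "y < 3"
  have "\<omega> ^ (a mod 3 + b mod 3 * x) = \<omega> ^ (a + b * x)"
    unfolding power_add power_mult omega_power_mod ..
  then show "sigma_elt (a mod 3) (b mod 3) (c mod 3) i $$ (x, y) = sigma_elt a b c i $$ (x, y)"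
    using xy by (simp add: index_sigma_elt mod_add_right_eq)
qed auto

lemmas omega_simps = omega_powers omega_mult_self omega_mult_left algebra_simps

lemma inverse_sqrt_m3_mult_self: "inverse sqrt_m3 * inverse sqrt_m3 = - 1 / 3"
  by (simp add: sqrt_m3_def complex_eq_iff field_simps)

lemma sqrt_m3_omega: "inverse sqrt_m3 * (1 + 2 * \<omega>) = 1"
  unfolding inverse_sqrt_m3 by (simp add: complex_eq_iff Re_omega Im_omega)

lemma all_less_3: "(\<forall>x<3. P x) \<longleftrightarrow> P (0::nat) \<and> P 1 \<and> P 2"
  by (auto simp: less_3_iff)

text \<open>M and the representative each carry the factor 1 / \<open>sqrt_m3\<close>, the result
  only one. The missing factor 1 + 2 \<omega> on the right of the second assumption lets the tables
  be compared without any inverse.\<close>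

lemma coset_product:
  assumes "M = V_mat \<and> L = [[1, 1, 1], [1, \<omega>, \<omega>\<^sup>2], [1, \<omega>\<^sup>2, \<omega>]] \<or> M = W_mat \<and> L = [[1, 1, \<omega>\<^sup>2], [1, \<omega>, \<omega>], [\<omega>, 1, \<omega>]]"
    and e: "\<forall>x<3. \<forall>y<3. L ! x ! 0 * coset_table ! i ! 0 ! y + L ! x ! 1 * coset_table ! i ! 1 ! y
        + L ! x ! 2 * coset_table ! i ! 2 ! y
      = (1 + 2 * \<omega>) * (\<omega> ^ (a + b * x) * coset_table ! j ! ((x + c) mod 3) ! y)"
  shows "M * sigma_elt 0 0 0 i = sigma_elt a b c j"
proof (rule eq_mat_3I)
  fix x y :: nat assume xy: "x < 3" "y < 3"
  let ?r = "inverse sqrt_m3"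
  have "(M * sigma_elt 0 0 0 i) $$ (x, y) = ?r * ?r * (L ! x ! 0 * coset_table ! i ! 0 ! y
      + L ! x ! 1 * coset_table ! i ! 1 ! y + L ! x ! 2 * coset_table ! i ! 2 ! y)"
    using assms(1) xy
    by (elim disjE conjE) (simp_all only: V_mult W_mult sigma_elt_carrier index_sigma_elt coset_entry_def
      distrib_left mult_ac power_0 mult_1 mult_0 add_0_left add_0_right, simp_all add: mult_ac index_sigma_elt coset_entry_def distrib_left)
  also have "\<dots> = (?r * (1 + 2 * \<omega>)) * (\<omega> ^ (a + b * x) * coset_table ! j ! ((x + c) mod 3) ! y * ?r)"
    using e xy by (simp only: mult_ac)
  also have "\<dots> = sigma_elt a b c j $$ (x, y)"
    unfolding sqrt_m3_omega using xy by (simp add: index_sigma_elt coset_entry_def mult_ac)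
  finally show "(M * sigma_elt 0 0 0 i) $$ (x, y) = sigma_elt a b c j $$ (x, y)" .
qed (use assms(1) in auto)

text \<open>In the quotient Q_8, with i = V, j = W, k = V W, this is left multiplication by i: it
  cycles the indices 0, 1, 2, 3 and 4, 6, 5, 7. The three exponents record the Heisenberg factor by
  which the product misses the representative.\<close>

lemma V_coset:
  "V_mat * sigma_elt 0 0 0 0 = sigma_elt 0 0 0 1"
  "V_mat * sigma_elt 0 0 0 1 = sigma_elt 0 0 0 2"
  "V_mat * sigma_elt 0 0 0 2 = sigma_elt 0 0 0 3"
  "V_mat * sigma_elt 0 0 0 3 = sigma_elt 0 0 0 0"
  "V_mat * sigma_elt 0 0 0 4 = sigma_elt 0 0 0 6"
  "V_mat * sigma_elt 0 0 0 5 = sigma_elt 2 2 2 7"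
  "V_mat * sigma_elt 0 0 0 6 = sigma_elt 0 1 0 5"
  "V_mat * sigma_elt 0 0 0 7 = sigma_elt 2 0 1 4"
proof -
  show "V_mat * sigma_elt 0 0 0 0 = sigma_elt 0 0 0 1"
    by (rule coset_product[where L = "[[1, 1, 1], [1, \<omega>, \<omega>\<^sup>2], [1, \<omega>\<^sup>2, \<omega>]]"])
      (simp_all add: all_less_3 coset_table_def omega_simps)
  show "V_mat * sigma_elt 0 0 0 1 = sigma_elt 0 0 0 2"
    by (rule coset_product[where L = "[[1, 1, 1], [1, \<omega>, \<omega>\<^sup>2], [1, \<omega>\<^sup>2, \<omega>]]"])
      (simp_all add: all_less_3 coset_table_def omega_simps)
  show "V_mat * sigma_elt 0 0 0 2 = sigma_elt 0 0 0 3"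
    by (rule coset_product[where L = "[[1, 1, 1], [1, \<omega>, \<omega>\<^sup>2], [1, \<omega>\<^sup>2, \<omega>]]"])
      (simp_all add: all_less_3 coset_table_def omega_simps)
  show "V_mat * sigma_elt 0 0 0 3 = sigma_elt 0 0 0 0"
    by (rule coset_product[where L = "[[1, 1, 1], [1, \<omega>, \<omega>\<^sup>2], [1, \<omega>\<^sup>2, \<omega>]]"])
      (simp_all add: all_less_3 coset_table_def omega_simps)
  show "V_mat * sigma_elt 0 0 0 4 = sigma_elt 0 0 0 6"
    by (rule coset_product[where L = "[[1, 1, 1], [1, \<omega>, \<omega>\<^sup>2], [1, \<omega>\<^sup>2, \<omega>]]"])
      (simp_all add: all_less_3 coset_table_def omega_simps)
  show "V_mat * sigma_elt 0 0 0 5 = sigma_elt 2 2 2 7"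
    by (rule coset_product[where L = "[[1, 1, 1], [1, \<omega>, \<omega>\<^sup>2], [1, \<omega>\<^sup>2, \<omega>]]"])
      (simp_all add: all_less_3 coset_table_def omega_simps)
  show "V_mat * sigma_elt 0 0 0 6 = sigma_elt 0 1 0 5"
    by (rule coset_product[where L = "[[1, 1, 1], [1, \<omega>, \<omega>\<^sup>2], [1, \<omega>\<^sup>2, \<omega>]]"])
      (simp_all add: all_less_3 coset_table_def omega_simps)
  show "V_mat * sigma_elt 0 0 0 7 = sigma_elt 2 0 1 4"
    by (rule coset_product[where L = "[[1, 1, 1], [1, \<omega>, \<omega>\<^sup>2], [1, \<omega>\<^sup>2, \<omega>]]"])
      (simp_all add: all_less_3 coset_table_def omega_simps)
qed

text \<open>Left multiplication by j in Q_8, with cycles 0, 4, 2, 5 and 1, 7, 3, 6.\<close>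

lemma W_coset:
  "W_mat * sigma_elt 0 0 0 0 = sigma_elt 0 0 0 4"
  "W_mat * sigma_elt 0 0 0 1 = sigma_elt 2 2 1 7"
  "W_mat * sigma_elt 0 0 0 2 = sigma_elt 0 2 1 5"
  "W_mat * sigma_elt 0 0 0 3 = sigma_elt 1 1 0 6"
  "W_mat * sigma_elt 0 0 0 4 = sigma_elt 0 2 0 2"
  "W_mat * sigma_elt 0 0 0 5 = sigma_elt 0 0 0 0"
  "W_mat * sigma_elt 0 0 0 6 = sigma_elt 2 0 2 1"
  "W_mat * sigma_elt 0 0 0 7 = sigma_elt 1 0 0 3"
proof -
  show "W_mat * sigma_elt 0 0 0 0 = sigma_elt 0 0 0 4"
    by (rule coset_product[where L = "[[1, 1, \<omega>\<^sup>2], [1, \<omega>, \<omega>], [\<omega>, 1, \<omega>]]"])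
      (simp_all add: all_less_3 coset_table_def omega_simps)
  show "W_mat * sigma_elt 0 0 0 1 = sigma_elt 2 2 1 7"
    by (rule coset_product[where L = "[[1, 1, \<omega>\<^sup>2], [1, \<omega>, \<omega>], [\<omega>, 1, \<omega>]]"])
      (simp_all add: all_less_3 coset_table_def omega_simps)
  show "W_mat * sigma_elt 0 0 0 2 = sigma_elt 0 2 1 5"
    by (rule coset_product[where L = "[[1, 1, \<omega>\<^sup>2], [1, \<omega>, \<omega>], [\<omega>, 1, \<omega>]]"])
      (simp_all add: all_less_3 coset_table_def omega_simps)
  show "W_mat * sigma_elt 0 0 0 3 = sigma_elt 1 1 0 6"
    by (rule coset_product[where L = "[[1, 1, \<omega>\<^sup>2], [1, \<omega>, \<omega>], [\<omega>, 1, \<omega>]]"])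
      (simp_all add: all_less_3 coset_table_def omega_simps)
  show "W_mat * sigma_elt 0 0 0 4 = sigma_elt 0 2 0 2"
    by (rule coset_product[where L = "[[1, 1, \<omega>\<^sup>2], [1, \<omega>, \<omega>], [\<omega>, 1, \<omega>]]"])
      (simp_all add: all_less_3 coset_table_def omega_simps)
  show "W_mat * sigma_elt 0 0 0 5 = sigma_elt 0 0 0 0"
    by (rule coset_product[where L = "[[1, 1, \<omega>\<^sup>2], [1, \<omega>, \<omega>], [\<omega>, 1, \<omega>]]"])
      (simp_all add: all_less_3 coset_table_def omega_simps)
  show "W_mat * sigma_elt 0 0 0 6 = sigma_elt 2 0 2 1"
    by (rule coset_product[where L = "[[1, 1, \<omega>\<^sup>2], [1, \<omega>, \<omega>], [\<omega>, 1, \<omega>]]"])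
      (simp_all add: all_less_3 coset_table_def omega_simps)
  show "W_mat * sigma_elt 0 0 0 7 = sigma_elt 1 0 0 3"
    by (rule coset_product[where L = "[[1, 1, \<omega>\<^sup>2], [1, \<omega>, \<omega>], [\<omega>, 1, \<omega>]]"])
      (simp_all add: all_less_3 coset_table_def omega_simps)
qed

text \<open>Up to a scalar V is the discrete Fourier transform, so conjugation by V sends the clock
  matrix S1 to the shift T, and T to the inverse S1^2 of S1.\<close>

lemma V_relations:
  "V_mat * S1_mat = T_mat * V_mat"
  "V_mat * T_mat = S1_mat * (S1_mat * V_mat)"
proof -
  show "V_mat * S1_mat = T_mat * V_mat"
    by (rule eq_mat_3I)
      (auto simp: S1_mult index_T T_mult V_mult index_V index_S1 less_3_iff omega_simps simp del: index_mult_mat)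
  show "V_mat * T_mat = S1_mat * (S1_mat * V_mat)"
    by (rule eq_mat_3I)
      (auto simp: S1_mult index_T T_mult V_mult index_V index_S1 less_3_iff omega_simps simp del: index_mult_mat)
qed

text \<open>Modulo the center, the Heisenberg group is a plane over the field of three elements with
  basis S1, T. W acts there by S1 -> (2, 1), T -> (1, 1), of determinant 1 and trace 0.\<close>

lemma W_relations:
  "W_mat * S1_mat = S1_mat * (S1_mat * (T_mat * W_mat))"
  "W_mat * T_mat = S2_mat * (S2_mat * (S1_mat * (T_mat * W_mat)))"
proof -
  show "W_mat * S1_mat = S1_mat * (S1_mat * (T_mat * W_mat))"
    by (rule eq_mat_3I)
      (auto simp: S1_mult S2_mult T_mult index_T W_mult index_W index_S1 less_3_iff omega_simps simp del: index_mult_mat)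
  show "W_mat * T_mat = S2_mat * (S2_mat * (S1_mat * (T_mat * W_mat)))"
    by (rule eq_mat_3I)
      (auto simp: S1_mult S2_mult T_mult index_T W_mult index_W index_S1 less_3_iff omega_simps simp del: index_mult_mat)
qed

section \<open>Closure of the normal forms under the generators\<close>

definition sigma_elts :: "complex mat set" where
  "sigma_elts = {sigma_elt a b c i | a b c i. i < 8}"

lemma sigma_elts_carrier: "X \<in> sigma_elts \<Longrightarrow> X \<in> carrier_mat 3 3"
  by (auto simp: sigma_elts_def)

lemma sigma_elt_mem: "i < 8 \<Longrightarrow> sigma_elt a b c i \<in> sigma_elts"
  by (auto simp: sigma_elts_def)

lemma heisenberg_mult_closed:
  assumes "X \<in> sigma_elts"
  shows "S1_mat * X \<in> sigma_elts" "S2_mat * X \<in> sigma_elts" "T_mat * X \<in> sigma_elts"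
proof -
  obtain a b c i where X: "X = sigma_elt a b c i" and i: "i < 8" using assms by (auto simp: sigma_elts_def)
  show "S1_mat * X \<in> sigma_elts" "S2_mat * X \<in> sigma_elts" "T_mat * X \<in> sigma_elts"
    unfolding X S1_sigma_elt S2_sigma_elt T_sigma_elt by (rule sigma_elt_mem[OF i])+
qed

lemma S2_central:
  assumes M: "M \<in> carrier_mat 3 3"
  shows "M * S2_mat = S2_mat * M"
proof (rule eq_mat_3I)
  fix i j :: nat assume ij: "i < 3" "j < 3"
  have "(M * S2_mat) $$ (i, j) = M $$ (i, j) * \<omega>"
    unfolding index_mult_mat_3[OF M generators_carrier(2) ij]
    using ij(2) by (auto simp: less_3_iff index_S2)
  then show "(M * S2_mat) $$ (i, j) = (S2_mat * M) $$ (i, j)"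
    unfolding S2_mult[OF M ij] by simp
qed (use M in auto)

lemma assoc_mult_mat_3:
  "A \<in> carrier_mat 3 3 \<Longrightarrow> B \<in> carrier_mat 3 3 \<Longrightarrow> C \<in> carrier_mat 3 3 \<Longrightarrow> (A * B) * C = A * (B * C)"
  for A :: "complex mat"
  by (rule assoc_mult_mat)

text \<open>M is pushed to the right past the Heisenberg generators, each crossing costing only
  Heisenberg factors on the left, until it meets a bare coset representative.\<close>

lemma mult_closed_if_normalizes:
  assumes M: "M \<in> carrier_mat 3 3"
    and T: "\<And>X. X \<in> carrier_mat 3 3 \<Longrightarrow> M * X \<in> sigma_elts \<Longrightarrow> M * (T_mat * X) \<in> sigma_elts"
    and S1: "\<And>X. X \<in> carrier_mat 3 3 \<Longrightarrow> M * X \<in> sigma_elts \<Longrightarrow> M * (S1_mat * X) \<in> sigma_elts"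
    and Q: "\<And>i. i < 8 \<Longrightarrow> M * sigma_elt 0 0 0 i \<in> sigma_elts"
    and X: "X \<in> sigma_elts"
  shows "M * X \<in> sigma_elts"
proof -
  obtain a b c i where X: "X = sigma_elt a b c i" and i: "i < 8" using X by (auto simp: sigma_elts_def)
  \<comment> \<open>The word is built from the inside out: T first, while b = 0 keeps T from
    changing a, then S1, then S2.\<close>
  have c: "M * sigma_elt 0 0 c i \<in> sigma_elts" for c
  proof (induction c)
    case (Suc c)
    then show ?case using T[OF sigma_elt_carrier Suc.IH] by (simp add: T_sigma_elt)
  qed (rule Q[OF i])
  have b: "M * sigma_elt 0 b c i \<in> sigma_elts" for b
  proof (induction b)
    case (Suc b)
    then show ?case using S1[OF sigma_elt_carrier Suc.IH] by (simp add: S1_sigma_elt)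
  qed (rule c)
  have "M * sigma_elt a b c i \<in> sigma_elts" for a
  proof (induction a)
    case (Suc a)
    have "M * (S2_mat * sigma_elt a b c i) = S2_mat * (M * sigma_elt a b c i)"
      using M by (simp only: assoc_mult_mat_3[symmetric] generators_carrier sigma_elt_carrier S2_central[OF M])
    then show ?case using heisenberg_mult_closed(2)[OF Suc.IH] by (simp add: S2_sigma_elt)
  qed (rule b)
  then show ?thesis by (simp add: X)
qed

lemma V_mult_closed: "X \<in> sigma_elts \<Longrightarrow> V_mat * X \<in> sigma_elts"
proof (rule mult_closed_if_normalizes)
  show "V_mat * sigma_elt 0 0 0 i \<in> sigma_elts" if "i < 8" for i
    using that unfolding less_8_iff by (elim disjE) (simp_all add: V_coset sigma_elt_mem del: One_nat_def)
  fix X :: "complex mat" assume X: "X \<in> carrier_mat 3 3" "V_mat * X \<in> sigma_elts"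
  have "V_mat * (T_mat * X) = S1_mat * (S1_mat * (V_mat * X))"
    using X(1) by (simp add: assoc_mult_mat_3[symmetric] V_relations)
  then show "V_mat * (T_mat * X) \<in> sigma_elts" using X(2) heisenberg_mult_closed by simp
  have "V_mat * (S1_mat * X) = T_mat * (V_mat * X)"
    using X(1) by (simp add: assoc_mult_mat_3[symmetric] V_relations)
  then show "V_mat * (S1_mat * X) \<in> sigma_elts" using X(2) heisenberg_mult_closed by simp
qed auto

lemma W_mult_closed: "X \<in> sigma_elts \<Longrightarrow> W_mat * X \<in> sigma_elts"
proof (rule mult_closed_if_normalizes)
  show "W_mat * sigma_elt 0 0 0 i \<in> sigma_elts" if "i < 8" for i
    using that unfolding less_8_iff by (elim disjE) (simp_all add: W_coset sigma_elt_mem del: One_nat_def)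
  fix X :: "complex mat" assume X: "X \<in> carrier_mat 3 3" "W_mat * X \<in> sigma_elts"
  have "W_mat * (T_mat * X) = S2_mat * (S2_mat * (S1_mat * (T_mat * (W_mat * X))))"
    using X(1) by (simp add: assoc_mult_mat_3[symmetric] W_relations)
  then show "W_mat * (T_mat * X) \<in> sigma_elts" using X(2) heisenberg_mult_closed by simp
  have "W_mat * (S1_mat * X) = S1_mat * (S1_mat * (T_mat * (W_mat * X)))"
    using X(1) by (simp add: assoc_mult_mat_3[symmetric] W_relations)
  then show "W_mat * (S1_mat * X) \<in> sigma_elts" using X(2) heisenberg_mult_closed by simp
qed auto

lemma sigma_elts_eq_image:
  "sigma_elts = (\<lambda>(a, b, c, i). sigma_elt a b c i) ` ({..<3} \<times> {..<3} \<times> {..<3} \<times> {..<8})"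
proof (intro equalityI subsetI)
  fix X assume "X \<in> sigma_elts"
  then obtain a b c i where "X = sigma_elt a b c i" "i < 8" by (auto simp: sigma_elts_def)
  then have "X = (\<lambda>(a, b, c, i). sigma_elt a b c i) (a mod 3, b mod 3, c mod 3, i)"
    by (simp add: sigma_elt_mod)
  then show "X \<in> (\<lambda>(a, b, c, i). sigma_elt a b c i) ` ({..<3} \<times> {..<3} \<times> {..<3} \<times> {..<8})"
    using \<open>i < 8\<close> by (intro image_eqI[where x = "(a mod 3, b mod 3, c mod 3, i)"]) auto
qed (auto simp: sigma_elt_mem)

lemma finite_sigma_elts: "finite sigma_elts"
  unfolding sigma_elts_eq_image by simp

section \<open>The generators in SU(3) and the identification of the generated group\<close>

lemma cnj_inverse_sqrt_m3: "cnj (inverse sqrt_m3) = - inverse sqrt_m3"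
  by (simp add: sqrt_m3_def)

lemma inverse_sqrt_m3_mult_left: "inverse sqrt_m3 * (inverse sqrt_m3 * z) = - z / 3"
  unfolding mult.assoc[symmetric] inverse_sqrt_m3_mult_self by simp

lemma mem_SU_3I:
  assumes "A \<in> carrier_mat 3 3" "det A = 1"
    and "\<And>i j. i < 3 \<Longrightarrow> j < 3 \<Longrightarrow> A $$ (i, 0) * cnj (A $$ (j, 0)) + A $$ (i, 1) * cnj (A $$ (j, 1))
      + A $$ (i, 2) * cnj (A $$ (j, 2)) = (if i = j then 1 else 0)"
  shows "A \<in> carrier (SU 3)"
proof -
  note c = mat_adjoint_simps[OF assms(1)]
  have "A * mat_adjoint A = 1\<^sub>m 3"
  proof (rule eq_mat_3I)
    fix i j :: nat assume ij: "i < 3" "j < 3"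
    show "(A * mat_adjoint A) $$ (i, j) = 1\<^sub>m 3 $$ (i, j)"
      unfolding index_mult_mat_3[OF assms(1) c(1) ij] using assms(3)[OF ij] ij
      by (simp add: c(2) conjugate_complex_def)
  qed (use assms(1) c(1) in auto)
  then show ?thesis using assms(1,2) by (simp add: SU_def)
qed

lemma mat_of_rows_list_3: "mat_of_rows_list 3 [r, s, t] = mat 3 3 (\<lambda>(i, j). [r, s, t] ! i ! j)"
  by (simp add: mat_of_rows_list_def numeral_3_eq_3)

lemma generators_in_SU: "{S1_mat, S2_mat, T_mat, V_mat, W_mat} \<subseteq> carrier (SU 3)"
proof -
  have lt: "(0::nat) < 3" "(1::nat) < 3" "(2::nat) < 3" by auto
  have "S1_mat \<in> carrier (SU 3)"
  proof (rule mem_SU_3I)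
    show "det S1_mat = 1"
      by (simp add: det_3 index_S1 omega_simps)
    fix i j :: nat assume ij: "i < 3" "j < 3"
    show "S1_mat $$ (i, 0) * cnj (S1_mat $$ (j, 0)) + S1_mat $$ (i, 1) * cnj (S1_mat $$ (j, 1))
      + S1_mat $$ (i, 2) * cnj (S1_mat $$ (j, 2)) = (if i = j then 1 else 0)"
      unfolding lt[THEN index_S1[OF ij(1)]] lt[THEN index_S1[OF ij(2)]]
      using ij unfolding less_3_iff by (elim disjE) (simp_all add: omega_simps cnj_omega)
  qed simp
  moreover have "S2_mat \<in> carrier (SU 3)"
  proof (rule mem_SU_3I)
    show "det S2_mat = 1"
      by (simp add: det_3 index_S2 omega_simps)
    fix i j :: nat assume ij: "i < 3" "j < 3"
    show "S2_mat $$ (i, 0) * cnj (S2_mat $$ (j, 0)) + S2_mat $$ (i, 1) * cnj (S2_mat $$ (j, 1))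
      + S2_mat $$ (i, 2) * cnj (S2_mat $$ (j, 2)) = (if i = j then 1 else 0)"
      unfolding lt[THEN index_S2[OF ij(1)]] lt[THEN index_S2[OF ij(2)]]
      using ij unfolding less_3_iff by (elim disjE) (simp_all add: omega_simps cnj_omega)
  qed simp
  moreover have "T_mat \<in> carrier (SU 3)"
  proof (rule mem_SU_3I)
    show "det T_mat = 1"
      by (simp add: det_3 index_T omega_simps)
    fix i j :: nat assume ij: "i < 3" "j < 3"
    show "T_mat $$ (i, 0) * cnj (T_mat $$ (j, 0)) + T_mat $$ (i, 1) * cnj (T_mat $$ (j, 1))
      + T_mat $$ (i, 2) * cnj (T_mat $$ (j, 2)) = (if i = j then 1 else 0)"
      unfolding lt[THEN index_T[OF ij(1)]] lt[THEN index_T[OF ij(2)]]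
      using ij unfolding less_3_iff by (elim disjE) (simp_all add: omega_simps cnj_omega)
  qed simp
  \<comment> \<open>The value -3 (1 + 2 \<omega>) is the cube of \<open>sqrt_m3\<close>, which the
    scaling of a 3 by 3 matrix divides out.\<close>
  moreover have det: "det (inverse sqrt_m3 \<cdot>\<^sub>m A) = 1"
    if "A \<in> carrier_mat 3 3" "det A = - 3 * (1 + 2 * \<omega>)" for A
  proof -
    have "det (inverse sqrt_m3 \<cdot>\<^sub>m A) = inverse sqrt_m3 ^ 3 * (- 3 * (1 + 2 * \<omega>))"
      using that by simp
    also have "\<dots> = - 3 * (inverse sqrt_m3 * inverse sqrt_m3) * (inverse sqrt_m3 * (1 + 2 * \<omega>))"
      by (simp only: power3_eq_cube mult_ac)
    finally show ?thesis by (simp add: inverse_sqrt_m3_mult_self sqrt_m3_omega)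
  qed
  moreover have "V_mat \<in> carrier (SU 3)"
  proof (rule mem_SU_3I)
    show "det V_mat = 1"
      unfolding V_mat_def inverse_eq_divide[symmetric]
      by (rule det) (auto simp: mat_of_rows_list_3 det_3 omega_simps)
    show "V_mat $$ (i, 0) * cnj (V_mat $$ (j, 0)) + V_mat $$ (i, 1) * cnj (V_mat $$ (j, 1))
      + V_mat $$ (i, 2) * cnj (V_mat $$ (j, 2)) = (if i = j then 1 else 0)" if "i < 3" "j < 3" for i j
      unfolding index_V[OF that(1) lt(1)] index_V[OF that(2) lt(1)] index_V[OF that(1) lt(2)]
        index_V[OF that(2) lt(2)] index_V[OF that(1) lt(3)] index_V[OF that(2) lt(3)]
      using that unfolding less_3_iff
      by (elim disjE) (simp_all add: cnj_inverse_sqrt_m3 cnj_omega omega_simps inverse_sqrt_m3_mult_self inverse_sqrt_m3_mult_left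
        add_divide_distrib diff_divide_distrib del: complex_cnj_inverse)
  qed simp
  moreover have "W_mat \<in> carrier (SU 3)"
  proof (rule mem_SU_3I)
    show "det W_mat = 1"
      unfolding W_mat_def inverse_eq_divide[symmetric]
      by (rule det) (auto simp: mat_of_rows_list_3 det_3 omega_simps)
    show "W_mat $$ (i, 0) * cnj (W_mat $$ (j, 0)) + W_mat $$ (i, 1) * cnj (W_mat $$ (j, 1))
      + W_mat $$ (i, 2) * cnj (W_mat $$ (j, 2)) = (if i = j then 1 else 0)" if "i < 3" "j < 3" for i j
      unfolding index_W[OF that(1) lt(1)] index_W[OF that(2) lt(1)] index_W[OF that(1) lt(2)]
        index_W[OF that(2) lt(2)] index_W[OF that(1) lt(3)] index_W[OF that(2) lt(3)]
      using that unfolding less_3_iff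
      by (elim disjE) (simp_all add: cnj_inverse_sqrt_m3 cnj_omega omega_simps inverse_sqrt_m3_mult_self inverse_sqrt_m3_mult_left
        add_divide_distrib diff_divide_distrib del: complex_cnj_inverse)
  qed simp
  ultimately show ?thesis by simp
qed

lemma sigma_elt_0: "sigma_elt 0 0 0 0 = 1\<^sub>m 3"
proof (rule eq_mat_3I)
  fix i j :: nat assume ij: "i < 3" "j < 3"
  then show "sigma_elt 0 0 0 0 $$ (i, j) = 1\<^sub>m 3 $$ (i, j)"
    using sqrt_m3_omega unfolding less_3_iff
    by (elim disjE) (simp_all add: index_sigma_elt coset_entry_def coset_table_def mult.commute)
qed auto

text \<open>The set is treated as a space on which the group acts by left multiplication, so closure
  under products of normal forms need not be computed. Acting on the identity matrix, itself a
  normal form, turns invariance into membership.\<close>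

lemma generate_subset_sigma_elts:
  assumes "g \<in> generate (SU 3) {S1_mat, S2_mat, T_mat, V_mat, W_mat}"
  shows "g \<in> carrier (SU 3) \<and> (\<forall>X\<in>sigma_elts. g * X \<in> sigma_elts)"
  using assms
proof (induction rule: generate.induct)
  interpret SU: Group.group "SU 3" by (rule group_SU)
  have mult: "mult (SU 3) = (*)" "one (SU 3) = 1\<^sub>m 3" by (simp_all add: SU_def)
  have SU_c: "A \<in> carrier_mat 3 3" if "A \<in> carrier (SU 3)" for A using that by (simp add: SU_def)
  {
    case one
    then show ?case using SU.one_closed by (simp add: mult(2) left_mult_one_mat[OF sigma_elts_carrier])
  next
    case (incl h)
    then show ?case
      using generators_in_SU V_mult_closed W_mult_closed heisenberg_mult_closed by auto
  next
    case (inv h)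
    have h: "h \<in> carrier (SU 3)" "\<And>X. X \<in> sigma_elts \<Longrightarrow> h * X \<in> sigma_elts"
      using inv generators_in_SU V_mult_closed W_mult_closed heisenberg_mult_closed by auto
    let ?i = "inv\<^bsub>SU 3\<^esub> h"
    have i: "?i \<in> carrier (SU 3)" "?i * h = 1\<^sub>m 3" using h(1) SU.l_inv[OF h(1)] by (simp_all add: mult)
    have cancel: "?i * (h * X) = X" if "X \<in> sigma_elts" for X
      using assoc_mult_mat_3[OF SU_c[OF i(1)] SU_c[OF h(1)] sigma_elts_carrier[OF that]] i(2)
        sigma_elts_carrier[OF that] by simp
    \<comment> \<open>An injective self-map of a finite set is onto, so the inverse of h preserves
      the set as well.\<close>
    have "inj_on ((*) h) sigma_elts"
      by (rule inj_on_inverseI[of _ "(*) ?i"]) (rule cancel)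
    then have "(*) h ` sigma_elts = sigma_elts"
      using h(2) by (intro endo_inj_surj finite_sigma_elts) auto
    then have "?i * X \<in> sigma_elts" if "X \<in> sigma_elts" for X
      using cancel that by (metis imageE)
    then show ?case using i(1) by blast
  next
    case (eng h1 h2)
    then have c: "h1 \<in> carrier (SU 3)" "h2 \<in> carrier (SU 3)" by auto
    have "h1 * h2 * X \<in> sigma_elts" if X: "X \<in> sigma_elts" for X
      unfolding assoc_mult_mat_3[OF SU_c[OF c(1)] SU_c[OF c(2)] sigma_elts_carrier[OF X]]
      using eng.IH X by blast
    then show ?case using SU.m_closed[OF c] by (simp add: mult)
  }
qed

lemma all_less_8: "(\<forall>x<8. P x) \<longleftrightarrow> P (0::nat) \<and> P 1 \<and> P 2 \<and> P 3 \<and> P 4 \<and> P 5 \<and> P 6 \<and> P 7"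
  unfolding less_8_iff by blast

lemma Sigma_72x3_eq: "Sigma_72x3 = sigma_elts"
proof (intro equalityI subsetI)
  fix g assume "g \<in> Sigma_72x3"
  then have "g \<in> carrier (SU 3)" "g * sigma_elt 0 0 0 0 \<in> sigma_elts"
    using generate_subset_sigma_elts[of g] sigma_elt_mem[of 0] by (auto simp: Sigma_72x3_def)
  then show "g \<in> sigma_elts" by (auto simp: sigma_elt_0 SU_def)
next
  let ?G = Sigma_72x3
  have mult: "mult (SU 3) = (*)" "one (SU 3) = 1\<^sub>m 3" by (simp_all add: SU_def)
  have gen: "h * X \<in> ?G" if "h \<in> {S1_mat, S2_mat, T_mat, V_mat, W_mat}" "X \<in> ?G" for h X
    using generate.eng[OF generate.incl[OF that(1)] that(2)[unfolded Sigma_72x3_def]]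
    unfolding Sigma_72x3_def by (simp add: mult)
  have S1: "sigma_elt a (b + n) c i \<in> ?G" if "sigma_elt a b c i \<in> ?G" for a b c i n
  proof (induction n)
    case (Suc n)
    then show ?case using gen[of S1_mat "sigma_elt a (b + n) c i"] by (simp add: S1_sigma_elt)
  qed (use that in simp)
  have S2: "sigma_elt (a + n) b c i \<in> ?G" if "sigma_elt a b c i \<in> ?G" for a b c i n
  proof (induction n)
    case (Suc n)
    then show ?case using gen[of S2_mat "sigma_elt (a + n) b c i"] by (simp add: S2_sigma_elt)
  qed (use that in simp)
  have T: "sigma_elt a 0 (c + n) i \<in> ?G" if "sigma_elt a 0 c i \<in> ?G" for a c i n
  proof (induction n)
    case (Suc n)
    then show ?case using gen[of T_mat "sigma_elt a 0 (c + n) i"] by (simp add: T_sigma_elt)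
  qed (use that in simp)
  \<comment> \<open>One element of a coset gives the whole coset. Exponents are cancelled by adding
    twice their value, since 3 b is 0 modulo 3; b is cleared before T is used because T would
    otherwise alter a.\<close>
  have shift: "sigma_elt a' b' c' i \<in> ?G" if X: "sigma_elt a b c i \<in> ?G" for a b c i a' b' c'
  proof -
    have "sigma_elt a (b + 2 * b) c i \<in> ?G" by (rule S1[OF X])
    then have "sigma_elt a 0 c i \<in> ?G" using sigma_elt_mod[of a "b + 2 * b" c i] sigma_elt_mod[of a 0 c i] by simp
    then have "sigma_elt a 0 (c + (2 * c + c')) i \<in> ?G" by (rule T)
    then have "sigma_elt a 0 c' i \<in> ?G"
      using sigma_elt_mod[of a 0 "c + (2 * c + c')" i] sigma_elt_mod[of a 0 c' i] by (simp add: add.assoc[symmetric])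
    then have "sigma_elt (a + (2 * a + a')) 0 c' i \<in> ?G" by (rule S2)
    then have "sigma_elt a' 0 c' i \<in> ?G"
      using sigma_elt_mod[of "a + (2 * a + a')" 0 c' i] sigma_elt_mod[of a' 0 c' i] by (simp add: add.assoc[symmetric])
    then show ?thesis using S1[of a' 0 c' i b'] by simp
  qed
  have q0: "sigma_elt 0 0 0 0 \<in> ?G"
    unfolding sigma_elt_0 Sigma_72x3_def using generate.one[of "SU 3"] by (simp add: mult)
  have q1: "sigma_elt 0 0 0 1 \<in> ?G" using gen[OF _ q0, of V_mat] by (simp add: V_coset del: One_nat_def)
  have q2: "sigma_elt 0 0 0 2 \<in> ?G" using gen[OF _ q1, of V_mat] by (simp add: V_coset del: One_nat_def)
  have q3: "sigma_elt 0 0 0 3 \<in> ?G" using gen[OF _ q2, of V_mat] by (simp add: V_coset del: One_nat_def)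
  have q4: "sigma_elt 0 0 0 4 \<in> ?G" using gen[OF _ q0, of W_mat] by (simp add: W_coset del: One_nat_def)
  \<comment> \<open>Here and for index 7 the product is the representative only up to a Heisenberg
    factor, which \<open>shift\<close> removes.\<close>
  have q5: "sigma_elt 0 2 1 5 \<in> ?G" using gen[OF _ q2, of W_mat] by (simp add: W_coset del: One_nat_def)
  have q6: "sigma_elt 0 0 0 6 \<in> ?G" using gen[OF _ q4, of V_mat] by (simp add: V_coset del: One_nat_def)
  have q7: "sigma_elt 2 2 1 7 \<in> ?G" using gen[OF _ q1, of W_mat] by (simp add: W_coset del: One_nat_def)
  fix X assume "X \<in> sigma_elts"
  then obtain a b c i where X: "X = sigma_elt a b c i" and i: "i < 8" by (auto simp: sigma_elts_def)
  have "\<forall>i<8. sigma_elt a b c i \<in> ?G"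
    unfolding all_less_8
    by (intro conjI shift[OF q0] shift[OF q1] shift[OF q2] shift[OF q3]
      shift[OF q4] shift[OF q5] shift[OF q6] shift[OF q7])
  then show "X \<in> ?G" using i X by simp
qed

lemma finite_Sigma_72x3: "finite Sigma_72x3"
  by (simp add: Sigma_72x3_eq finite_sigma_elts)

lemma subgroup_Sigma_72x3: "subgroup Sigma_72x3 (SU 3)"
  unfolding Sigma_72x3_def
  by (rule group.generate_is_subgroup[OF group_SU generators_in_SU])

section \<open>Distinctness of the 216 normal forms\<close>

lemma coset_table_unitary:
  "\<forall>i<8. \<forall>x<3. \<forall>y<3. coset_table ! i ! x ! 0 * cnj (coset_table ! i ! y ! 0)
    + coset_table ! i ! x ! 1 * cnj (coset_table ! i ! y ! 1)
    + coset_table ! i ! x ! 2 * cnj (coset_table ! i ! y ! 2) = (if x = y then 3 else 0)"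
  by (simp add: all_less_8 all_less_3 coset_table_def omega_simps cnj_omega)

text \<open>Scaling the row by a cube root of unity or permuting the rows cyclically does not change
  the product and the cubed sum of its entries, and these separate the eight cosets.\<close>

definition row_product :: "nat \<Rightarrow> complex" where
  "row_product i = [0, 1, 0, -1, \<omega>\<^sup>2, - (\<omega>\<^sup>2), -\<omega>, \<omega>] ! i"

lemma coset_table_row_product:
  "\<forall>i<8. \<forall>x<3. coset_table ! i ! x ! 0 * (coset_table ! i ! x ! 1 * coset_table ! i ! x ! 2) = row_product i"
  by (simp add: all_less_8 all_less_3 coset_table_def row_product_def omega_simps)

lemma row_product_eqD:
  "\<forall>i<8. \<forall>j<8. row_product i = row_product j \<longrightarrow> i = j \<or> {i, j} = {0, 2}"
  by (simp add: all_less_8 row_product_def omega_powers insert_commute)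
    (simp add: complex_eq_iff Re_omega Im_omega)

lemma coset_table_row_sum:
  "\<forall>x<3. coset_table ! 0 ! x ! 0 + coset_table ! 0 ! x ! 1 + coset_table ! 0 ! x ! 2 = 1 + 2 * \<omega>"
  "\<forall>x<3. coset_table ! 2 ! x ! 0 + coset_table ! 2 ! x ! 1 + coset_table ! 2 ! x ! 2 = - (1 + 2 * \<omega>)"
  by (simp_all add: all_less_3 coset_table_def)

lemma omega_power_cube: "\<omega> ^ a * \<omega> ^ a * \<omega> ^ a = 1"
  unfolding power3_eq_cube[symmetric] power_mult[symmetric] mult.commute[of a] power_mult omega_cube by simp

text \<open>The product of a row determines i, except between 0 and 2, where both products vanish
  and the row sums decide. Orthogonality of rows then gives c, the first row gives a, and the second
  row gives b.\<close>

lemma sigma_elt_inj: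
  assumes eq: "sigma_elt a b c i = sigma_elt a' b' c' i'"
    and bd: "a < 3" "a' < 3" "b < 3" "b' < 3" "c < 3" "c' < 3" "i < 8" "i' < 8"
  shows "a = a' \<and> b = b' \<and> c = c' \<and> i = i'"
proof -
  let ?t = "\<lambda>i x y. coset_table ! i ! x ! y"
  have lt: "(0::nat) < 3" "(1::nat) < 3" "(2::nat) < 3" by auto
  have r: "inverse sqrt_m3 \<noteq> 0" using sqrt_m3_omega by force
  have ent: "\<omega> ^ (a + b * x) * ?t i ((x + c) mod 3) y = \<omega> ^ (a' + b' * x) * ?t i' ((x + c') mod 3) y"
    if "x < 3" "y < 3" for x y
    using arg_cong[OF eq, of "\<lambda>M. M $$ (x, y)"] r
    unfolding index_sigma_elt[OF that] coset_entry_def mult.assoc[symmetric] by simp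
  have row0: "\<omega> ^ a * ?t i c y = \<omega> ^ a' * ?t i' c' y" if "y < 3" for y
    using ent[OF lt(1) that] bd by simp
  have prod: "(\<omega> ^ a * ?t i c 0) * (\<omega> ^ a * ?t i c 1) * (\<omega> ^ a * ?t i c 2) = row_product i"
    if "c < 3" "i < 8" for a c i
  proof -
    have "(\<omega> ^ a * ?t i c 0) * (\<omega> ^ a * ?t i c 1) * (\<omega> ^ a * ?t i c 2)
        = (\<omega> ^ a * \<omega> ^ a * \<omega> ^ a) * (?t i c 0 * (?t i c 1 * ?t i c 2))"
      by (simp only: mult_ac)
    also have "\<dots> = row_product i"
      using coset_table_row_product that unfolding omega_power_cube by simp
    finally show ?thesis .
  qed
  have "row_product i = row_product i'"
    using prod[OF bd(5,7), of a] prod[OF bd(6,8), of a'] unfolding lt[THEN row0] by simp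
  then have "i = i' \<or> {i, i'} = {0, 2}" using row_product_eqD[rule_format, OF bd(7,8)] by simp
  moreover have "\<not> {i, i'} = {0, 2}"
  proof
    assume "{i, i'} = {0, 2}"
    then have ii: "i = 0 \<and> i' = 2 \<or> i = 2 \<and> i' = 0" by (simp add: doubleton_eq_iff)
    have "\<omega> ^ a * (?t i c 0 + ?t i c 1 + ?t i c 2) = \<omega> ^ a' * (?t i' c' 0 + ?t i' c' 1 + ?t i' c' 2)"
      unfolding distrib_left lt[THEN row0] ..
    then have "\<omega> ^ a * (1 + 2 * \<omega>) = \<omega> ^ a' * - (1 + 2 * \<omega>) \<or>
        \<omega> ^ a * - (1 + 2 * \<omega>) = \<omega> ^ a' * (1 + 2 * \<omega>)"
      using ii coset_table_row_sum bd(5,6) by (elim disjE) (simp_all only: simp_thms)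
    then have "\<omega> ^ a * (1 + 2 * \<omega>) = - (\<omega> ^ a') * (1 + 2 * \<omega>)"
      unfolding mult_minus_right mult_minus_left by (metis minus_minus)
    moreover have "1 + 2 * \<omega> \<noteq> 0" using sqrt_m3_omega by force
    ultimately have "\<omega> ^ a = - (\<omega> ^ a')" by (metis mult_right_cancel)
    \<comment> \<open>Cubing removes the cube roots of unity and leaves 1 = -1.\<close>
    then have "\<omega> ^ a * \<omega> ^ a * \<omega> ^ a = - (\<omega> ^ a' * \<omega> ^ a' * \<omega> ^ a')" by simp
    then show False unfolding omega_power_cube by simp
  qed
  ultimately have i: "i = i'" by blast
  have unit: "w * ?t i x 0 * cnj (?t i y 0) + w * ?t i x 1 * cnj (?t i y 1) + w * ?t i x 2 * cnj (?t i y 2)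
      = w * (if x = y then 3 else 0)" if "x < 3" "y < 3" for x y w
    using coset_table_unitary bd(7) that by (simp only: mult.assoc distrib_left[symmetric])
  \<comment> \<open>Both first rows are paired with row c' of the common table: if c and c'
    differed, the left side would vanish by orthogonality while the right side does not.\<close>
  have "\<omega> ^ a * (if c = c' then 3 else 0) = \<omega> ^ a' * 3"
    using unit[OF bd(5,6), of "\<omega> ^ a", symmetric] unit[OF bd(6,6), of "\<omega> ^ a'"]
    unfolding lt[THEN row0] unfolding i by (simp only: refl if_True)
  then have c: "c = c'" and a: "a = a'"
    using omega_power_eq_iff[OF bd(1,2)] by (auto split: if_splits)
  have x: "(1 + c) mod 3 < 3" by simp
  have row1: "\<omega> ^ (a + b) * ?t i ((1 + c) mod 3) y = \<omega> ^ (a + b') * ?t i ((1 + c) mod 3) y" if "y < 3" for y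
    using ent[OF lt(2) that] unfolding i a c by simp
  have "\<omega> ^ (a + b) * 3 = \<omega> ^ (a + b') * 3"
    using unit[OF x x, of "\<omega> ^ (a + b)"] unit[OF x x, of "\<omega> ^ (a + b')"] unfolding lt[THEN row1] by simp
  then have "b = b'" using omega_power_eq_iff[OF bd(3,4)] by (simp add: power_add)
  then show ?thesis using a c i by blast
qed

lemma inj_on_sigma_elt: "inj_on (\<lambda>(a, b, c, i). sigma_elt a b c i) ({..<3} \<times> {..<3} \<times> {..<3} \<times> {..<8})"
  by (rule inj_onI) (use sigma_elt_inj in auto)

lemma card_Sigma_72x3: "card Sigma_72x3 = 216"
  unfolding Sigma_72x3_eq sigma_elts_eq_image card_image[OF inj_on_sigma_elt] by simp

section \<open>Traces on the cosets and sums over the center\<close>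

definition coset_trace :: "nat \<Rightarrow> nat \<Rightarrow> nat \<Rightarrow> complex" where
  "coset_trace b c i = (\<Sum>x<3. \<omega> ^ (b * x) * coset_table ! i ! ((x + c) mod 3) ! x) * inverse sqrt_m3"

lemma mat_trace_sigma_elt: "mat_trace (sigma_elt a b c i) = \<omega> ^ a * coset_trace b c i"
  using carrier_matD[OF sigma_elt_carrier, of a b c i]
  by (simp add: mat_trace_def coset_trace_def index_sigma_elt coset_entry_def power_add sum_distrib_left sum_distrib_right mult_ac)

lemma coset_trace_0: "\<forall>b<3. \<forall>c<3. coset_trace b c 0 = (if b = 0 \<and> c = 0 then 3 else 0)"
proof -
  have "\<forall>b<3. \<forall>c<3. (\<Sum>x<3. \<omega> ^ (b * x) * coset_table ! 0 ! ((x + c) mod 3) ! x)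
      = (if b = 0 \<and> c = 0 then 3 * (1 + 2 * \<omega>) else 0)"
    by (simp add: all_less_3 sum_lessThan_3 coset_table_def omega_simps)
  moreover have "3 * (1 + 2 * \<omega>) * inverse sqrt_m3 = 3"
    using sqrt_m3_omega by (simp only: mult.assoc mult.commute[of "1 + 2 * \<omega>"] mult_1_right)
  moreover have "(if P then 3 * (1 + 2 * \<omega>) else 0) * inverse sqrt_m3 = (if P then 3 else 0)" for P
    using calculation(2) by (cases P) (simp_all only: if_True if_False mult_zero_left)
  ultimately show ?thesis unfolding coset_trace_def by simp
qed

text \<open>The exponent may stay existential, since summation over the center forgets it. The case
  analysis is carried out on table sums, where a factor 1 + 2 \<omega> still stands for the division
  by \<open>sqrt_m3\<close>.\<close>

lemma coset_trace_unit:
  "\<forall>i<8. \<forall>b<3. \<forall>c<3. i \<noteq> 0 \<longrightarrow> (\<exists>k. coset_trace b c i = (if i = 2 then - (\<omega> ^ k) else \<omega> ^ k))"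
proof -
  have e: "\<forall>i<8. \<forall>b<3. \<forall>c<3. i \<noteq> 0 \<longrightarrow>
    (\<Sum>x<3. \<omega> ^ (b * x) * coset_table ! i ! ((x + c) mod 3) ! x) = (if i = 2 then -1 else 1) * (1 + 2 * \<omega>) \<or>
    (\<Sum>x<3. \<omega> ^ (b * x) * coset_table ! i ! ((x + c) mod 3) ! x) = (if i = 2 then -1 else 1) * (\<omega> * (1 + 2 * \<omega>)) \<or>
    (\<Sum>x<3. \<omega> ^ (b * x) * coset_table ! i ! ((x + c) mod 3) ! x) = (if i = 2 then -1 else 1) * (\<omega>\<^sup>2 * (1 + 2 * \<omega>))"
    by (simp add: all_less_3 all_less_8 sum_lessThan_3 coset_table_def omega_simps)
  show ?thesis
  proof (intro allI impI)
    fix i b c :: nat assume bd: "i < 8" "b < 3" "c < 3" "i \<noteq> 0"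
    let ?S = "\<Sum>x<3. \<omega> ^ (b * x) * coset_table ! i ! ((x + c) mod 3) ! x"
    let ?s = "if i = 2 then -1 else 1 :: complex"
    have "?S = ?s * (1 + 2 * \<omega>) \<or> ?S = ?s * (\<omega> * (1 + 2 * \<omega>)) \<or> ?S = ?s * (\<omega>\<^sup>2 * (1 + 2 * \<omega>))"
      using e bd by blast
    then have "\<exists>k. ?S = ?s * (\<omega> ^ k * (1 + 2 * \<omega>))"
    proof (elim disjE)
      assume "?S = ?s * (1 + 2 * \<omega>)"
      then show ?thesis by (intro exI[of _ 0]) (simp only: power_0 mult_1)
    next
      assume "?S = ?s * (\<omega> * (1 + 2 * \<omega>))"
      then show ?thesis by (intro exI[of _ 1]) (simp only: power_one_right)
    qed (rule exI)
    then obtain k where k: "?S = ?s * (\<omega> ^ k * (1 + 2 * \<omega>))" ..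
    have "coset_trace b c i = ?s * \<omega> ^ k * (inverse sqrt_m3 * (1 + 2 * \<omega>))"
      unfolding coset_trace_def k by (simp only: mult_ac)
    then show "\<exists>k. coset_trace b c i = (if i = 2 then - (\<omega> ^ k) else \<omega> ^ k)"
      unfolding sqrt_m3_omega by (intro exI[of _ k]) simp
  qed
qed

text \<open>Summation over the orbit of t under the center. Group elements and torus points both
  come in such orbits, so this is the common unit of comparison.\<close>

definition center_sum :: "(complex \<Rightarrow> 'a::comm_monoid_add) \<Rightarrow> complex \<Rightarrow> 'a" where
  "center_sum f t = (\<Sum>a<3. f (\<omega> ^ a * t))"

lemma center_sum_omega: "center_sum f (\<omega> ^ k * t) = center_sum f t"
proof (induction k)
  case (Suc k)
  have "center_sum f (\<omega> * u) = center_sum f u" for u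
  proof -
    have "\<omega> * (\<omega> * (\<omega> * u)) = u" by (simp add: omega_mult_left right_diff_distrib)
    note w = this
    show ?thesis
      by (simp add: center_sum_def sum_lessThan_3 power2_eq_square add_ac mult.assoc w)
  qed
  then show ?case using Suc by (simp add: mult.assoc)
qed simp

text \<open>The exponent a runs over the center, leaving nine pairs (b, c) in each of the eight
  cosets. In the coset of 1, one pair has trace 3 and eight have trace 0; the coset of V^2 gives 9
  orbits of -1, and the other six give 54 orbits of 1.\<close>

lemma sum_Sigma_72x3:
  fixes f :: "complex \<Rightarrow> complex"
  shows "(\<Sum>g\<in>Sigma_72x3. f (mat_trace g))
    = center_sum f 3 + 9 * center_sum f (-1) + 54 * center_sum f 1 + 8 * center_sum f 0"
proof -
  have "(\<Sum>g\<in>Sigma_72x3. f (mat_trace g))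
      = (\<Sum>(a, b, c, i)\<in>{..<3} \<times> {..<3} \<times> {..<3} \<times> {..<8}. f (\<omega> ^ a * coset_trace b c i))"
    unfolding Sigma_72x3_eq sigma_elts_eq_image sum.reindex[OF inj_on_sigma_elt]
    by (intro sum.cong refl) (auto simp: mat_trace_sigma_elt)
  also have "\<dots> = (\<Sum>a<3. \<Sum>b<3. \<Sum>c<3. \<Sum>i<8. f (\<omega> ^ a * coset_trace b c i))"
    by (simp add: sum.cartesian_product)
  also have "\<dots> = (\<Sum>b<3. \<Sum>c<3. \<Sum>i<8. center_sum f (coset_trace b c i))"
    unfolding center_sum_def
    by (subst sum.swap, rule sum.cong[OF refl], subst sum.swap, rule sum.cong[OF refl], rule sum.swap)
  also have "\<dots> = (\<Sum>b<3::nat. \<Sum>c<3::nat. \<Sum>i<8::nat. if i = 0 then center_sum f (if b = 0 \<and> c = 0 then 3 else 0)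
      else if i = 2 then center_sum f (-1) else center_sum f 1)"
  proof (intro sum.cong refl)
    fix b c i :: nat assume bd: "b \<in> {..<3}" "c \<in> {..<3}" "i \<in> {..<8}"
    show "center_sum f (coset_trace b c i) = (if i = 0 then center_sum f (if b = 0 \<and> c = 0 then 3 else 0)
      else if i = 2 then center_sum f (-1) else center_sum f 1)"
    proof (cases "i = 0")
      case True
      then show ?thesis using coset_trace_0 bd by simp
    next
      case False
      then obtain k where "coset_trace b c i = (if i = 2 then - (\<omega> ^ k) else \<omega> ^ k)"
        using coset_trace_unit bd by blast
      then show ?thesis
        using False center_sum_omega[of f k "-1"] center_sum_omega[of f k 1] by simp
    qed
  qed
  also have "\<dots> = (\<Sum>b<3::nat. \<Sum>c<3::nat. (center_sum f (if b = 0 \<and> c = 0 then 3 else 0)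
      + center_sum f (-1) + 6 * center_sum f 1))"
    by (intro sum.cong refl) (simp add: eval_nat_numeral)
  also have "\<dots> = center_sum f 3 + 9 * center_sum f (-1) + 54 * center_sum f 1 + 8 * center_sum f 0"
    by (simp add: sum_lessThan_3)
  finally show ?thesis .
qed

definition center_moment :: "nat \<Rightarrow> nat \<Rightarrow> complex \<Rightarrow> complex" where
  "center_moment m n = center_sum (\<lambda>z. z ^ m * cnj z ^ n)"

section \<open>Finitely supported measures on the torus\<close>

text \<open>A common form for the uniform measures and for the measure to be constructed. As
  \<open>ennreal\<close> sends negative weights to 0, the evaluations below ask for nonnegative
  weights.\<close>

definition weighted_points :: "(complex \<times> complex) set \<Rightarrow> (complex \<times> complex \<Rightarrow> real) \<Rightarrow> (complex \<times> complex) measure" where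
  "weighted_points D w = distr (point_measure D (\<lambda>p. ennreal (w p))) borel_T2 (\<lambda>p. p)"

lemma space_borel_T2: "space borel_T2 = T2"
  by (simp add: borel_T2_def space_restrict_space)

lemma sets_weighted_points [simp]: "sets (weighted_points D w) = sets borel_T2"
  by (simp add: weighted_points_def)

context
  fixes D :: "(complex \<times> complex) set" and w :: "complex \<times> complex \<Rightarrow> real"
  assumes D: "finite D" "D \<subseteq> T2" and w: "\<And>p. p \<in> D \<Longrightarrow> 0 \<le> w p"
begin

lemma measurable_id_point_measure: "(\<lambda>p. p) \<in> measurable (point_measure D f) borel_T2"
  using D(2) by (auto simp: space_borel_T2)

lemma emeasure_weighted_points:
  assumes "A \<in> sets borel_T2"
  shows "emeasure (weighted_points D w) A = ennreal (\<Sum>p\<in>D \<inter> A. w p)"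
proof -
  have "emeasure (weighted_points D w) A = emeasure (point_measure D (\<lambda>p. ennreal (w p))) (D \<inter> A)"
    unfolding weighted_points_def
    by (subst emeasure_distr[OF measurable_id_point_measure assms]) (simp add: space_point_measure Int_commute)
  also have "\<dots> = (\<Sum>p\<in>D \<inter> A. ennreal (w p))"
    using D(1) by (intro emeasure_point_measure_finite) auto
  also have "\<dots> = ennreal (\<Sum>p\<in>D \<inter> A. w p)"
    using w by (intro sum_ennreal) auto
  finally show ?thesis .
qed

lemma measure_weighted_points:
  "A \<in> sets borel_T2 \<Longrightarrow> measure (weighted_points D w) A = (\<Sum>p\<in>D \<inter> A. w p)"
  using emeasure_weighted_points[of A] w by (auto simp: measure_def intro!: enn2real_ennreal sum_nonneg)

lemma finite_measure_weighted_points: "finite_measure (weighted_points D w)"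
proof
  have "space (weighted_points D w) \<in> sets borel_T2"
    using sets.top[of "weighted_points D w"] by simp
  then show "emeasure (weighted_points D w) (space (weighted_points D w)) \<noteq> \<infinity>"
    by (simp add: emeasure_weighted_points)
qed

lemma integral_weighted_points:
  fixes f :: "complex \<times> complex \<Rightarrow> complex"
  assumes "f \<in> borel_measurable borel_T2"
  shows "(\<integral>p. f p \<partial>weighted_points D w) = (\<Sum>p\<in>D. w p *\<^sub>R f p)"
  unfolding weighted_points_def
  by (subst integral_distr[OF measurable_id_point_measure assms])
    (use D(1) w in \<open>auto intro!: lebesgue_integral_point_measure_finite\<close>)

end

lemma d_measure_eq: "d_measure N = weighted_points (D_set N) (\<lambda>_. 1 / card (D_set N))"
  by (simp add: d_measure_def weighted_points_def uniform_count_measure_def)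

lemma finite_D_set: "finite (D_set N)"
proof (rule finite_subset)
  show "D_set N \<subseteq> (\<lambda>(q1, q2). (cis (2 * pi * real q1 / (3 * real N)), cis (2 * pi * real q2 / (3 * real N)))) `
      ({..<3*N} \<times> {..<3*N})"
    by (force simp: D_set_def)
qed simp

text \<open>On the torus the angles disappear: the three sines are imaginary parts of monomials in
  the coordinates and their conjugates. This serves both measurability and evaluation at torsion
  points.\<close>

lemma J_fun_T2:
  assumes "norm w1 = 1" "norm w2 = 1"
  shows "J_fun (w1, w2) = 4 * pi\<^sup>2 * (Im (w1 * w2) - Im (w1\<^sup>2 * cnj w2) - Im (w2\<^sup>2 * cnj w1))"
proof -
  obtain x y where "w1 = cis x" "w2 = cis y"
    using rcis_cmod_Arg[of w1] rcis_cmod_Arg[of w2] assms by (simp add: rcis_def) metis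
  define t u where "t = x / (2 * pi)" and "u = y / (2 * pi)"
  have w: "w1 = cis (2 * pi * t)" "w2 = cis (2 * pi * u)"
    using \<open>w1 = cis x\<close> \<open>w2 = cis y\<close> by (simp_all add: t_def u_def)
  have "w1 * w2 = cis (2 * pi * (t + u))" "w1\<^sup>2 * cnj w2 = cis (2 * pi * (2 * t - u))"
    "w2\<^sup>2 * cnj w1 = cis (2 * pi * (2 * u - t))"
    unfolding w power2_eq_square cis_cnj cis_mult by (simp_all add: algebra_simps)
  then show ?thesis
    unfolding w(1,2) J_fun_cis J_angle_def using w by simp
qed

lemma J_fun_measurable: "J_fun \<in> borel_measurable borel_T2"
proof -
  define h where "h p = 4 * pi\<^sup>2 * (Im (fst p * snd p) - Im ((fst p)\<^sup>2 * cnj (snd p)) - Im ((snd p)\<^sup>2 * cnj (fst p)))"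
    for p :: "complex \<times> complex"
  have "continuous_on UNIV h" unfolding h_def by (intro continuous_intros)
  then have "h \<in> borel_measurable borel_T2"
    unfolding borel_T2_def by (intro measurable_restrict_space1 borel_measurable_continuous_onI)
  moreover have "J_fun p = h p" if "p \<in> space borel_T2" for p
    using that J_fun_T2 by (cases p) (auto simp: h_def space_borel_T2 T2_def)
  ultimately show ?thesis by (metis measurable_cong)
qed

text \<open>On the unit circle inversion is conjugation, so the function agrees there with a
  globally continuous one.\<close>

lemma R_fun_measurable: "R_fun m n \<in> borel_measurable borel_T2"
proof -
  define h where "h p = (fst p + cnj (snd p) + cnj (fst p) * snd p) ^ m * (cnj (fst p) + snd p + fst p * cnj (snd p)) ^ n"
    for p :: "complex \<times> complex"
  have "continuous_on UNIV h" unfolding h_def by (intro continuous_intros)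
  then have "h \<in> borel_measurable borel_T2"
    unfolding borel_T2_def by (intro measurable_restrict_space1 borel_measurable_continuous_onI)
  moreover have "R_fun m n p = h p" if "p \<in> space borel_T2" for p
  proof -
    have "inverse w = cnj w" if "norm w = 1" for w :: complex
      using complex_norm_square[of w] that by (intro inverse_unique) simp
    then show ?thesis using that by (cases p) (auto simp: h_def R_fun_def space_borel_T2 T2_def)
  qed
  ultimately show ?thesis by (metis measurable_cong)
qed

lemma J2_measure_eq:
  "A \<in> sets borel_T2 \<Longrightarrow> measure (J2_measure N) A = (\<Sum>p\<in>D_set N \<inter> A. (J_fun p)\<^sup>2 / card (D_set N))"
proof -
  assume A: "A \<in> sets borel_T2"
  let ?c = "1 / real (card (D_set N))"
  note D = finite_D_set[of N] D_set_subset_T2[of N]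
  have s: "sets (d_measure N) = sets borel_T2" by (simp add: d_measure_eq)
  have "J_fun \<in> borel_measurable (d_measure N)"
    unfolding measurable_cong_sets[OF s refl] by (rule J_fun_measurable)
  then have m: "(\<lambda>p. ennreal ((J_fun p)\<^sup>2)) \<in> borel_measurable (d_measure N)" by measurable
  have "emeasure (J2_measure N) A = (\<integral>\<^sup>+p. ennreal ((J_fun p)\<^sup>2) * indicator A p \<partial>d_measure N)"
    unfolding J2_measure_def using A by (intro emeasure_density m) (simp add: d_measure_eq)
  also have "\<dots> = (\<integral>\<^sup>+p. ennreal ((J_fun p)\<^sup>2) * indicator A p \<partial>point_measure (D_set N) (\<lambda>_. ennreal ?c))"
    unfolding d_measure_eq weighted_points_def using A D
    using J_fun_measurable by (intro nn_integral_distr measurable_id_point_measure) auto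
  also have "\<dots> = (\<Sum>p\<in>D_set N. ennreal ?c * (ennreal ((J_fun p)\<^sup>2) * indicator A p))"
    by (rule nn_integral_point_measure_finite[OF D(1)])
  also have "\<dots> = (\<Sum>p\<in>D_set N. ennreal (if p \<in> A then (J_fun p)\<^sup>2 / card (D_set N) else 0))"
    by (intro sum.cong refl) (auto simp: ennreal_mult[symmetric])
  also have "\<dots> = ennreal (\<Sum>p\<in>D_set N. if p \<in> A then (J_fun p)\<^sup>2 / card (D_set N) else 0)"
    by (intro sum_ennreal) auto
  also have "(\<Sum>p\<in>D_set N. if p \<in> A then (J_fun p)\<^sup>2 / card (D_set N) else 0) = (\<Sum>p\<in>D_set N \<inter> A. (J_fun p)\<^sup>2 / card (D_set N))"
    by (rule sum.inter_restrict[OF D(1), symmetric])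
  finally show ?thesis by (simp add: measure_def sum_nonneg)
qed

section \<open>The points of \<open>D_set N\<close>\<close>

text \<open>Here l is q1 and k is (q1 + q2) / 3 modulo N, so the product of the coordinates is an
  N-th root of unity. In these parameters the congruence on q1 + q2 disappears and the points form a
  full 3N by N grid.\<close>

definition torsion_point :: "nat \<Rightarrow> nat \<Rightarrow> nat \<Rightarrow> complex \<times> complex" where
  "torsion_point N l k = (cis (2 * pi / real (3 * N)) ^ l, cis (2 * pi / real N) ^ k * cnj (cis (2 * pi / real (3 * N)) ^ l))"

lemma cis_root_power: "cis (2 * pi / real N) ^ k = cis (2 * pi * real k / real N)"
  by (simp add: DeMoivre mult_ac)

lemma cis_root_power_cube: "(cis (2 * pi / real (3 * N)) ^ l) ^ 3 = cis (2 * pi / real N) ^ l"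
  by (cases "N = 0") (simp_all add: DeMoivre field_simps)

lemma cis_root_power_self: "0 < N \<Longrightarrow> cis (2 * pi / real N) ^ N = 1"
  by (simp add: DeMoivre)

lemma cis_third_root: "0 < N \<Longrightarrow> cis (2 * pi / real (3 * N)) ^ N = \<omega>"
proof -
  assume "0 < N"
  have "\<omega> = cis (2 * pi / 3)" by (simp add: \<omega>_def cis_conv_exp mult_ac)
  with \<open>0 < N\<close> show ?thesis by (simp add: DeMoivre)
qed

lemma inj_on_cis_root_power: "inj_on (\<lambda>k. cis (2 * pi / real N) ^ k) {..<N}"
proof (cases "N = 0")
  case False
  then have "inj_on (\<lambda>k. cis (2 * pi * real k / real N)) {..<N}"
    using bij_betw_roots_unity[of N] by (simp add: bij_betw_def)
  then show ?thesis by (simp only: cis_root_power)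
qed simp

lemma inj_on_torsion_point: "inj_on (\<lambda>(l, k). torsion_point N l k) ({..<3*N} \<times> {..<N})"
proof (rule inj_onI)
  fix x y assume xy: "x \<in> {..<3*N} \<times> {..<N}" "y \<in> {..<3*N} \<times> {..<N}"
    "(\<lambda>(l, k). torsion_point N l k) x = (\<lambda>(l, k). torsion_point N l k) y"
  obtain l k l' k' where x: "x = (l, k)" and y: "y = (l', k')" by (cases x, cases y)
  have bd: "l \<in> {..<3*N}" "k \<in> {..<N}" "l' \<in> {..<3*N}" "k' \<in> {..<N}"
    and eq: "torsion_point N l k = torsion_point N l' k'" using xy by (simp_all add: x y)
  have l: "l = l'"
    using eq inj_onD[OF inj_on_cis_root_power[of "3 * N"] _ bd(1,3)] by (simp add: torsion_point_def)
  have "cnj (cis (2 * pi / real (3 * N)) ^ l) \<noteq> 0" by simp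
  then have "cis (2 * pi / real N) ^ k = cis (2 * pi / real N) ^ k'"
    using eq unfolding torsion_point_def l by (metis mult_right_cancel prod.inject)
  then have "k = k'" using inj_onD[OF inj_on_cis_root_power[of N] _ bd(2,4)] by blast
  with l show "x = y" by (simp add: x y)
qed

text \<open>The integer c absorbs the wrap-around of q modulo 3N, which changes the angle by full
  turns.\<close>

lemma cis_eq_torsion_coordinate:
  assumes "0 < N" "int q + int l = 3 * int k + 3 * int N * c"
  shows "cis (2 * pi * real q / (3 * real N)) = cis (2 * pi / real N) ^ k * cnj (cis (2 * pi / real (3 * N)) ^ l)"
proof -
  have "real_of_int (int q + int l) = real_of_int (3 * int k + 3 * int N * c)" using assms(2) by simp
  then have q: "real q = 3 * real k - real l + 3 * real N * of_int c" by simp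
  have "2 * pi * real q / (3 * real N) = 2 * pi * real k / real N + - (real l * (2 * pi / real (3 * N))) + 2 * pi * of_int c"
    using assms(1) unfolding q by (simp add: field_simps)
  then have "cis (2 * pi * real q / (3 * real N))
      = cis (2 * pi * real k / real N) * cis (- (real l * (2 * pi / real (3 * N)))) * cis (2 * pi * of_int c)"
    by (simp only: cis_mult)
  moreover have "cis (2 * pi * of_int c) = 1" by (rule cis_multiple_2pi) simp
  moreover have "cnj (cis (2 * pi / real (3 * N)) ^ l) = cis (- (real l * (2 * pi / real (3 * N))))"
    unfolding DeMoivre cis_cnj ..
  ultimately show ?thesis by (simp only: cis_root_power[of N k] mult_1_right)
qed

lemma D_set_eq_torsion_points:
  assumes N: "0 < N"
  shows "D_set N = (\<lambda>(l, k). torsion_point N l k) ` ({..<3*N} \<times> {..<N})"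
proof (intro equalityI subsetI)
  fix p assume "p \<in> D_set N"
  then obtain q1 q2 where p: "p = (cis (2 * pi * real q1 / (3 * real N)), cis (2 * pi * real q2 / (3 * real N)))"
    and q: "q1 < 3 * N" "q2 < 3 * N" "(q1 + q2) mod 3 = 0" unfolding D_set_def by (elim CollectE exE conjE)
  define k where "k = (q1 + q2) div 3"
  have "int q2 + int q1 = 3 * int k" using q(3) unfolding k_def by presburger
  also have "int k = int (k mod N) + int N * int (k div N)"
    by (metis mod_mult_div_eq of_nat_add of_nat_mult)
  finally have "int q2 + int q1 = 3 * int (k mod N) + 3 * int N * int (k div N)" by (simp add: algebra_simps)
  note c2 = cis_eq_torsion_coordinate[OF N this]
  have "p = torsion_point N q1 (k mod N)"
    unfolding p torsion_point_def c2 using cis_root_power[of "3 * N" q1] by simp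
  then show "p \<in> (\<lambda>(l, k). torsion_point N l k) ` ({..<3*N} \<times> {..<N})"
    using q(1) N by (intro image_eqI[where x = "(q1, k mod N)"]) auto
next
  fix p assume "p \<in> (\<lambda>(l, k). torsion_point N l k) ` ({..<3*N} \<times> {..<N})"
  then obtain l k where p: "p = torsion_point N l k" and bd: "l < 3 * N" "k < N" by auto
  \<comment> \<open>The summand 3N keeps the subtraction of natural numbers exact, as l <
    3N.\<close>
  define q where "q = (3 * k + 3 * N - l) mod (3 * N)"
  define d where "d = (3 * k + 3 * N - l) div (3 * N)"
  have qd: "3 * k + 3 * N - l = q + 3 * N * d" unfolding q_def d_def by simp
  then have e: "l + q + 3 * N * d = 3 * k + 3 * N" using bd by linarith
  then have "int q + int l = 3 * int k + 3 * int N * (1 - int d)"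
    using arg_cong[OF e, of int] by (simp add: algebra_simps)
  note c2 = cis_eq_torsion_coordinate[OF N this]
  have "p = (cis (2 * pi * real l / (3 * real N)), cis (2 * pi * real q / (3 * real N)))"
    unfolding p torsion_point_def c2 using cis_root_power[of "3 * N" l] by simp
  moreover have "q < 3 * N" using N by (simp add: q_def)
  moreover have "(l + q) mod 3 = 0"
  proof -
    have "(l + q + 3 * (N * d)) mod 3 = (3 * (k + N)) mod 3" using e by (simp add: algebra_simps)
    then show ?thesis by (simp only: mod_mult_self2 mod_mult_self1_is_0)
  qed
  ultimately show "p \<in> D_set N"
    unfolding D_set_def using bd(1) by (intro CollectI exI[of _ l] exI[of _ q] conjI)
qed

lemma card_D_set: "0 < N \<Longrightarrow> card (D_set N) = 3 * N * N"
  by (simp add: D_set_eq_torsion_points card_image[OF inj_on_torsion_point])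

text \<open>\<open>J / (4\<pi>\<^sup>2)\<close> and \<open>\<omega>\<^sub>1 + \<omega>\<^sub>2\<^sup>-\<^sup>1 + \<omega>\<^sub>1\<^sup>-\<^sup>1\<omega>\<^sub>2\<close> (up to a factor) in terms of \<open>s = \<omega>\<^sub>1\<^sup>3\<close> and \<open>e = \<omega>\<^sub>1\<omega>\<^sub>2\<close>.\<close>

definition torsion_J :: "complex \<Rightarrow> complex \<Rightarrow> real" where
  "torsion_J s e = Im e - Im (s * cnj e) - Im (e\<^sup>2 * cnj s)"

definition torsion_trace :: "complex \<Rightarrow> complex \<Rightarrow> complex" where
  "torsion_trace s e = 1 + cnj e + cnj s * e"

text \<open>Substituting e / u for the second coordinate and factoring u out of the trace leaves
  dependence on u^3 and e alone. Multiplying u by \<omega> thus fixes J and only rotates the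
  trace.\<close>

lemma
  assumes "norm u = 1" "norm e = 1"
  shows J_fun_torsion: "J_fun (u, e * cnj u) = 4 * pi\<^sup>2 * torsion_J (u ^ 3) e"
    and R_fun_torsion: "R_fun m n (u, e * cnj u)
      = (u * torsion_trace (u ^ 3) e) ^ m * cnj (u * torsion_trace (u ^ 3) e) ^ n"
proof -
  have uu: "u * cnj u = 1" "e * cnj e = 1" using complex_norm_square[of u] complex_norm_square[of e] assms by simp_all
  have uu': "cnj u * u = 1" "u * (cnj u * z) = z" "cnj u * (u * z) = z" for z
    using uu by (simp_all add: mult.commute[of "cnj u"] mult.assoc[symmetric])
  have "(e * cnj u) * (cnj e * u) = (u * cnj u) * (e * cnj e)" by (simp only: mult_ac)
  then have inv: "inverse u = cnj u" "inverse (e * cnj u) = cnj e * u"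
    using uu by (auto intro!: inverse_unique simp del: inverse_mult_distrib)
  have e: "u * (e * cnj u) = e" "u\<^sup>2 * cnj (e * cnj u) = u ^ 3 * cnj e" "(e * cnj u)\<^sup>2 * cnj u = e\<^sup>2 * cnj (u ^ 3)"
    using uu' by (simp_all add: power2_eq_square power3_eq_cube mult_ac)
  have "norm (e * cnj u) = 1" using assms by (simp add: norm_mult)
  from J_fun_T2[OF assms(1) this]
  show "J_fun (u, e * cnj u) = 4 * pi\<^sup>2 * torsion_J (u ^ 3) e"
    unfolding e torsion_J_def .
  have t: "u + inverse (e * cnj u) + inverse u * (e * cnj u) = u * torsion_trace (u ^ 3) e"
    unfolding inv torsion_trace_def by (simp add: power3_eq_cube distrib_left mult_ac uu')
  moreover have "inverse u + e * cnj u + u * inverse (e * cnj u) = cnj (u * torsion_trace (u ^ 3) e)"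
    unfolding t[symmetric] inv by (simp add: mult_ac)
  ultimately show "R_fun m n (u, e * cnj u)
      = (u * torsion_trace (u ^ 3) e) ^ m * cnj (u * torsion_trace (u ^ 3) e) ^ n"
    by (simp add: R_fun_def)
qed

text \<open>With l = N a + j, the index a becomes the center: the N-th power of the primitive 3N-th
  root is \<omega>.\<close>

lemma sum_lessThan_3_mult:
  fixes F :: "nat \<Rightarrow> 'a::comm_monoid_add"
  shows "(\<Sum>l<3*N. F l) = (\<Sum>j<N. \<Sum>a<3. F (N * a + j))"
proof -
  have "(\<Sum>l<3*N. F l) = (\<Sum>l<3*N. F (N * (l div N) + l mod N))" by simp
  also have "\<dots> = (\<Sum>a<3. \<Sum>j<N. F (N * a + j))" by (rule sum_div_mod)
  also have "\<dots> = (\<Sum>j<N. \<Sum>a<3. F (N * a + j))" by (rule sum.swap)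
  finally show ?thesis .
qed

text \<open>The 3 N^2 points fall into N^2 center orbits, on each of which J is constant. The
  function \<phi> is the constant 1 for the uniform measures and the square for the weights
  J^2.\<close>

lemma sum_D_set:
  fixes \<phi> :: "real \<Rightarrow> complex"
  assumes N: "0 < N"
  defines "\<zeta> \<equiv> cis (2 * pi / real (3 * N))" and "\<eta> \<equiv> cis (2 * pi / real N)"
  shows "(\<Sum>p\<in>D_set N. \<phi> (J_fun p) * R_fun m n p)
    = (\<Sum>l<N. \<Sum>k<N. \<phi> (4 * pi\<^sup>2 * torsion_J (\<eta> ^ l) (\<eta> ^ k)) * center_moment m n (\<zeta> ^ l * torsion_trace (\<eta> ^ l) (\<eta> ^ k)))"
proof -
  define c where "c l k = \<phi> (4 * pi\<^sup>2 * torsion_J (\<eta> ^ l) (\<eta> ^ k))" for l k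
  define f where "f = (\<lambda>z. z ^ m * cnj z ^ n)"
  have F: "\<phi> (J_fun (torsion_point N l k)) * R_fun m n (torsion_point N l k)
      = c l k * f (\<zeta> ^ l * torsion_trace (\<eta> ^ l) (\<eta> ^ k))" for l k
  proof -
    have n: "norm (\<zeta> ^ l) = 1" "norm (\<eta> ^ k) = 1" by (simp_all add: \<zeta>_def \<eta>_def norm_power)
    have "(\<zeta> ^ l) ^ 3 = \<eta> ^ l" unfolding \<zeta>_def \<eta>_def by (rule cis_root_power_cube)
    then show ?thesis
      using J_fun_torsion[OF n] R_fun_torsion[OF n, of m n]
      unfolding torsion_point_def \<zeta>_def[symmetric] \<eta>_def[symmetric] c_def f_def by simp
  qed
  have eta: "\<eta> ^ (N * a + j) = \<eta> ^ j" for a j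
    unfolding power_add power_mult using cis_root_power_self[OF N] by (simp add: \<eta>_def)
  have zeta: "\<zeta> ^ (N * a + j) = \<omega> ^ a * \<zeta> ^ j" for a j
    unfolding power_add power_mult using cis_third_root[OF N] by (simp add: \<zeta>_def)
  have "(\<Sum>p\<in>D_set N. \<phi> (J_fun p) * R_fun m n p) = (\<Sum>l<3*N. \<Sum>k<N. c l k * f (\<zeta> ^ l * torsion_trace (\<eta> ^ l) (\<eta> ^ k)))"
    unfolding D_set_eq_torsion_points[OF N] sum.reindex[OF inj_on_torsion_point]
    by (simp add: sum.cartesian_product F case_prod_unfold)
  also have "\<dots> = (\<Sum>l<N. \<Sum>a<3. \<Sum>k<N. c l k * f (\<omega> ^ a * (\<zeta> ^ l * torsion_trace (\<eta> ^ l) (\<eta> ^ k))))"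
    unfolding sum_lessThan_3_mult by (simp add: eta zeta c_def mult.assoc)
  also have "\<dots> = (\<Sum>l<N. \<Sum>k<N. c l k * center_sum f (\<zeta> ^ l * torsion_trace (\<eta> ^ l) (\<eta> ^ k)))"
    unfolding center_sum_def sum_distrib_left by (intro sum.cong refl sum.swap)
  finally show ?thesis unfolding c_def f_def center_moment_def .
qed

section \<open>The spectral measure\<close>

lemma center_moment_omega: "center_moment m n (\<omega> ^ k * t) = center_moment m n t"
  unfolding center_moment_def by (rule center_sum_omega)

lemma sum_D_set_1: "(\<Sum>p\<in>D_set 1. R_fun m n p) = center_moment m n 3"
  using sum_D_set[of 1 "\<lambda>_. 1" m n] by (simp add: torsion_trace_def)

lemma sum_D_set_2: "(\<Sum>p\<in>D_set 2. R_fun m n p) = center_moment m n 3 + 3 * center_moment m n (-1)"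
proof -
  have e: "cis (2 * pi / real 2) = -1" by simp
  \<comment> \<open>Splitting a sixth root of unity into a central factor and a sign lets the center
    sum discard the former. The same is done for twelfth roots when N = 4.\<close>
  have "cis (pi / 3) = \<omega> ^ 2 * - 1"
    by (simp add: complex_eq_iff omega_powers Re_omega Im_omega cos_60 sin_60)
  then have z: "cis (2 * pi / real (3 * 2)) = \<omega> ^ 2 * - 1" by simp
  have C: "center_moment m n ((\<omega> ^ 2 * - 1) ^ l * t) = center_moment m n ((- 1) ^ l * t)" for l t
    unfolding power_mult_distrib power_mult[symmetric] mult.assoc by (rule center_moment_omega)
  have s: "(\<Sum>i<2. f i) = f 0 + f 1" for f :: "nat \<Rightarrow> complex"
    by (simp add: numeral_2_eq_2)
  show ?thesis
    using sum_D_set[of 2 "\<lambda>_. 1" m n] unfolding e z C s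
    by (simp add: torsion_trace_def)
qed

text \<open>Of the nine pairs (s, e) only s = 1 with e = \<omega> or e = \<omega>^2 has J nonzero.
  There the trace vanishes and J^2 = 108 pi^4, which gives the total 216 pi^4.\<close>

lemma sum_J2_D_set_3:
  "(\<Sum>p\<in>D_set 3. of_real ((J_fun p)\<^sup>2) * R_fun m n p) = of_real (216 * pi ^ 4) * center_moment m n 0"
proof -
  have e: "cis (2 * pi / real 3) = \<omega>"
    by (simp add: complex_eq_iff Re_omega Im_omega cos_120 sin_120)
  have J: "torsion_J 1 1 = 0"
    "torsion_J 1 \<omega> = 3 * sqrt 3 / 2"
    "torsion_J 1 (\<omega>\<^sup>2) = - (3 * sqrt 3 / 2)"
    "torsion_J \<omega> 1 = 0"
    "torsion_J \<omega> \<omega> = 0"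
    "torsion_J \<omega> (\<omega>\<^sup>2) = 0"
    "torsion_J (\<omega>\<^sup>2) 1 = 0"
    "torsion_J (\<omega>\<^sup>2) \<omega> = 0"
    "torsion_J (\<omega>\<^sup>2) (\<omega>\<^sup>2) = 0"
    by (simp_all add: torsion_J_def power2_eq_square Re_omega Im_omega)
  have t: "torsion_trace 1 \<omega> = 0" "torsion_trace 1 (\<omega>\<^sup>2) = 0"
    by (simp_all add: torsion_trace_def omega_powers cnj_omega)
  have sq: "(4 * pi\<^sup>2 * (3 * sqrt 3 / 2))\<^sup>2 = 108 * pi ^ 4" "(4 * pi\<^sup>2 * - (3 * sqrt 3 / 2))\<^sup>2 = 108 * pi ^ 4"
    by (simp_all add: power_mult_distrib power_divide flip: power_mult)
  show ?thesis
    using sum_D_set[of 3 "\<lambda>x. of_real (x\<^sup>2)" m n] unfolding e sum_lessThan_3 power_0 power_one_right J t sq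
    by simp
qed

text \<open>J is nonzero at six of the sixteen pairs, with J^2 = 64 pi^4, hence 384 pi^4.\<close>

lemma sum_J2_D_set_4:
  "(\<Sum>p\<in>D_set 4. of_real ((J_fun p)\<^sup>2) * R_fun m n p) = of_real (384 * pi ^ 4) * center_moment m n 1"
proof -
  have e: "cis (2 * pi / real 4) = \<i>" by simp
  have "cis (pi / 6) = \<omega> * - \<i>"
    by (simp add: complex_eq_iff Re_omega Im_omega cos_30 sin_30)
  then have z: "cis (2 * pi / real (3 * 4)) = \<omega> * - \<i>" by simp
  have C: "center_moment m n ((\<omega> * - \<i>) ^ l * t) = center_moment m n ((- \<i>) ^ l * t)" for l t
    unfolding power_mult_distrib mult.assoc by (rule center_moment_omega)
  have s: "(\<Sum>i<4. f i) = f 0 + f 1 + f 2 + f 3" for f :: "nat \<Rightarrow> complex"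
    by (simp add: eval_nat_numeral)
  have i: "\<i> ^ 2 = - 1" "\<i> ^ 3 = - \<i>" "(- \<i>) ^ 2 = - 1" "(- \<i>) ^ 3 = \<i>"
    by (simp_all add: power3_eq_cube)
  have J: "torsion_J 1 1 = 0"
    "torsion_J 1 \<i> = 2"
    "torsion_J 1 (- 1) = 0"
    "torsion_J 1 (- \<i>) = - 2"
    "torsion_J \<i> 1 = 0"
    "torsion_J \<i> \<i> = 0"
    "torsion_J \<i> (- 1) = 2"
    "torsion_J \<i> (- \<i>) = - 2"
    "torsion_J (- 1) 1 = 0"
    "torsion_J (- 1) \<i> = 0"
    "torsion_J (- 1) (- 1) = 0"
    "torsion_J (- 1) (- \<i>) = 0"
    "torsion_J (- \<i>) 1 = 0"
    "torsion_J (- \<i>) \<i> = 2"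
    "torsion_J (- \<i>) (- 1) = - 2"
    "torsion_J (- \<i>) (- \<i>) = 0"
    by (simp_all add: torsion_J_def)
  \<comment> \<open>At each of the six pairs the value is \<i>^l, cancelled by the factor (-\<i>)^l
    left over from the twelfth root, so every orbit is that of 1.\<close>
  have t: "torsion_trace 1 \<i> = 1"
    "torsion_trace 1 (- \<i>) = 1"
    "torsion_trace \<i> (- 1) = \<i>"
    "torsion_trace \<i> (- \<i>) = \<i>"
    "torsion_trace (- \<i>) \<i> = - \<i>"
    "torsion_trace (- \<i>) (- 1) = - \<i>"
    by (simp_all add: torsion_trace_def)
  have sq: "(4 * pi\<^sup>2 * 2)\<^sup>2 = 64 * pi ^ 4" "(4 * pi\<^sup>2 * - 2)\<^sup>2 = 64 * pi ^ 4"
    by (simp_all add: power_mult_distrib flip: power_mult)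
  show ?thesis
    using sum_D_set[of 4 "\<lambda>x. of_real (x\<^sup>2)" m n]
    unfolding e z C s power_0 power_one_right i J t sq by simp
qed

lemma sum_Int_if:
  fixes f :: "'a \<Rightarrow> 'b::comm_monoid_add"
  assumes "finite D" "E \<subseteq> D"
  shows "(\<Sum>p\<in>D \<inter> A. if p \<in> E then f p else 0) = (\<Sum>p\<in>E \<inter> A. f p)"
proof -
  have "(\<Sum>p\<in>D \<inter> A. if p \<in> E then f p else 0) = (\<Sum>p\<in>D \<inter> A \<inter> E. f p)"
    using assms(1) by (intro sum.inter_restrict[symmetric]) simp
  also have "D \<inter> A \<inter> E = E \<inter> A" using assms(2) by blast
  finally show ?thesis .
qed

text \<open>Makes the signed combination positive: on these points the weight -1/108 is outweighed
  by 1/72.\<close>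

lemma D_set_1_subset_2: "D_set 1 \<subseteq> D_set 2"
proof
  fix p assume "p \<in> D_set 1"
  then obtain q1 q2 where p: "p = (cis (2 * pi * real q1 / (3 * real 1)), cis (2 * pi * real q2 / (3 * real 1)))"
    and q: "q1 < 3 * 1" "q2 < 3 * 1" "(q1 + q2) mod 3 = 0" unfolding D_set_def by (elim CollectE exE conjE)
  have "p = (cis (2 * pi * real (2 * q1) / (3 * real 2)), cis (2 * pi * real (2 * q2) / (3 * real 2)))"
    unfolding p by (simp add: mult.assoc)
  moreover have "2 * q1 < 3 * 2" "2 * q2 < 3 * 2" using q by auto
  moreover have "(2 * q1 + 2 * q2) mod 3 = 0" using q(3) by presburger
  ultimately show "p \<in> D_set 2"
    unfolding D_set_def by (intro CollectI exI[of _ "2 * q1"] exI[of _ "2 * q2"] conjI)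
qed

lemma mckay_moment_Sigma_72x3:
  "mckay_moment Sigma_72x3 m n = (center_moment n m 3 + 9 * center_moment n m (-1)
    + 54 * center_moment n m 1 + 8 * center_moment n m 0) / 216"
  unfolding mckay_moment_eq_average[OF subgroup_Sigma_72x3 finite_Sigma_72x3 group_SU]
    card_Sigma_72x3 sum_Sigma_72x3[of "\<lambda>z. z ^ n * cnj z ^ m"] center_moment_def by simp

text \<open>For real t, conjugation exchanges the summands at \<omega> t and \<omega>^2 t and fixes
  the one at t. This reconciles the exponent order of the graph moments with that of
  \<open>R_fun\<close>.\<close>

lemma center_moment_swap: "cnj t = t \<Longrightarrow> center_moment n m t = center_moment m n t"
proof -
  assume t: "cnj t = t"
  have w: "cnj \<omega> = \<omega>\<^sup>2" "cnj (\<omega>\<^sup>2) = \<omega>" by (simp_all add: omega_powers cnj_omega omega_mult_self power2_eq_square algebra_simps)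
  have "center_moment n m t = t ^ n * t ^ m + ((\<omega> * t) ^ n * (\<omega>\<^sup>2 * t) ^ m + (\<omega>\<^sup>2 * t) ^ n * (\<omega> * t) ^ m)" for n m
    unfolding center_moment_def center_sum_def sum_lessThan_3 using w t by (simp add: add.assoc)
  then show ?thesis by (simp add: mult.commute add.commute)
qed

theorem theorem3p6:
  shows "card Sigma_72x3 = 216 \<and>
    (\<exists>\<epsilon>. spectral_measure_T2 Sigma_72x3 \<epsilon> \<and>
      (\<forall>A\<in>sets borel_T2. measure \<epsilon> A =
         1 / (32 * pi ^ 4) * measure (J2_measure 4) A
       + 1 / (216 * pi ^ 4) * measure (J2_measure 3) A
       + 1 / 6 * measure (d_measure 2) A
       - 1 / 36 * measure (d_measure 1) A))"
proof -
  define w4 where "w4 p = 1 / (32 * pi ^ 4) * ((J_fun p)\<^sup>2 / real (card (D_set 4)))" for p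
  define w3 where "w3 p = 1 / (216 * pi ^ 4) * ((J_fun p)\<^sup>2 / real (card (D_set 3)))" for p
  \<comment> \<open>Measures cannot be subtracted, so the signed combination is formed pointwise on
    the supports and shown nonnegative. The constants are 1/72 = 1/6 * 1/12 and 1/108 = 1/36 * 1/3,
    from 12 and 3 equally weighted points.\<close>
  define w where "w p = (if p \<in> D_set 4 then w4 p else 0) + (if p \<in> D_set 3 then w3 p else 0)
    + (if p \<in> D_set 2 then 1 / 72 else 0) - (if p \<in> D_set 1 then 1 / 108 else 0)" for p
  define D where "D = D_set 4 \<union> D_set 3 \<union> D_set 2 \<union> D_set 1"
  have card: "card (D_set 4) = 48" "card (D_set 3) = 27" "card (D_set 2) = 12" "card (D_set 1) = 3"
    using card_D_set[of 4] card_D_set[of 3] card_D_set[of 2] card_D_set[of 1] by simp_all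
  have fin: "finite D" and DT: "D \<subseteq> T2"
    using finite_D_set D_set_subset_T2 by (auto simp: D_def)
  have "0 \<le> w4 p" "0 \<le> w3 p" for p by (simp_all add: w4_def w3_def)
  note nn = this
  have pos: "0 \<le> w p" for p
    using nn(1)[of p] nn(2)[of p] D_set_1_subset_2 by (auto simp: w_def simp del: One_nat_def)
  define \<epsilon> where "\<epsilon> = weighted_points D w"
  have sub: "D_set 4 \<subseteq> D" "D_set 3 \<subseteq> D" "D_set 2 \<subseteq> D" "D_set 1 \<subseteq> D" by (auto simp: D_def)
  have dm: "measure (d_measure N) A = (\<Sum>p\<in>D_set N \<inter> A. 1 / real (card (D_set N)))"
    if "A \<in> sets borel_T2" for N A
    unfolding d_measure_eq by (rule measure_weighted_points[OF finite_D_set D_set_subset_T2 _ that]) simp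
  have "measure \<epsilon> A = 1 / (32 * pi ^ 4) * measure (J2_measure 4) A + 1 / (216 * pi ^ 4) * measure (J2_measure 3) A
       + 1 / 6 * measure (d_measure 2) A - 1 / 36 * measure (d_measure 1) A" if A: "A \<in> sets borel_T2" for A
  proof -
    have "measure \<epsilon> A = (\<Sum>p\<in>D \<inter> A. w p)"
      unfolding \<epsilon>_def by (rule measure_weighted_points[OF fin DT pos A])
    also have "\<dots> = (\<Sum>p\<in>D_set 4 \<inter> A. w4 p) + (\<Sum>p\<in>D_set 3 \<inter> A. w3 p)
        + (\<Sum>p\<in>D_set 2 \<inter> A. 1 / 72) - (\<Sum>p\<in>D_set 1 \<inter> A. 1 / 108)"
      unfolding w_def sum_subtractf sum.distrib sum_Int_if[OF fin sub(1)] sum_Int_if[OF fin sub(2)]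
        sum_Int_if[OF fin sub(3)] sum_Int_if[OF fin sub(4)] ..
    also have "(\<Sum>p\<in>D_set 4 \<inter> A. w4 p) = 1 / (32 * pi ^ 4) * measure (J2_measure 4) A"
      unfolding w4_def J2_measure_eq[OF A] sum_distrib_left ..
    also have "(\<Sum>p\<in>D_set 3 \<inter> A. w3 p) = 1 / (216 * pi ^ 4) * measure (J2_measure 3) A"
      unfolding w3_def J2_measure_eq[OF A] sum_distrib_left ..
    finally show ?thesis by (simp add: dm[OF A] card del: One_nat_def)
  qed
  moreover have "spectral_measure_T2 Sigma_72x3 \<epsilon>"
    unfolding spectral_measure_T2_def
  proof (intro conjI allI)
    show "sets \<epsilon> = sets borel_T2" by (simp add: \<epsilon>_def)
    show "finite_measure \<epsilon>" unfolding \<epsilon>_def by (rule finite_measure_weighted_points[OF fin DT pos])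
    fix m n
    let ?R = "R_fun m n"
    have if_of_real: "(if P then x else 0) *\<^sub>R z = (if P then of_real x * z else 0)" for P x and z :: complex
      by (simp add: scaleR_conv_of_real)
    \<comment> \<open>Intersecting with \<open>UNIV\<close> puts the sum in the form of
      \<open>sum_Int_if\<close>, as for the measures of sets above.\<close>
    have "(\<integral>p. ?R p \<partial>\<epsilon>) = (\<Sum>p\<in>D \<inter> UNIV. w p *\<^sub>R ?R p)"
      unfolding \<epsilon>_def by (subst integral_weighted_points[OF fin DT pos R_fun_measurable]) auto
    also have "\<dots> = (\<Sum>p\<in>D_set 4 \<inter> UNIV. of_real (w4 p) * ?R p) + (\<Sum>p\<in>D_set 3 \<inter> UNIV. of_real (w3 p) * ?R p)
        + (\<Sum>p\<in>D_set 2 \<inter> UNIV. of_real (1 / 72) * ?R p) - (\<Sum>p\<in>D_set 1 \<inter> UNIV. of_real (1 / 108) * ?R p)"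
      unfolding w_def scaleR_add_left scaleR_diff_left if_of_real sum_subtractf sum.distrib
        sum_Int_if[OF fin sub(1)] sum_Int_if[OF fin sub(2)] sum_Int_if[OF fin sub(3)] sum_Int_if[OF fin sub(4)] ..
    also have "(\<Sum>p\<in>D_set 4 \<inter> UNIV. of_real (w4 p) * ?R p)
        = of_real (1 / (32 * pi ^ 4) / 48) * (\<Sum>p\<in>D_set 4. of_real ((J_fun p)\<^sup>2) * ?R p)"
      unfolding sum_distrib_left w4_def card by (intro sum.cong) (auto simp: field_simps)
    also have "(\<Sum>p\<in>D_set 3 \<inter> UNIV. of_real (w3 p) * ?R p)
        = of_real (1 / (216 * pi ^ 4) / 27) * (\<Sum>p\<in>D_set 3. of_real ((J_fun p)\<^sup>2) * ?R p)"
      unfolding sum_distrib_left w3_def card by (intro sum.cong) (auto simp: field_simps)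
    also have "(\<Sum>p\<in>D_set 2 \<inter> UNIV. of_real (1 / 72) * ?R p) = of_real (1 / 72) * (\<Sum>p\<in>D_set 2. ?R p)"
      by (simp add: sum_distrib_left)
    also have "(\<Sum>p\<in>D_set 1 \<inter> UNIV. of_real (1 / 108) * ?R p) = of_real (1 / 108) * (\<Sum>p\<in>D_set 1. ?R p)"
      by (simp add: sum_distrib_left)
    finally have "(\<integral>p. ?R p \<partial>\<epsilon>) = of_real (1 / (32 * pi ^ 4) / 48 * (384 * pi ^ 4)) * center_moment m n 1
        + of_real (1 / (216 * pi ^ 4) / 27 * (216 * pi ^ 4)) * center_moment m n 0
        + of_real (1 / 72) * (center_moment m n 3 + 3 * center_moment m n (-1)) - of_real (1 / 108) * center_moment m n 3"
      unfolding sum_J2_D_set_4 sum_J2_D_set_3 sum_D_set_2 sum_D_set_1 mult.assoc[symmetric] of_real_mult[symmetric] .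
    \<comment> \<open>The coefficients become 1/4 = 54/216 at 1, 1/27 = 8/216 at 0, 3/72 = 9/216 at
      -1 and 1/72 - 1/108 = 1/216 at 3.\<close>
    also have "\<dots> = mckay_moment Sigma_72x3 m n"
      unfolding mckay_moment_Sigma_72x3
      by (simp add: center_moment_swap[of 3 n m] center_moment_swap[of "-1" n m] center_moment_swap[of 1 n m]
          center_moment_swap[of 0 n m] field_simps)
    finally show "(\<integral>p. ?R p \<partial>\<epsilon>) = mckay_moment Sigma_72x3 m n" .
  qed
  ultimately show ?thesis using card_Sigma_72x3 by blast
qed

end
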